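(* Let $\rho>0$. Take $0<\mu<2/\rho$ and an integer $k\ge0$, and consider the operator $L$ in the space $X_{k,\mu}$, with domain $X_{k+1,\mu}$. Then $L$ has a spectral gap in $X_{k,\mu}$; more precisely, there is some constant $K=K(k,\mu,\rho)>0$ such that $$\|e^{tL}h^0\|_{k,\mu}\le K\,\|h^0\|_{k,\mu}\,e^{-t}\qquad (t\ge 0)$$ for any $h^0\in X_{k,\mu}$.
   Context: All functions live on $(0,\infty)$; integrals without limits are over $(0,\infty)$; $L^2(e^{\mu y})=L^2((0,\infty);e^{\mu y}dy)$; convolution is $(u*v)(y)=\int_0^y u(x)v(y-x)\,dx$. Fix $\rho>0$ and $g_\rho(y)=\frac4\rho e^{-2y/\rho}$. For a function $h$ integrable on $(\epsilon,\infty)$ for all $\epsilon>0$, $H(y):=\int_y^\infty h(x)\,dx$. For $\mu>0$ and integer $k\ge0$ define $X_{k,\mu}:=\{h\mid y^{k+1}D^kh\in L^2(e^{\mu y}),\ \int y\,h=0\}$ (derivatives in the sense of distributions on $(0,\infty)$), with Hilbert norm $\|h\|_{k,\mu}^2:=\int_0^\infty y^{2(k+1)}(D^kh)^2e^{\mu y}\,dy$. The linearized self-similar coagulation operator is $$Lh:=y\,\partial_yh-\frac4\rho H+\frac2\rho\,H*g_\rho ,$$ with $\partial_y h$ in the sense of distributions. For $0<\mu<4/\rho$ and integer $k\ge0$, $L$ maps $X_{k+1,\mu}$ into $X_{k,\mu}$ and, as an unbounded operator on $X_{k,\mu}$ with domain $X_{k+1,\mu}$, generates an evolution semigroup $e^{tL}$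 on $X_{k,\mu}$. *)

theory Defs
  imports "HOL-Analysis.Analysis"
begin

text \<open>
  Functions on the half-line are represented by total functions \<^typ>\<open>real \<Rightarrow> real\<close> of which only
  the values on \<open>{0<..}\<close> matter. The function spaces are sets of such representatives, and
  elements are identified when they agree almost everywhere on \<open>{0<..}\<close>.
\<close>

definition ae_eq :: "(real \<Rightarrow> real) \<Rightarrow> (real \<Rightarrow> real) \<Rightarrow> bool" (infix "\<approx>\<^sub>+" 50) where
  "f \<approx>\<^sub>+ g \<longleftrightarrow> (AE y in lborel. y > 0 \<longrightarrow> f y = g y)"

definition loc_integrable :: "(real \<Rightarrow> real) \<Rightarrow> bool" where
  "loc_integrable f \<longleftrightarrow> (\<forall>a b. 0 < a \<longrightarrow> a \<le> b \<longrightarrow> set_integrable lborel {a..b} f)"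

definition test_function :: "(real \<Rightarrow> real) \<Rightarrow> bool" where
  "test_function \<phi> \<longleftrightarrow>
     (\<forall>n x. (deriv ^^ n) \<phi> field_differentiable at x) \<and>
     (\<exists>a b. 0 < a \<and> a \<le> b \<and> (\<forall>x. x \<notin> {a..b} \<longrightarrow> \<phi> x = 0))"

definition has_weak_deriv :: "nat \<Rightarrow> (real \<Rightarrow> real) \<Rightarrow> (real \<Rightarrow> real) \<Rightarrow> bool" where
  "has_weak_deriv n f g \<longleftrightarrow>
     loc_integrable f \<and> loc_integrable g \<and>
     (\<forall>\<phi>. test_function \<phi> \<longrightarrow>
        (LINT y:{0<..}|lborel. f y * (deriv ^^ n) \<phi> y)
          = (-1) ^ n * (LINT y:{0<..}|lborel. g y * \<phi> y))"

text \<open>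
  A representative of the distributional derivative \<open>D\<^sup>n f\<close>, meaningful when this is a
  locally integrable function; it is then determined up to \<^const>\<open>ae_eq\<close>.
\<close>
definition weak_deriv :: "nat \<Rightarrow> (real \<Rightarrow> real) \<Rightarrow> real \<Rightarrow> real" where
  "weak_deriv n f = (SOME g. has_weak_deriv n f g)"

definition L2_exp :: "real \<Rightarrow> (real \<Rightarrow> real) set" where
  "L2_exp \<mu> = {f. set_borel_measurable lborel {0<..} f \<and>
                  set_integrable lborel {0<..} (\<lambda>y. (f y)\<^sup>2 * exp (\<mu> * y))}"

text \<open>
  Since \<open>y\<^sup>k\<^sup>+\<^sup>1 D\<^sup>k h \<in> L\<^sup>2(e\<^sup>\<mu>\<^sup>y)\<close> makes \<open>D\<^sup>k h\<close> locally square integrable, the distribution \<open>h\<close> is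
  itself a function, so nothing is lost by starting from functions. The condition \<open>\<integral> y h = 0\<close>
  includes integrability of \<open>y h\<close>, which the Bochner integral (0 for non-integrable functions)
  would not enforce. It cannot be omitted: for \<open>k \<ge> 1\<close> it excludes polynomials of degree
  less than \<open>k\<close>.
\<close>
definition X_space :: "nat \<Rightarrow> real \<Rightarrow> (real \<Rightarrow> real) set" where
  "X_space k \<mu> =
     {h. (\<exists>g. has_weak_deriv k h g) \<and>
         (\<lambda>y. y ^ (k + 1) * weak_deriv k h y) \<in> L2_exp \<mu> \<and>
         set_integrable lborel {0<..} (\<lambda>y. y * h y) \<and>
         (LINT y:{0<..}|lborel. y * h y) = 0}"

definition X_norm :: "nat \<Rightarrow> real \<Rightarrow> (real \<Rightarrow> real) \<Rightarrow> real" where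
  "X_norm k \<mu> h =
     sqrt (LINT y:{0<..}|lborel. y ^ (2 * (k + 1)) * (weak_deriv k h y)\<^sup>2 * exp (\<mu> * y))"

definition tail_integral :: "(real \<Rightarrow> real) \<Rightarrow> real \<Rightarrow> real" where
  "tail_integral h y = (LINT x:{y<..}|lborel. h x)"

definition convolution :: "(real \<Rightarrow> real) \<Rightarrow> (real \<Rightarrow> real) \<Rightarrow> real \<Rightarrow> real" where
  "convolution u v y = (LINT x:{0<..<y}|lborel. u x * v (y - x))"

definition g_profile :: "real \<Rightarrow> real \<Rightarrow> real" where
  "g_profile \<rho> y = 4 / \<rho> * exp (- 2 * y / \<rho>)"

definition coag_L :: "real \<Rightarrow> (real \<Rightarrow> real) \<Rightarrow> real \<Rightarrow> real" where
  "coag_L \<rho> h y =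
     y * weak_deriv 1 h y - 4 / \<rho> * tail_integral h y
       + 2 / \<rho> * convolution (tail_integral h) (g_profile \<rho>) y"

text \<open>
  A strongly continuous semigroup of bounded linear operators on the normed space consisting of
  the \<^const>\<open>ae_eq\<close>-classes of a set \<open>X\<close> of functions with norm \<open>N\<close>.
\<close>
definition C0_semigroup ::
  "(real \<Rightarrow> real) set \<Rightarrow> ((real \<Rightarrow> real) \<Rightarrow> real) \<Rightarrow> (real \<Rightarrow> (real \<Rightarrow> real) \<Rightarrow> real \<Rightarrow> real) \<Rightarrow> bool"
where
  "C0_semigroup X N S \<longleftrightarrow>
     (\<forall>t\<ge>0. \<forall>h\<in>X. S t h \<in> X) \<and>
     (\<forall>t\<ge>0. \<forall>f\<in>X. \<forall>g\<in>X. f \<approx>\<^sub>+ g \<longrightarrow> S t f \<approx>\<^sub>+ S t g) \<and>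
     (\<forall>t\<ge>0. \<forall>f\<in>X. \<forall>g\<in>X. \<forall>a b.
        S t (\<lambda>y. a * f y + b * g y) \<approx>\<^sub>+ (\<lambda>y. a * S t f y + b * S t g y)) \<and>
     (\<forall>t\<ge>0. \<exists>M. \<forall>h\<in>X. N (S t h) \<le> M * N h) \<and>
     (\<forall>h\<in>X. S 0 h \<approx>\<^sub>+ h) \<and>
     (\<forall>s\<ge>0. \<forall>t\<ge>0. \<forall>h\<in>X. S (s + t) h \<approx>\<^sub>+ S s (S t h)) \<and>
     (\<forall>h\<in>X. ((\<lambda>t. N (\<lambda>y. S t h y - h y)) \<longlongrightarrow> 0) (at_right 0))"

text \<open>
  The unbounded operator \<open>A\<close> on \<open>X\<close> with domain \<open>D\<close> generates \<open>S\<close>: the infinitesimal generator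
  of \<open>S\<close> coincides with \<open>A\<close>, including its domain. Such an \<open>S\<close> is unique up to
  \<^const>\<open>ae_eq\<close> and is what is denoted by \<open>e\<^sup>t\<^sup>A\<close>.
\<close>
definition generates_semigroup ::
  "(real \<Rightarrow> real) set \<Rightarrow> ((real \<Rightarrow> real) \<Rightarrow> real) \<Rightarrow> (real \<Rightarrow> real) set \<Rightarrow>
   ((real \<Rightarrow> real) \<Rightarrow> real \<Rightarrow> real) \<Rightarrow> (real \<Rightarrow> (real \<Rightarrow> real) \<Rightarrow> real \<Rightarrow> real) \<Rightarrow> bool"
where
  "generates_semigroup X N D A S \<longleftrightarrow>
     D \<subseteq> X \<and> A ` D \<subseteq> X \<and> C0_semigroup X N S \<and>
     (\<forall>h\<in>X. \<forall>f\<in>X.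
        ((\<lambda>t. N (\<lambda>y. (S t h y - h y) / t - f y)) \<longlongrightarrow> 0) (at_right 0)
          \<longleftrightarrow> h \<in> D \<and> f \<approx>\<^sub>+ A h)"

end

(*
  Write I f for the tail integral of f, a = 2 / rho and F = D^k h. On functions with zero first
  moment, (1 - a I)^2 conjugates L to y D, a generator of dilations, because the convolution with
  exp (- a y) is inverted by 1 - a I. Dilations decay at rate 3/2 in the weighted L^2 norm, since
  the derivative of y^(2k+3) exp (mu y) dominates (2k+3) y^(2k+2) exp (mu y). The operator
  1 - a I has kernel spanned by exp (- a y) and is bounded below once one moment is controlled; the
  first moment of h vanishes, and the second moment satisfies m_2 (L h) = - m_2 (h). Hence
  ||(1 - a I)^2 F||^2 + m_2^2 is an equivalent squared norm in which <L h, h> <= - <h, h>,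
  the rate 1 being that of m_2. The domain is dense, so the decay extends to the whole space.
*)

theory Submission
  imports Defs
begin

section \<open>Seminorm calculus for square integrable representatives\<close>

section \<open>Square integrable functions\<close>

text \<open>The commutator of \<open>I\<close> with multiplication by y is \<open>I^2\<close>, so
  each application of \<open>1 - aI\<close> to L h trades one nonlocal term for another: one
  application replaces the convolution by the remainder \<open>- a I h\<close>, and a further one
  cancels this remainder; hence the square. The price is a two-dimensional kernel. One direction is
  excluded by the zero first moment, the other is seen by m_2, an eigenfunctional of L; so exactly
  one moment has to be added to the norm.

  The rate 3/2 does not depend on k: the weight of order k + 1 yields (2k + 3)/2, but D^k does not
  commute with multiplication by y, and the commutator costs k.

  D^k h exists only weakly and may be singular at 0. Computations are therefore done on primitives
  vanishing at infinity, where integration by parts is Fubini, and return to derivatives by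
  uniqueness of weak derivatives. The semigroup is never constructed: the decay comes from the right
  derivative of the energy along orbits that start in the domain.\<close>

definition L2 :: "'a measure \<Rightarrow> ('a \<Rightarrow> real) set" where
  "L2 M = {f \<in> borel_measurable M. integrable M (\<lambda>x. (f x)\<^sup>2)}"

definition L2_norm :: "'a measure \<Rightarrow> ('a \<Rightarrow> real) \<Rightarrow> real" where
  "L2_norm M f = sqrt (\<integral>x. (f x)\<^sup>2 \<partial>M)"

lemma L2_measurable: "f \<in> L2 M \<Longrightarrow> f \<in> borel_measurable M"
  and L2_integrable_square: "f \<in> L2 M \<Longrightarrow> integrable M (\<lambda>x. (f x)\<^sup>2)"
  by (auto simp: L2_def)

lemma L2_norm_nonneg: "0 \<le> L2_norm M f"
  by (simp add: L2_norm_def)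

lemma L2_norm_square: "(L2_norm M f)\<^sup>2 = (\<integral>x. (f x)\<^sup>2 \<partial>M)"
  by (simp add: L2_norm_def)

lemma L2_norm_cong_AE:
  assumes "f \<in> borel_measurable M" "g \<in> borel_measurable M" "AE x in M. f x = g x"
  shows "L2_norm M f = L2_norm M g"
  unfolding L2_norm_def
  by (rule arg_cong[where f = sqrt], rule integral_cong_AE) (use assms in auto)

lemma L2_integrable_mult:
  assumes "f \<in> L2 M" "g \<in> L2 M"
  shows "integrable M (\<lambda>x. f x * g x)"
proof (rule Bochner_Integration.integrable_bound)
  show "integrable M (\<lambda>x. (f x)\<^sup>2 + (g x)\<^sup>2)"
    using assms by (auto simp: L2_def)
  show "(\<lambda>x. f x * g x) \<in> borel_measurable M"
    using assms by (auto simp: L2_def)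
  have "\<bar>f x * g x\<bar> \<le> (f x)\<^sup>2 + (g x)\<^sup>2" for x
  proof -
    have "0 \<le> (\<bar>f x\<bar> - \<bar>g x\<bar>)\<^sup>2" "0 \<le> \<bar>f x\<bar> * \<bar>g x\<bar>" by simp_all
    then have "2 * (\<bar>f x\<bar> * \<bar>g x\<bar>) \<le> (f x)\<^sup>2 + (g x)\<^sup>2" "0 \<le> \<bar>f x\<bar> * \<bar>g x\<bar>"
      by (simp_all add: power2_diff mult.assoc)
    then show ?thesis unfolding abs_mult by linarith
  qed
  then show "AE x in M. norm (f x * g x) \<le> norm ((f x)\<^sup>2 + (g x)\<^sup>2)"
    by (auto simp del: abs_mult)
qed

lemma L2_lincomb:
  assumes "f \<in> L2 M" "g \<in> L2 M"
  shows "(\<lambda>x. a * f x + b * g x) \<in> L2 M"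
proof -
  have "(\<lambda>x. (a * f x + b * g x)\<^sup>2) = (\<lambda>x. a\<^sup>2 * (f x)\<^sup>2 + (2 * a * b) * (f x * g x) + b\<^sup>2 * (g x)\<^sup>2)"
    by (auto simp: power2_eq_square algebra_simps)
  moreover have "integrable M \<dots>"
    using assms L2_integrable_mult[OF assms] by (auto simp: L2_def)
  ultimately show ?thesis
    using assms by (auto simp: L2_def)
qed

lemma L2_integral_square_lincomb:
  assumes "f \<in> L2 M" "g \<in> L2 M"
  shows "(\<integral>x. (a * f x + b * g x)\<^sup>2 \<partial>M)
    = a\<^sup>2 * (\<integral>x. (f x)\<^sup>2 \<partial>M) + 2 * a * b * (\<integral>x. f x * g x \<partial>M) + b\<^sup>2 * (\<integral>x. (g x)\<^sup>2 \<partial>M)"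
proof -
  have "(\<lambda>x. (a * f x + b * g x)\<^sup>2) = (\<lambda>x. a\<^sup>2 * (f x)\<^sup>2 + (2 * a * b) * (f x * g x) + b\<^sup>2 * (g x)\<^sup>2)"
    by (auto simp: power2_eq_square algebra_simps)
  then show ?thesis
    using assms L2_integrable_mult[OF assms] by (simp add: L2_def)
qed

text \<open>The quadratic form in (s, t) given by the integral of the square of s f + t g is
  nonnegative. Its value at (C, -B) is C (A C - B^2), which settles C > 0; only C = 0 requires
  another point.\<close>

lemma L2_cauchy_schwarz:
  assumes "f \<in> L2 M" "g \<in> L2 M"
  shows "\<bar>\<integral>x. f x * g x \<partial>M\<bar> \<le> L2_norm M f * L2_norm M g"
proof -
  define A B C where "A = (\<integral>x. (f x)\<^sup>2 \<partial>M)" and "B = (\<integral>x. f x * g x \<partial>M)"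
    and "C = (\<integral>x. (g x)\<^sup>2 \<partial>M)"
  have q: "0 \<le> s\<^sup>2 * A + 2 * s * t * B + t\<^sup>2 * C" for s t
    using L2_integral_square_lincomb[OF assms, of s t] integral_nonneg_AE[of "\<lambda>x. (s * f x + t * g x)\<^sup>2" M]
    by (simp add: A_def B_def C_def)
  have "0 \<le> A" "0 \<le> C" by (simp_all add: A_def C_def)
  have "B\<^sup>2 \<le> A * C"
  proof (cases "C = 0")
    case True
    have "B = 0"
    proof (rule ccontr)
      assume "B \<noteq> 0"
      \<comment> \<open>For C = 0 the form at (1, t) is A + 2 t B, and this t makes it -1.\<close>
      from q[of 1 "- (A + 1) / (2 * B)"] True this show False
        by (simp add: field_simps)
    qed
    then show ?thesis by (simp add: True)
  next
    case False
    then have "C > 0" using \<open>0 \<le> C\<close> by simp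
    from q[of C "- B"] have "0 \<le> C * (A * C - B\<^sup>2)"
      by (simp add: power2_eq_square algebra_simps)
    then show ?thesis using \<open>C > 0\<close> by (simp add: zero_le_mult_iff)
  qed
  then have "\<bar>B\<bar> \<le> sqrt (A * C)"
    by (metis real_sqrt_abs real_sqrt_le_mono)
  then show ?thesis
    by (simp add: A_def B_def C_def L2_norm_def real_sqrt_mult)
qed

lemma L2_norm_lincomb:
  assumes "f \<in> L2 M" "g \<in> L2 M"
  shows "L2_norm M (\<lambda>x. a * f x + b * g x) \<le> \<bar>a\<bar> * L2_norm M f + \<bar>b\<bar> * L2_norm M g"
proof -
  have "a * b * (\<integral>x. f x * g x \<partial>M) \<le> \<bar>a\<bar> * \<bar>b\<bar> * (L2_norm M f * L2_norm M g)"
  proof -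
    have "a * b * (\<integral>x. f x * g x \<partial>M) \<le> \<bar>a * b\<bar> * \<bar>\<integral>x. f x * g x \<partial>M\<bar>"
      by (metis abs_ge_self abs_mult)
    also have "\<dots> \<le> \<bar>a * b\<bar> * (L2_norm M f * L2_norm M g)"
      by (rule mult_left_mono[OF L2_cauchy_schwarz[OF assms]]) simp
    finally show ?thesis by (simp add: abs_mult)
  qed
  moreover have "(\<bar>a\<bar> * L2_norm M f + \<bar>b\<bar> * L2_norm M g)\<^sup>2
      = a\<^sup>2 * (L2_norm M f)\<^sup>2 + 2 * (\<bar>a\<bar> * \<bar>b\<bar> * (L2_norm M f * L2_norm M g)) + b\<^sup>2 * (L2_norm M g)\<^sup>2"
    by (simp add: power2_sum power_mult_distrib)
  ultimately have "(L2_norm M (\<lambda>x. a * f x + b * g x))\<^sup>2 \<le> (\<bar>a\<bar> * L2_norm M f + \<bar>b\<bar> * L2_norm M g)\<^sup>2"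
    unfolding L2_norm_square L2_integral_square_lincomb[OF assms] by linarith
  then show ?thesis
    by (rule power2_le_imp_le) (auto intro!: add_nonneg_nonneg mult_nonneg_nonneg L2_norm_nonneg)
qed

lemma L2_cong_AE:
  assumes "f \<in> L2 M" "g \<in> borel_measurable M" "AE x in M. f x = g x"
  shows "g \<in> L2 M"
proof -
  have "AE x in M. (f x)\<^sup>2 = (g x)\<^sup>2"
    using assms(3) by eventually_elim simp
  then have "integrable M (\<lambda>x. (f x)\<^sup>2) \<longleftrightarrow> integrable M (\<lambda>x. (g x)\<^sup>2)"
    using assms by (intro integrable_cong_AE) (auto simp: L2_def)
  then show ?thesis
    using assms by (auto simp: L2_def)
qed

text \<open>Estimates obtained from Tonelli live in the extended reals, where integrability need not
  be known beforehand. This turns such an estimate into membership and a norm bound at once.\<close>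

lemma L2_nn_bound:
  assumes "g \<in> L2 M" "f \<in> borel_measurable M" "0 \<le> C"
    and "(\<integral>\<^sup>+x. ennreal ((f x)\<^sup>2) \<partial>M) \<le> ennreal (C\<^sup>2) * (\<integral>\<^sup>+x. ennreal ((g x)\<^sup>2) \<partial>M)"
  shows "f \<in> L2 M \<and> L2_norm M f \<le> C * L2_norm M g"
proof -
  have g: "(\<integral>\<^sup>+x. ennreal ((g x)\<^sup>2) \<partial>M) = ennreal ((L2_norm M g)\<^sup>2)"
    unfolding L2_norm_square by (rule nn_integral_eq_integral) (use assms in \<open>auto simp: L2_def\<close>)
  have le: "(\<integral>\<^sup>+x. ennreal ((f x)\<^sup>2) \<partial>M) \<le> ennreal ((C * L2_norm M g)\<^sup>2)"
    using assms(4) by (simp add: g ennreal_mult'[symmetric] power_mult_distrib)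
  then have f: "f \<in> L2 M"
    unfolding L2_def using assms(2) 
    by (auto intro!: integrableI_nonneg intro: le_less_trans)
  then have "(\<integral>\<^sup>+x. ennreal ((f x)\<^sup>2) \<partial>M) = ennreal ((L2_norm M f)\<^sup>2)"
    unfolding L2_norm_square by (intro nn_integral_eq_integral) (auto simp: L2_def)
  with le have "(L2_norm M f)\<^sup>2 \<le> (C * L2_norm M g)\<^sup>2"
    by simp
  then have "L2_norm M f \<le> C * L2_norm M g"
    by (rule power2_le_imp_le) (use assms in \<open>simp add: L2_norm_nonneg\<close>)
  with f show ?thesis by blast
qed

section \<open>Lebesgue measure on the half-line and Fubini for tail integrals\<close>

section \<open>Tail integrals on the half-line\<close>

text \<open>A measure in its own right rather than a set integral: product measures and Fubini apply
  directly, and equality \<open>AE y in halfline\<close> is the relation \<open>ae_eq\<close> of the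
  spaces.\<close>

definition halfline :: "real measure" where
  "halfline = restrict_space lborel {0<..}"

lemma space_halfline [simp]: "space halfline = {0<..}"
  by (simp add: halfline_def space_restrict_space)

lemma measurable_halfline: "f \<in> borel_measurable halfline \<longleftrightarrow> set_borel_measurable lborel {0<..} f"
  for f :: "real \<Rightarrow> real"
  unfolding halfline_def set_borel_measurable_def
  by (subst borel_measurable_restrict_space_iff) auto

lemma measurable_halflineI [measurable (raw)]:
  "f \<in> borel_measurable borel \<Longrightarrow> f \<in> borel_measurable halfline"
  unfolding halfline_def by (rule measurable_restrict_space1) simp

lemma integrable_halfline: "integrable halfline f \<longleftrightarrow> set_integrable lborel {0<..} f"
  for f :: "real \<Rightarrow> real"
  unfolding halfline_def set_integrable_def by (subst integrable_restrict_space) auto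

lemma integral_halfline: "(\<integral>y. f y \<partial>halfline) = (LINT y:{0<..}|lborel. f y)"
  for f :: "real \<Rightarrow> real"
  unfolding halfline_def set_lebesgue_integral_def by (subst integral_restrict_space) auto

lemma nn_integral_halfline:
  "(\<integral>\<^sup>+y. f y \<partial>halfline) = (\<integral>\<^sup>+y. f y * indicator {0<..} y \<partial>lborel)"
  unfolding halfline_def by (subst nn_integral_restrict_space) auto

lemma AE_halfline: "(AE y in halfline. Q y) \<longleftrightarrow> (AE y in lborel. y > 0 \<longrightarrow> Q y)"
  unfolding halfline_def by (subst AE_restrict_space_iff) auto

lemma ae_eq_halfline: "f \<approx>\<^sub>+ g \<longleftrightarrow> (AE y in halfline. f y = g y)"
  unfolding ae_eq_def AE_halfline ..

lemma sigma_finite_halfline: "sigma_finite_measure halfline"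
  unfolding halfline_def
  by (rule sigma_finite_measure_restrict_space) (auto intro: sigma_finite_lborel)

interpretation halfline: sigma_finite_measure halfline
  by (rule sigma_finite_halfline)

interpretation halfline2: pair_sigma_finite halfline halfline
  by standard

lemma tail_integral_halfline:
  assumes "0 \<le> y"
  shows "tail_integral f y = (\<integral>x. indicator {y<..} x * f x \<partial>halfline)"
  unfolding integral_halfline tail_integral_def set_lebesgue_integral_def
  using assms by (intro Bochner_Integration.integral_cong) (auto simp: indicator_def)

lemma measurable_greater_halfline [measurable]:
  "{p \<in> space (halfline \<Otimes>\<^sub>M halfline). fst p < snd p} \<in> sets (halfline \<Otimes>\<^sub>M halfline)"
proof -
  have "fst \<in> borel_measurable (halfline \<Otimes>\<^sub>M halfline)" "snd \<in> borel_measurable (halfline \<Otimes>\<^sub>M halfline)"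
    by (rule measurable_compose[OF measurable_fst], rule measurable_halflineI, simp)
       (rule measurable_compose[OF measurable_snd], rule measurable_halflineI, simp)
  then show ?thesis by measurable
qed

lemma indicator_greater_halfline [measurable]:
  "(\<lambda>p. indicator {fst p<..} (snd p) :: real) \<in> borel_measurable (halfline \<Otimes>\<^sub>M halfline)"
proof -
  have "(\<lambda>p. indicator {p \<in> space (halfline \<Otimes>\<^sub>M halfline). fst p < snd p} p :: real)
      \<in> borel_measurable (halfline \<Otimes>\<^sub>M halfline)"
    by measurable
  then show ?thesis
    by (rule measurable_cong[THEN iffD1, rotated]) (auto simp: indicator_def)
qed

lemma measurable_tail_integral:
  assumes [measurable]: "f \<in> borel_measurable halfline"
  shows "tail_integral f \<in> borel_measurable halfline"
proof -
  have "(\<lambda>y. \<integral>x. indicator {fst (y, x)<..} (snd (y, x)) * f x \<partial>halfline) \<in> borel_measurable halfline"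
    by (rule halfline.borel_measurable_lebesgue_integral) measurable
  then show ?thesis
    by (rule measurable_cong[THEN iffD1, rotated]) (auto simp: tail_integral_halfline)
qed

lemma measurable_pair_halfline:
  assumes "0 \<le> y0" and [measurable]: "f \<in> borel_measurable halfline" "\<kappa> \<in> borel_measurable halfline"
  shows "(\<lambda>p. indicator {y0<..} (fst p) * indicator {fst p<..} (snd p) * (\<kappa> (fst p) * f (snd p)) :: real)
    \<in> borel_measurable (halfline \<Otimes>\<^sub>M halfline)"
proof -
  have fst: "(\<lambda>p. h (fst p)) \<in> borel_measurable (halfline \<Otimes>\<^sub>M halfline)"
    and snd: "(\<lambda>p. h (snd p)) \<in> borel_measurable (halfline \<Otimes>\<^sub>M halfline)"
    if "h \<in> borel_measurable halfline" for h :: "real \<Rightarrow> real"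
    using measurable_compose[OF measurable_fst that] measurable_compose[OF measurable_snd that] by auto
  show ?thesis
    by (intro borel_measurable_times indicator_greater_halfline fst snd assms) measurable
qed

text \<open>Both sides are iterated integrals of \<open>\<kappa> y * f x\<close> over y0 < y < x.
  The function B majorizes the inner integral of |kappa|, so integrability of f B gives absolute
  integrability on the plane. The kernel may change sign, as it does for derivatives of test
  functions.\<close>

lemma tail_fubini:
  fixes f \<kappa> B :: "real \<Rightarrow> real"
  assumes y0: "0 \<le> y0"
    and f [measurable]: "f \<in> borel_measurable halfline"
    and \<kappa> [measurable]: "\<kappa> \<in> borel_measurable halfline"
    and B: "\<And>x. y0 < x \<Longrightarrow> (\<integral>\<^sup>+y. ennreal (indicator {y0<..<x} y * \<bar>\<kappa> y\<bar>) \<partial>halfline) \<le> ennreal (B x)"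
    and B0: "\<And>x. y0 < x \<Longrightarrow> 0 \<le> B x"
    and int: "integrable halfline (\<lambda>x. indicator {y0<..} x * (f x * B x))"
  shows "integrable halfline (\<lambda>y. indicator {y0<..} y * (\<kappa> y * tail_integral f y))" (is ?A)
    and "(\<integral>y. indicator {y0<..} y * (\<kappa> y * tail_integral f y) \<partial>halfline)
      = (\<integral>x. indicator {y0<..} x * (f x * (\<integral>y. indicator {y0<..<x} y * \<kappa> y \<partial>halfline)) \<partial>halfline)" (is ?B)
proof -
  define G where "G = (\<lambda>p. indicator {y0<..} (fst p) * indicator {fst p<..} (snd p) * (\<kappa> (fst p) * f (snd p)) :: real)"
  have [measurable]: "G \<in> borel_measurable (halfline \<Otimes>\<^sub>M halfline)"
    unfolding G_def by (rule measurable_pair_halfline) (use y0 in auto)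
  have inner: "(\<integral>\<^sup>+y. ennreal (norm (G (y, x))) \<partial>halfline)
      \<le> ennreal (norm (indicator {y0<..} x * (f x * B x)))" for x
  proof (cases "y0 < x")
    case True
    have "(\<integral>\<^sup>+y. ennreal (norm (G (y, x))) \<partial>halfline)
        = (\<integral>\<^sup>+y. ennreal \<bar>f x\<bar> * ennreal (indicator {y0<..<x} y * \<bar>\<kappa> y\<bar>) \<partial>halfline)"
      by (intro nn_integral_cong) (auto simp: G_def indicator_def ennreal_mult'[symmetric] abs_mult mult.commute)
    also have "\<dots> = ennreal \<bar>f x\<bar> * (\<integral>\<^sup>+y. ennreal (indicator {y0<..<x} y * \<bar>\<kappa> y\<bar>) \<partial>halfline)"
      by (rule nn_integral_cmult) measurable
    also have "\<dots> \<le> ennreal \<bar>f x\<bar> * ennreal (B x)"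
      by (intro mult_left_mono B True) simp
    also have "\<dots> = ennreal (norm (indicator {y0<..} x * (f x * B x)))"
      using True B0[OF True] by (simp add: ennreal_mult'[symmetric] abs_mult)
    finally show ?thesis .
  next
    case False
    then have "G (y, x) = 0" for y by (auto simp: G_def indicator_def)
    then show ?thesis by simp
  qed
  have "(\<integral>\<^sup>+p. ennreal (norm (G p)) \<partial>(halfline \<Otimes>\<^sub>M halfline))
      = (\<integral>\<^sup>+x. (\<integral>\<^sup>+y. ennreal (norm (G (y, x))) \<partial>halfline) \<partial>halfline)"
    by (rule halfline2.nn_integral_snd[symmetric]) measurable
  also have "\<dots> \<le> (\<integral>\<^sup>+x. ennreal (norm (indicator {y0<..} x * (f x * B x))) \<partial>halfline)"
    by (intro nn_integral_mono inner)
  also have "\<dots> < \<infinity>"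
    using int by (simp add: integrable_iff_bounded)
  finally have G: "integrable (halfline \<Otimes>\<^sub>M halfline) G"
    by (intro integrableI_bounded) auto
  have fst_eq: "(\<integral>x. G (y, x) \<partial>halfline) = indicator {y0<..} y * (\<kappa> y * tail_integral f y)"
    if "y \<in> space halfline" for y
  proof -
    have "(\<integral>x. G (y, x) \<partial>halfline)
        = (\<integral>x. (indicator {y0<..} y * \<kappa> y) * (indicator {y<..} x * f x) \<partial>halfline)"
      by (intro Bochner_Integration.integral_cong) (auto simp: G_def)
    also have "\<dots> = (indicator {y0<..} y * \<kappa> y) * tail_integral f y"
      using that by (simp add: tail_integral_halfline)
    finally show ?thesis by (simp add: mult.assoc)
  qed
  have "integrable halfline (\<lambda>y. \<integral>x. G (y, x) \<partial>halfline)"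
    by (rule halfline2.integrable_fst'[OF G])
  then show ?A
    by (rule Bochner_Integration.integrable_cong[OF refl, THEN iffD1, rotated]) (rule fst_eq)
  have "(\<integral>y. indicator {y0<..} y * (\<kappa> y * tail_integral f y) \<partial>halfline)
      = (\<integral>y. (\<integral>x. G (y, x) \<partial>halfline) \<partial>halfline)"
    by (intro Bochner_Integration.integral_cong refl fst_eq[symmetric])
  also have "\<dots> = (\<integral>x. (\<integral>y. G (y, x) \<partial>halfline) \<partial>halfline)"
    using halfline2.Fubini_integral[of "\<lambda>y x. G (y, x)"] G by simp
  also have "\<dots> = (\<integral>x. indicator {y0<..} x * (f x * (\<integral>y. indicator {y0<..<x} y * \<kappa> y \<partial>halfline)) \<partial>halfline)"
  proof (intro Bochner_Integration.integral_cong refl)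
    fix x
    have "(\<integral>y. G (y, x) \<partial>halfline)
        = (\<integral>y. (indicator {y0<..} x * f x) * (indicator {y0<..<x} y * \<kappa> y) \<partial>halfline)"
      by (intro Bochner_Integration.integral_cong) (auto simp: G_def indicator_def)
    then show "(\<integral>y. G (y, x) \<partial>halfline)
        = indicator {y0<..} x * (f x * (\<integral>y. indicator {y0<..<x} y * \<kappa> y \<partial>halfline))"
      by (simp add: mult.assoc)
  qed
  finally show ?B .
qed

lemma halfline_FTC:
  fixes K \<kappa> :: "real \<Rightarrow> real"
  assumes "0 \<le> y0" "y0 \<le> x" "\<kappa> \<in> borel_measurable borel"
    and K: "\<And>x. y0 \<le> x \<Longrightarrow> (K has_real_derivative \<kappa> x) (at x)"
    and \<kappa>0: "\<And>x. y0 \<le> x \<Longrightarrow> 0 \<le> \<kappa> x"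
  shows "(\<integral>\<^sup>+y. ennreal (indicator {y0<..<x} y * \<bar>\<kappa> y\<bar>) \<partial>halfline) = ennreal (K x - K y0)"
    and "(\<integral>y. indicator {y0<..<x} y * \<kappa> y \<partial>halfline) = K x - K y0"
    and "0 \<le> K x - K y0"
proof -
  have "(\<integral>\<^sup>+y. ennreal (indicator {y0<..<x} y * \<bar>\<kappa> y\<bar>) \<partial>halfline)
      = (\<integral>\<^sup>+y. ennreal (\<kappa> y) * indicator {y0..x} y \<partial>lborel)"
    unfolding nn_integral_halfline
  proof (rule nn_integral_cong_AE)
    have "AE y in lborel. y \<noteq> y0 \<and> y \<noteq> x"
      using AE_lborel_singleton[of y0] AE_lborel_singleton[of x] by eventually_elim auto
    then show "AE y in lborel. ennreal (indicator {y0<..<x} y * \<bar>\<kappa> y\<bar>) * indicator {0<..} y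
        = ennreal (\<kappa> y) * indicator {y0..x} y"
      by eventually_elim (use assms in \<open>auto simp: indicator_def\<close>)
  qed
  also have "\<dots> = ennreal (K x - K y0)"
    by (rule nn_integral_FTC_Icc) (use assms in auto)
  finally show 1: "(\<integral>\<^sup>+y. ennreal (indicator {y0<..<x} y * \<bar>\<kappa> y\<bar>) \<partial>halfline) = ennreal (K x - K y0)" .
  show 2: "0 \<le> K x - K y0"
    using DERIV_nonneg_imp_nondecreasing[of y0 x K] assms by auto
  have [measurable]: "\<kappa> \<in> borel_measurable halfline"
    using assms by (intro measurable_halflineI)
  have "(\<integral>\<^sup>+y. ennreal (indicator {y0<..<x} y * \<kappa> y) \<partial>halfline) = ennreal (K x - K y0)"
    unfolding 1[symmetric] by (intro nn_integral_cong) (use assms in \<open>auto simp: indicator_def\<close>)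
  then have "(\<integral>y. indicator {y0<..<x} y * \<kappa> y \<partial>halfline) = enn2real (ennreal (K x - K y0))"
    by (subst integral_eq_nn_integral) (use assms in \<open>auto simp: indicator_def\<close>)
  then show "(\<integral>y. indicator {y0<..<x} y * \<kappa> y \<partial>halfline) = K x - K y0"
    using 2 by simp
qed

text \<open>Integration by parts for \<open>tail_integral f\<close>, whose derivative is - f:
  subtracting \<open>K y0\<close> removes the boundary term at y0, and no regularity of f is
  involved. For increasing K the increment \<open>K x - K y0\<close> is itself the majorant that
  \<open>tail_fubini\<close> asks for.\<close>

lemma tail_fubini_primitive:
  fixes f \<kappa> K :: "real \<Rightarrow> real"
  assumes y0: "0 \<le> y0"
    and f [measurable]: "f \<in> borel_measurable halfline"
    and \<kappa>: "\<kappa> \<in> borel_measurable borel"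
    and K: "\<And>x. y0 \<le> x \<Longrightarrow> (K has_real_derivative \<kappa> x) (at x)"
    and \<kappa>0: "\<And>x. y0 \<le> x \<Longrightarrow> 0 \<le> \<kappa> x"
    and int: "integrable halfline (\<lambda>x. indicator {y0<..} x * (f x * (K x - K y0)))"
  shows "integrable halfline (\<lambda>y. indicator {y0<..} y * (\<kappa> y * tail_integral f y))"
    and "(\<integral>y. indicator {y0<..} y * (\<kappa> y * tail_integral f y) \<partial>halfline)
      = (\<integral>x. indicator {y0<..} x * (f x * (K x - K y0)) \<partial>halfline)"
proof -
  have [measurable]: "\<kappa> \<in> borel_measurable halfline"
    using \<kappa> by (rule measurable_halflineI)
  note FTC = halfline_FTC[OF y0 _ \<kappa> K \<kappa>0]
  note * = tail_fubini[OF y0 f, of \<kappa> "\<lambda>x. K x - K y0"]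
  show "integrable halfline (\<lambda>y. indicator {y0<..} y * (\<kappa> y * tail_integral f y))"
    by (rule *(1)) (use FTC int in auto)
  have "(\<integral>y. indicator {y0<..} y * (\<kappa> y * tail_integral f y) \<partial>halfline)
      = (\<integral>x. indicator {y0<..} x * (f x * (\<integral>y. indicator {y0<..<x} y * \<kappa> y \<partial>halfline)) \<partial>halfline)"
    by (rule *(2)) (use FTC int in auto)
  also have "\<dots> = (\<integral>x. indicator {y0<..} x * (f x * (K x - K y0)) \<partial>halfline)"
    by (intro Bochner_Integration.integral_cong refl) (use FTC in \<open>auto simp: indicator_def\<close>)
  finally show "(\<integral>y. indicator {y0<..} y * (\<kappa> y * tail_integral f y) \<partial>halfline)
      = (\<integral>x. indicator {y0<..} x * (f x * (K x - K y0)) \<partial>halfline)" .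
qed

section \<open>Moments, and the algebra of tail integrals with powers of y\<close>

section \<open>Functions with finite moments\<close>

text \<open>Near 0 a derivative D^k h may be as singular as y^(-k-1) times a square integrable
  function, so only moments of sufficiently high order exist; the exponential weight supplies all of
  these at once. Taking a tail integral lowers the threshold by one.\<close>

definition moments_from :: "nat \<Rightarrow> (real \<Rightarrow> real) set" where
  "moments_from n = {f \<in> borel_measurable halfline. \<forall>m\<ge>n. integrable halfline (\<lambda>y. y ^ m * f y)}"

lemma moments_from_measurable: "f \<in> moments_from n \<Longrightarrow> f \<in> borel_measurable halfline"
  and moments_from_integrable: "f \<in> moments_from n \<Longrightarrow> n \<le> m \<Longrightarrow> integrable halfline (\<lambda>y. y ^ m * f y)"
  and moments_from_mono: "f \<in> moments_from n \<Longrightarrow> n \<le> m \<Longrightarrow> f \<in> moments_from m"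
  by (auto simp: moments_from_def)

lemma moments_from_lincomb:
  assumes "f \<in> moments_from n" "g \<in> moments_from n"
  shows "(\<lambda>y. a * f y + b * g y) \<in> moments_from n"
proof -
  have "integrable halfline (\<lambda>y. y ^ m * (a * f y + b * g y))" if "n \<le> m" for m
  proof -
    have "integrable halfline (\<lambda>y. a * (y ^ m * f y) + b * (y ^ m * g y))"
      using assms that by (auto simp: moments_from_def)
    then show ?thesis by (simp add: algebra_simps)
  qed
  then show ?thesis
    using assms by (auto simp: moments_from_def)
qed

lemma moments_from_diff: "f \<in> moments_from n \<Longrightarrow> g \<in> moments_from n \<Longrightarrow> (\<lambda>y. f y - c * g y) \<in> moments_from n"
  using moments_from_lincomb[of f n g 1 "- c"] by simp

lemma moments_from_cmult: "f \<in> moments_from n \<Longrightarrow> (\<lambda>y. c * f y) \<in> moments_from n"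
  using moments_from_lincomb[of f n f c 0] by simp

lemma moments_from_uminus: "f \<in> moments_from n \<Longrightarrow> (\<lambda>y. - f y) \<in> moments_from n"
  using moments_from_cmult[of f n "-1"] by simp

lemma moments_from_mult: "f \<in> moments_from (Suc n) \<Longrightarrow> (\<lambda>y. y * f y) \<in> moments_from n"
proof -
  assume f: "f \<in> moments_from (Suc n)"
  have "integrable halfline (\<lambda>y. y ^ m * (y * f y))" if "n \<le> m" for m
    using moments_from_integrable[OF f, of "Suc m"] that by (simp add: ac_simps)
  then show ?thesis
    using f by (auto simp: moments_from_def)
qed

lemma moments_from_cong_AE:
  assumes "f \<in> moments_from n" "g \<in> borel_measurable halfline" "AE y in halfline. f y = g y"
  shows "g \<in> moments_from n"
proof -
  have "integrable halfline (\<lambda>y. y ^ m * g y)" if "n \<le> m" for m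
  proof -
    have "AE y in halfline. y ^ m * f y = y ^ m * g y"
      using assms(3) by eventually_elim simp
    then have "integrable halfline (\<lambda>y. y ^ m * f y) \<longleftrightarrow> integrable halfline (\<lambda>y. y ^ m * g y)"
      using assms by (intro integrable_cong_AE) (auto simp: moments_from_def)
    then show ?thesis using moments_from_integrable[OF assms(1) that] by simp
  qed
  then show ?thesis using assms(2) by (auto simp: moments_from_def)
qed

text \<open>On x > y the factor \<open>x ^ n / y ^ n\<close> is at least 1, so missing powers of x
  can be inserted; the singularity at 0 is not seen.\<close>

lemma moments_from_tail_integrable:
  assumes f: "f \<in> moments_from n" and "0 < y"
  shows "integrable halfline (\<lambda>x. indicator {y<..} x * (x ^ m * f x))"
proof (rule Bochner_Integration.integrable_bound)
  show "integrable halfline (\<lambda>x. (1 / y ^ n) * (x ^ (m + n) * f x))"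
    by (intro Bochner_Integration.integrable_mult_right moments_from_integrable[OF f]) simp
  show "(\<lambda>x. indicator {y<..} x * (x ^ m * f x)) \<in> borel_measurable halfline"
    using moments_from_measurable[OF f] by measurable
  have "norm (indicator {y<..} x * (x ^ m * f x)) \<le> norm ((1 / y ^ n) * (x ^ (m + n) * f x))" for x
  proof (cases "y < x")
    case True
    then have "y ^ n \<le> x ^ n" "0 < y ^ n"
      using \<open>0 < y\<close> by (auto intro!: power_mono)
    then have "1 \<le> x ^ n / y ^ n"
      by simp
    then have "1 * (\<bar>x ^ m\<bar> * \<bar>f x\<bar>) \<le> x ^ n / y ^ n * (\<bar>x ^ m\<bar> * \<bar>f x\<bar>)"
      by (intro mult_right_mono) auto
    then show ?thesis
      using True \<open>0 < y\<close> by (simp add: abs_mult power_add ac_simps)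
  qed simp
  then show "AE x in halfline. norm (indicator {y<..} x * (x ^ m * f x))
      \<le> norm ((1 / y ^ n) * (x ^ (m + n) * f x))" by simp
qed

lemma moments_from_tail_integrable':
  assumes "f \<in> moments_from n" "0 < y"
  shows "integrable halfline (\<lambda>x. indicator {y<..} x * f x)"
  using moments_from_tail_integrable[OF assms, of 0] by simp

lemma tail_integral_lincomb:
  assumes "f \<in> moments_from n" "g \<in> moments_from n" "0 < y"
  shows "tail_integral (\<lambda>y. a * f y + b * g y) y = a * tail_integral f y + b * tail_integral g y"
proof -
  have "tail_integral (\<lambda>y. a * f y + b * g y) y
      = (\<integral>x. a * (indicator {y<..} x * f x) + b * (indicator {y<..} x * g x) \<partial>halfline)"
    using assms by (simp add: tail_integral_halfline algebra_simps)
  also have "\<dots> = a * tail_integral f y + b * tail_integral g y"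
    using assms moments_from_tail_integrable'[OF assms(1,3)] moments_from_tail_integrable'[OF assms(2,3)]
    by (simp add: tail_integral_halfline)
  finally show ?thesis .
qed

lemma tail_integral_cmult: "0 \<le> y \<Longrightarrow> tail_integral (\<lambda>y. c * f y) y = c * tail_integral f y"
proof -
  assume "0 \<le> y"
  have "(\<integral>x. indicator {y<..} x * (c * f x) \<partial>halfline) = (\<integral>x. c * (indicator {y<..} x * f x) \<partial>halfline)"
    by (intro Bochner_Integration.integral_cong) auto
  with \<open>0 \<le> y\<close> show ?thesis by (simp add: tail_integral_halfline)
qed

lemma tail_integral_uminus: "0 \<le> y \<Longrightarrow> tail_integral (\<lambda>y. - f y) y = - tail_integral f y"
  using tail_integral_cmult[of y "-1" f] by simp

lemma tail_integral_cong_AE: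
  assumes [measurable]: "f \<in> borel_measurable halfline" "g \<in> borel_measurable halfline"
    and "AE y in halfline. f y = g y" "0 \<le> y"
  shows "tail_integral f y = tail_integral g y"
  unfolding tail_integral_halfline[OF \<open>0 \<le> y\<close>]
proof (rule integral_cong_AE)
  show "AE x in halfline. indicator {y<..} x * f x = indicator {y<..} x * g x"
    using assms(3) by eventually_elim simp
qed measurable

lemma tail_integral_cong:
  assumes "\<And>x. 0 < x \<Longrightarrow> f x = g x" "0 \<le> y"
  shows "tail_integral f y = tail_integral g y"
  unfolding tail_integral_halfline[OF \<open>0 \<le> y\<close>]
  by (intro Bochner_Integration.integral_cong) (use assms in auto)

text \<open>Fubini with the kernel y^m integrates one more power of y. This is the source of the
  gain of one moment: for positive n even the moment of order n - 1 of the tail integral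
  exists.\<close>

lemma moment_tail_integral:
  assumes f: "f \<in> moments_from n" and "n \<le> Suc m"
  shows "integrable halfline (\<lambda>y. y ^ m * tail_integral f y)"
    and "(\<integral>y. y ^ m * tail_integral f y \<partial>halfline) = (\<integral>y. y ^ Suc m * f y \<partial>halfline) / real (Suc m)"
proof -
  define K where "K = (\<lambda>x::real. x ^ Suc m / real (Suc m))"
  have K: "(K has_real_derivative x ^ m) (at x)" for x
    unfolding K_def by (auto intro!: derivative_eq_intros simp del: power_Suc of_nat_Suc)
  have i: "integrable halfline (\<lambda>x. f x * (K x - K 0))"
    using moments_from_integrable[OF f \<open>n \<le> Suc m\<close>]
    by (simp add: K_def mult.commute[of "f _"] del: power_Suc of_nat_Suc)
  have i': "integrable halfline (\<lambda>x. indicator {0<..} x * (f x * (K x - K 0)))"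
    by (rule Bochner_Integration.integrable_cong[OF refl, THEN iffD2, OF _ i]) simp
  note * = tail_fubini_primitive[OF order_refl moments_from_measurable[OF f], of "\<lambda>x. x ^ m" K, OF _ K _ i']
  have "integrable halfline (\<lambda>y. indicator {0<..} y * (y ^ m * tail_integral f y))"
    by (rule *(1)) auto
  then show "integrable halfline (\<lambda>y. y ^ m * tail_integral f y)"
    by (rule Bochner_Integration.integrable_cong[OF refl, THEN iffD1, rotated]) simp
  have "(\<integral>y. y ^ m * tail_integral f y \<partial>halfline)
      = (\<integral>y. indicator {0<..} y * (y ^ m * tail_integral f y) \<partial>halfline)"
    by (intro Bochner_Integration.integral_cong) auto
  also have "\<dots> = (\<integral>x. indicator {0<..} x * (f x * (K x - K 0)) \<partial>halfline)"
    by (rule *(2)) auto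
  also have "\<dots> = (\<integral>x. (x ^ Suc m * f x) / real (Suc m) \<partial>halfline)"
    by (intro Bochner_Integration.integral_cong) (auto simp: K_def simp del: of_nat_Suc)
  finally show "(\<integral>y. y ^ m * tail_integral f y \<partial>halfline) = (\<integral>y. y ^ Suc m * f y \<partial>halfline) / real (Suc m)"
    by simp
qed

lemma moments_from_tail_integral:
  "f \<in> moments_from (Suc n) \<Longrightarrow> tail_integral f \<in> moments_from n"
  using moment_tail_integral(1)[of f "Suc n"]
  by (auto simp: moments_from_def[of n] measurable_tail_integral moments_from_measurable)

lemma moments_from_tail_integral':
  "f \<in> moments_from n \<Longrightarrow> tail_integral f \<in> moments_from n"
  by (rule moments_from_tail_integral, erule moments_from_mono) simp

text \<open>Multiplication by y and the tail integral fail to commute by exactly \<open>I^2\<close>,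
  because x - y is the integral of 1 over (y, x). The conjugation of the generator rests on this
  identity.\<close>

lemma tail_integral_mult:
  assumes f: "f \<in> moments_from n" and y: "0 < y"
  shows "tail_integral (\<lambda>x. x * f x) y = y * tail_integral f y + tail_integral (tail_integral f) y"
proof -
  note int = moments_from_tail_integrable[OF f y, of 1] moments_from_tail_integrable[OF f y, of 0]
  have "integrable halfline (\<lambda>x. indicator {y<..} x * (x ^ 1 * f x) - y * (indicator {y<..} x * (x ^ 0 * f x)))"
    using int by (intro Bochner_Integration.integrable_diff Bochner_Integration.integrable_mult_right)
  then have i: "integrable halfline (\<lambda>x. indicator {y<..} x * (f x * (x - y)))"
    by (simp add: algebra_simps)
  have "tail_integral (tail_integral f) y = (\<integral>x. indicator {y<..} x * (1 * tail_integral f x) \<partial>halfline)"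
    using y by (simp add: tail_integral_halfline)
  also have "\<dots> = (\<integral>x. indicator {y<..} x * (f x * (x - y)) \<partial>halfline)"
    by (rule tail_fubini_primitive(2)[OF _ moments_from_measurable[OF f], where K = "\<lambda>x. x"])
       (use y i in auto)
  also have "\<dots> = (\<integral>x. indicator {y<..} x * (x ^ 1 * f x) - y * (indicator {y<..} x * (x ^ 0 * f x)) \<partial>halfline)"
    by (intro Bochner_Integration.integral_cong) (auto simp: algebra_simps)
  also have "\<dots> = tail_integral (\<lambda>x. x * f x) y - y * tail_integral f y"
    using int y by (simp add: tail_integral_halfline)
  finally show ?thesis by simp
qed

lemma tail_integral_diff_interval:
  assumes f: "f \<in> moments_from n" and y: "0 < y" "y \<le> x"
  shows "(\<integral>z. indicator {y<..<x} z * f z \<partial>halfline) = tail_integral f y - tail_integral f x"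
proof -
  have [measurable]: "f \<in> borel_measurable halfline" using f by (rule moments_from_measurable)
  have "AE z in halfline. z \<noteq> x"
    unfolding AE_halfline using AE_lborel_singleton[of x] by eventually_elim simp
  then have ae: "AE z in halfline. indicator {y<..<x} z * f z = indicator {y<..} z * f z - indicator {x<..} z * f z"
    by eventually_elim (use y in \<open>auto simp: indicator_def\<close>)
  have "(\<integral>z. indicator {y<..<x} z * f z \<partial>halfline)
      = (\<integral>z. indicator {y<..} z * f z - indicator {x<..} z * f z \<partial>halfline)"
    by (rule integral_cong_AE) (use ae in measurable)
  also have "\<dots> = tail_integral f y - tail_integral f x"
    using moments_from_tail_integrable'[OF f, of y] moments_from_tail_integrable'[OF f, of x] y
    by (simp add: tail_integral_halfline)
  finally show ?thesis .
qed

text \<open>Formally the derivative of \<open>(I f)^2\<close> is - 2 f I f. As f is merely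
  integrable at infinity, the identity is read off from Fubini with f itself as kernel: the integral
  of f over (y, x) is I f (y) - I f (x), and the unknown integral reappears with a minus
  sign.\<close>

lemma tail_integral_square:
  assumes f: "f \<in> moments_from n" and y: "0 < y"
  shows "integrable halfline (\<lambda>x. indicator {y<..} x * (f x * tail_integral f x))"
    and "(tail_integral f y)\<^sup>2 = 2 * tail_integral (\<lambda>x. f x * tail_integral f x) y"
proof -
  have [measurable]: "f \<in> borel_measurable halfline" using f by (rule moments_from_measurable)
  note int = moments_from_tail_integrable'[OF f y]
  \<comment> \<open>A constant majorant suffices, because f has finite mass on (y,
    infinity).\<close>
  define c where "c = (\<integral>z. \<bar>indicator {y<..} z * f z\<bar> \<partial>halfline)"
  have c: "(\<integral>\<^sup>+z. ennreal (indicator {y<..<x} z * \<bar>f z\<bar>) \<partial>halfline) \<le> ennreal c" for x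
  proof -
    have "(\<integral>\<^sup>+z. ennreal (indicator {y<..<x} z * \<bar>f z\<bar>) \<partial>halfline)
        \<le> (\<integral>\<^sup>+z. ennreal \<bar>indicator {y<..} z * f z\<bar> \<partial>halfline)"
      by (intro nn_integral_mono) (auto simp: indicator_def)
    also have "\<dots> = ennreal c"
      unfolding c_def using int by (intro nn_integral_eq_integral) auto
    finally show ?thesis .
  qed
  have i: "integrable halfline (\<lambda>x. indicator {y<..} x * (f x * c))"
    using Bochner_Integration.integrable_mult_left[OF int, of c] by (simp add: mult.assoc)
  have c0: "0 \<le> c" by (auto simp: c_def)
  note * = tail_fubini[OF less_imp_le[OF y], of f f "\<lambda>_. c"]
  show 1: "integrable halfline (\<lambda>x. indicator {y<..} x * (f x * tail_integral f x))"
    by (rule *(1)) (use c c0 i in auto)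
  have "tail_integral (\<lambda>x. f x * tail_integral f x) y
      = (\<integral>x. indicator {y<..} x * (f x * tail_integral f x) \<partial>halfline)"
    using y by (simp add: tail_integral_halfline)
  also have "\<dots> = (\<integral>x. indicator {y<..} x * (f x * (\<integral>z. indicator {y<..<x} z * f z \<partial>halfline)) \<partial>halfline)"
    by (rule *(2)) (use c c0 i in auto)
  also have "\<dots> = (\<integral>x. tail_integral f y * (indicator {y<..} x * f x) - indicator {y<..} x * (f x * tail_integral f x) \<partial>halfline)"
  proof (intro Bochner_Integration.integral_cong refl)
    fix x
    show "indicator {y<..} x * (f x * (\<integral>z. indicator {y<..<x} z * f z \<partial>halfline))
        = tail_integral f y * (indicator {y<..} x * f x) - indicator {y<..} x * (f x * tail_integral f x)"
    proof (cases "y < x")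
      case True
      show ?thesis
        unfolding tail_integral_diff_interval[OF f y less_imp_le[OF True]] by (simp add: algebra_simps)
    qed simp
  qed
  also have "\<dots> = tail_integral f y * tail_integral f y - tail_integral (\<lambda>x. f x * tail_integral f x) y"
    using int 1 y by (simp add: tail_integral_halfline)
  finally show "(tail_integral f y)\<^sup>2 = 2 * tail_integral (\<lambda>x. f x * tail_integral f x) y"
    by (simp add: power2_eq_square)
qed

section \<open>Exponential kernels and the weighted spaces\<close>

section \<open>Weighted square integrable functions\<close>

text \<open>The inequality t <= exp t at t = d x / p, raised to the p-th power; for p = 0 it reads 1
  <= exp (d x).\<close>

lemma power_le_exp:
  fixes x d :: real
  assumes "0 \<le> x" "0 < d"
  shows "x ^ p \<le> (real p / d) ^ p * exp (d * x)"
proof (cases "p = 0")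
  case False
  then have p: "0 < real p" by simp
  have "d * x / real p \<le> exp (d * x / real p)"
    using exp_ge_add_one_self[of "d * x / real p"] by linarith
  then have "x \<le> real p / d * exp (d * x / real p)"
    using p assms by (simp add: field_simps)
  then have "x ^ p \<le> (real p / d * exp (d * x / real p)) ^ p"
    using assms by (intro power_mono)
  also have "\<dots> = (real p / d) ^ p * exp (d * x)"
    unfolding power_mult_distrib exp_of_nat_mult[symmetric] using p by simp
  finally show ?thesis .
qed (use assms in simp)

lemma nn_integral_exp_tail:
  fixes b y :: real
  assumes "0 < b"
  shows "(\<integral>\<^sup>+x. ennreal (exp (- (b * (x - y)))) * indicator {y..} x \<partial>lborel) = ennreal (1 / b)"
proof -
  define F where "F = (\<lambda>x. - exp (- (b * (x - y))) / b)"
  have "((\<lambda>x. F x) \<longlongrightarrow> 0) at_top"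
    unfolding F_def using assms by real_asymp
  then have "(\<integral>\<^sup>+x. ennreal (exp (- (b * (x - y)))) * indicator {y..} x \<partial>lborel) = ennreal (0 - F y)"
    by (intro nn_integral_FTC_atLeast)
       (auto simp: F_def intro!: derivative_eq_intros, use assms in \<open>auto simp: field_simps\<close>)
  then show ?thesis by (simp add: F_def)
qed

lemma nn_integral_exp_kernel:
  fixes b y :: real
  assumes "0 < b"
  shows "(\<integral>\<^sup>+x. ennreal (exp (- (b * \<bar>y - x\<bar>))) \<partial>halfline) \<le> ennreal (2 / b)"
proof -
  have refl: "(\<integral>\<^sup>+x. ennreal (exp (- (b * (y - x)))) * indicator {..y} x \<partial>lborel) = ennreal (1 / b)"
  proof -
    have "(\<integral>\<^sup>+x. ennreal (exp (- (b * (y - x)))) * indicator {..y} x \<partial>lborel)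
        = (\<integral>\<^sup>+x. ennreal (exp (- (b * (x - (- y))))) * indicator {- y..} x \<partial>distr lborel borel uminus)"
      by (subst nn_integral_distr) (auto intro!: nn_integral_cong simp: indicator_def)
    also have "\<dots> = ennreal (1 / b)"
      unfolding lborel_distr_uminus by (rule nn_integral_exp_tail[OF assms])
    finally show ?thesis .
  qed
  have "(\<integral>\<^sup>+x. ennreal (exp (- (b * \<bar>y - x\<bar>))) \<partial>halfline)
      \<le> (\<integral>\<^sup>+x. ennreal (exp (- (b * (x - y)))) * indicator {y..} x
            + ennreal (exp (- (b * (y - x)))) * indicator {..y} x \<partial>lborel)"
    unfolding nn_integral_halfline
    by (intro nn_integral_mono) (auto simp: indicator_def ennreal_plus[symmetric] simp del: ennreal_plus)
  also have "\<dots> = ennreal (1 / b) + ennreal (1 / b)"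
    by (subst nn_integral_add) (auto simp: nn_integral_exp_tail[OF assms] refl)
  also have "\<dots> = ennreal (2 / b)"
    using assms by (subst ennreal_plus[symmetric]) auto
  finally show ?thesis .
qed

text \<open>Schur's test for the kernel exp (-b |y - x|). Splitting the kernel into two square
  roots, Cauchy-Schwarz bounds u(y)^2 by the mass 2/b of one factor times the integral of the kernel
  against g^2; Tonelli then contributes the second factor 2/b.\<close>

lemma exp_kernel_L2:
  fixes b c :: real and g u :: "real \<Rightarrow> real"
  assumes b: "0 < b" and c: "0 \<le> c" and g: "g \<in> L2 halfline" and u [measurable]: "u \<in> borel_measurable halfline"
    and le: "\<And>y. 0 < y \<Longrightarrow> \<bar>u y\<bar> \<le> c * (\<integral>x. exp (- (b * \<bar>y - x\<bar>)) * \<bar>g x\<bar> \<partial>halfline)"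
  shows "u \<in> L2 halfline \<and> L2_norm halfline u \<le> c * (2 / b) * L2_norm halfline g"
proof (rule L2_nn_bound[OF g u])
  have [measurable]: "g \<in> borel_measurable halfline" using g by (rule L2_measurable)
  show "0 \<le> c * (2 / b)" using b c by simp
  define E where "E = (\<lambda>y x::real. exp (- (b / 2 * \<bar>y - x\<bar>)))"
  have Em [measurable]: "(\<lambda>x. E y x) \<in> borel_measurable halfline" for y
    unfolding E_def by (rule measurable_halflineI) measurable
  have E2: "(E y x)\<^sup>2 = exp (- (b * \<bar>y - x\<bar>))" for x y
    by (simp add: E_def power2_eq_square exp_add[symmetric])
  have E_L2: "E y \<in> L2 halfline" for y
    unfolding L2_def using nn_integral_exp_kernel[OF b, of y]
    by (auto simp: E2 intro!: integrableI_nonneg intro: le_less_trans)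
  have E_norm: "(L2_norm halfline (E y))\<^sup>2 \<le> 2 / b" for y
  proof -
    have "ennreal ((L2_norm halfline (E y))\<^sup>2) = (\<integral>\<^sup>+x. ennreal ((E y x)\<^sup>2) \<partial>halfline)"
      unfolding L2_norm_square
      by (rule nn_integral_eq_integral[symmetric]) (use E_L2[of y] in \<open>auto simp: L2_def\<close>)
    also have "\<dots> \<le> ennreal (2 / b)"
      using nn_integral_exp_kernel[OF b, of y] by (simp add: E2)
    finally show ?thesis using b by simp
  qed
  have Eg_L2: "(\<lambda>x. E y x * \<bar>g x\<bar>) \<in> L2 halfline" for y
  proof -
    have "integrable halfline (\<lambda>x. (E y x * \<bar>g x\<bar>)\<^sup>2)"
    proof (rule Bochner_Integration.integrable_bound[OF L2_integrable_square[OF g]])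
      show "AE x in halfline. norm ((E y x * \<bar>g x\<bar>)\<^sup>2) \<le> norm ((g x)\<^sup>2)"
      proof (rule AE_I2)
        fix x
        have "(E y x)\<^sup>2 * (g x)\<^sup>2 \<le> 1 * (g x)\<^sup>2"
          using b by (intro mult_right_mono) (auto simp: E2)
        then show "norm ((E y x * \<bar>g x\<bar>)\<^sup>2) \<le> norm ((g x)\<^sup>2)"
          by (simp add: power_mult_distrib)
      qed
    qed measurable
    then show ?thesis by (auto simp: L2_def)
  qed
  \<comment> \<open>The squared Cauchy-Schwarz bound. The integral of the kernel against g^2 is
    written as a nonnegative integral, so that the order of integration may be exchanged
    next.\<close>
  have pt: "ennreal ((u y)\<^sup>2) \<le> ennreal (c\<^sup>2 * (2 / b)) * (\<integral>\<^sup>+x. ennreal (exp (- (b * \<bar>y - x\<bar>)) * (g x)\<^sup>2) \<partial>halfline)"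
    if "0 < y" for y
  proof -
    have "\<bar>\<integral>x. exp (- (b * \<bar>y - x\<bar>)) * \<bar>g x\<bar> \<partial>halfline\<bar>
        \<le> L2_norm halfline (E y) * L2_norm halfline (\<lambda>x. E y x * \<bar>g x\<bar>)"
      using L2_cauchy_schwarz[OF E_L2 Eg_L2, of y y]
      by (simp add: mult.assoc[symmetric] power2_eq_square[symmetric] E2)
    then have "\<bar>u y\<bar> \<le> c * (L2_norm halfline (E y) * L2_norm halfline (\<lambda>x. E y x * \<bar>g x\<bar>))"
      using le[OF that] c by (smt (verit) mult_left_mono)
    then have "(u y)\<^sup>2 \<le> (c * (L2_norm halfline (E y) * L2_norm halfline (\<lambda>x. E y x * \<bar>g x\<bar>)))\<^sup>2"
      by (metis abs_ge_zero power2_abs power_mono)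
    also have "\<dots> = c\<^sup>2 * (L2_norm halfline (E y))\<^sup>2 * (L2_norm halfline (\<lambda>x. E y x * \<bar>g x\<bar>))\<^sup>2"
      by (simp add: power_mult_distrib)
    also have "\<dots> \<le> c\<^sup>2 * (2 / b) * (L2_norm halfline (\<lambda>x. E y x * \<bar>g x\<bar>))\<^sup>2"
      by (intro mult_right_mono mult_left_mono E_norm) auto
    finally have "ennreal ((u y)\<^sup>2) \<le> ennreal (c\<^sup>2 * (2 / b)) * ennreal ((L2_norm halfline (\<lambda>x. E y x * \<bar>g x\<bar>))\<^sup>2)"
      using b by (simp add: ennreal_mult'[symmetric])
    also have "ennreal ((L2_norm halfline (\<lambda>x. E y x * \<bar>g x\<bar>))\<^sup>2)
        = (\<integral>\<^sup>+x. ennreal ((E y x * \<bar>g x\<bar>)\<^sup>2) \<partial>halfline)"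
      unfolding L2_norm_square
      by (rule nn_integral_eq_integral[symmetric]) (use Eg_L2[of y] in \<open>auto simp: L2_def\<close>)
    finally show ?thesis by (simp add: power_mult_distrib E2)
  qed
  have km: "(\<lambda>p. ennreal (exp (- (b * \<bar>fst p - snd p\<bar>)) * (g (snd p))\<^sup>2)) \<in> borel_measurable (halfline \<Otimes>\<^sub>M halfline)"
  proof -
    have id: "(\<lambda>x::real. x) \<in> borel_measurable halfline" by (rule measurable_halflineI) simp
    have [measurable]: "(\<lambda>p. fst p) \<in> borel_measurable (halfline \<Otimes>\<^sub>M halfline)"
      "(\<lambda>p. snd p) \<in> borel_measurable (halfline \<Otimes>\<^sub>M halfline)"
      "(\<lambda>p. g (snd p)) \<in> borel_measurable (halfline \<Otimes>\<^sub>M halfline)"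
      using measurable_compose[OF measurable_fst id] measurable_compose[OF measurable_snd id]
        measurable_compose[OF measurable_snd, of g halfline borel halfline] by auto
    show ?thesis by measurable
  qed
  have km': "(\<lambda>x. ennreal (exp (- (b * \<bar>y - x\<bar>)) * (g x)\<^sup>2)) \<in> borel_measurable halfline" for y
  proof -
    have [measurable]: "(\<lambda>x::real. exp (- (b * \<bar>y - x\<bar>))) \<in> borel_measurable halfline"
      by (rule measurable_halflineI) measurable
    show ?thesis by measurable
  qed
  have "(\<integral>\<^sup>+y. ennreal ((u y)\<^sup>2) \<partial>halfline)
      \<le> (\<integral>\<^sup>+y. ennreal (c\<^sup>2 * (2 / b)) * (\<integral>\<^sup>+x. ennreal (exp (- (b * \<bar>y - x\<bar>)) * (g x)\<^sup>2) \<partial>halfline) \<partial>halfline)"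
    by (intro nn_integral_mono pt) simp
  also have "\<dots> = ennreal (c\<^sup>2 * (2 / b)) * (\<integral>\<^sup>+y. (\<integral>\<^sup>+x. ennreal (exp (- (b * \<bar>y - x\<bar>)) * (g x)\<^sup>2) \<partial>halfline) \<partial>halfline)"
    using km by (intro nn_integral_cmult) (auto intro!: halfline.borel_measurable_nn_integral simp: case_prod_beta)
  also have "(\<integral>\<^sup>+y. (\<integral>\<^sup>+x. ennreal (exp (- (b * \<bar>y - x\<bar>)) * (g x)\<^sup>2) \<partial>halfline) \<partial>halfline)
      = (\<integral>\<^sup>+x. (\<integral>\<^sup>+y. ennreal (exp (- (b * \<bar>y - x\<bar>)) * (g x)\<^sup>2) \<partial>halfline) \<partial>halfline)"
    using halfline2.Fubini'[of "\<lambda>y x. ennreal (exp (- (b * \<bar>y - x\<bar>)) * (g x)\<^sup>2)"] km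
    by (simp add: case_prod_beta)
  also have "\<dots> \<le> (\<integral>\<^sup>+x. ennreal (2 / b) * ennreal ((g x)\<^sup>2) \<partial>halfline)"
  proof (rule nn_integral_mono)
    fix x
    have "(\<integral>\<^sup>+y. ennreal (exp (- (b * \<bar>y - x\<bar>)) * (g x)\<^sup>2) \<partial>halfline)
        = (\<integral>\<^sup>+y. ennreal ((g x)\<^sup>2) * ennreal (exp (- (b * \<bar>x - y\<bar>))) \<partial>halfline)"
      by (intro nn_integral_cong) (simp add: ennreal_mult'[symmetric] mult.commute abs_minus_commute)
    also have "\<dots> = ennreal ((g x)\<^sup>2) * (\<integral>\<^sup>+y. ennreal (exp (- (b * \<bar>x - y\<bar>))) \<partial>halfline)"
      by (intro nn_integral_cmult measurable_compose[OF measurable_halflineI measurable_ennreal]) measurable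
    also have "\<dots> \<le> ennreal ((g x)\<^sup>2) * ennreal (2 / b)"
      by (intro mult_left_mono nn_integral_exp_kernel b) simp
    finally show "(\<integral>\<^sup>+y. ennreal (exp (- (b * \<bar>y - x\<bar>)) * (g x)\<^sup>2) \<partial>halfline) \<le> ennreal (2 / b) * ennreal ((g x)\<^sup>2)"
      by (simp add: mult.commute)
  qed
  also have "\<dots> = ennreal (2 / b) * (\<integral>\<^sup>+x. ennreal ((g x)\<^sup>2) \<partial>halfline)"
    by (intro nn_integral_cmult) measurable
  finally have "(\<integral>\<^sup>+y. ennreal ((u y)\<^sup>2) \<partial>halfline)
      \<le> ennreal (c\<^sup>2 * (2 / b)) * (ennreal (2 / b) * (\<integral>\<^sup>+x. ennreal ((g x)\<^sup>2) \<partial>halfline))"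
    by (simp add: mult_left_mono)
  also have "\<dots> = ennreal ((c * (2 / b))\<^sup>2) * (\<integral>\<^sup>+x. ennreal ((g x)\<^sup>2) \<partial>halfline)"
  proof -
    have "ennreal ((c * (2 / b))\<^sup>2) = ennreal (c\<^sup>2 * (2 / b)) * ennreal (2 / b)"
      using b by (subst ennreal_mult'[symmetric]) (auto simp: power2_eq_square)
    then show ?thesis by (simp only: mult.assoc)
  qed
  finally show "(\<integral>\<^sup>+y. ennreal ((u y)\<^sup>2) \<partial>halfline)
      \<le> ennreal ((c * (2 / b))\<^sup>2) * (\<integral>\<^sup>+x. ennreal ((g x)\<^sup>2) \<partial>halfline)" .
qed


text \<open>The exponent mu/2 gives the weight the square
  \<open>y ^ (2 * n) * exp (\<mu> * y)\<close>; with n = k + 1 this is the norm of X_{k,mu}, taken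
  on the k-th derivative.\<close>

definition weight :: "real \<Rightarrow> nat \<Rightarrow> real \<Rightarrow> real" where
  "weight \<mu> n y = y ^ n * exp (\<mu> / 2 * y)"

lemma weight_pos: "0 < y \<Longrightarrow> 0 < weight \<mu> n y"
  by (simp add: weight_def)

lemma weight_square: "(weight \<mu> n y)\<^sup>2 = y ^ (2 * n) * exp (\<mu> * y)"
  unfolding weight_def power_mult_distrib power_even_eq exp_of_nat_mult[symmetric] by simp

lemma measurable_weight [measurable]: "weight \<mu> n \<in> borel_measurable halfline"
  unfolding weight_def by (rule measurable_halflineI) measurable

definition wL2 :: "real \<Rightarrow> nat \<Rightarrow> (real \<Rightarrow> real) set" where
  "wL2 \<mu> n = {f \<in> borel_measurable halfline. (\<lambda>y. weight \<mu> n y * f y) \<in> L2 halfline}"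

definition wnorm :: "real \<Rightarrow> nat \<Rightarrow> (real \<Rightarrow> real) \<Rightarrow> real" where
  "wnorm \<mu> n f = L2_norm halfline (\<lambda>y. weight \<mu> n y * f y)"

definition winner :: "real \<Rightarrow> nat \<Rightarrow> (real \<Rightarrow> real) \<Rightarrow> (real \<Rightarrow> real) \<Rightarrow> real" where
  "winner \<mu> n f g = (\<integral>y. (weight \<mu> n y * f y) * (weight \<mu> n y * g y) \<partial>halfline)"

lemma wL2_measurable: "f \<in> wL2 \<mu> n \<Longrightarrow> f \<in> borel_measurable halfline"
  and wL2_L2: "f \<in> wL2 \<mu> n \<Longrightarrow> (\<lambda>y. weight \<mu> n y * f y) \<in> L2 halfline"
  by (auto simp: wL2_def)

lemma wL2I:
  "f \<in> borel_measurable halfline \<Longrightarrow> (\<lambda>y. weight \<mu> n y * f y) \<in> L2 halfline \<Longrightarrow> f \<in> wL2 \<mu> n"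
  by (auto simp: wL2_def)

lemma wnorm_nonneg: "0 \<le> wnorm \<mu> n f"
  by (simp add: wnorm_def L2_norm_nonneg)

lemma wL2_lincomb:
  assumes "f \<in> wL2 \<mu> n" "g \<in> wL2 \<mu> n"
  shows "(\<lambda>y. a * f y + b * g y) \<in> wL2 \<mu> n"
proof (rule wL2I)
  show "(\<lambda>y. weight \<mu> n y * (a * f y + b * g y)) \<in> L2 halfline"
    using L2_lincomb[OF assms[THEN wL2_L2], of a b] by (simp add: algebra_simps)
qed (use assms[THEN wL2_measurable] in measurable)

lemma wL2_diff: "f \<in> wL2 \<mu> n \<Longrightarrow> g \<in> wL2 \<mu> n \<Longrightarrow> (\<lambda>y. f y - c * g y) \<in> wL2 \<mu> n"
  using wL2_lincomb[of f \<mu> n g 1 "- c"] by simp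

lemma wL2_cmult: "f \<in> wL2 \<mu> n \<Longrightarrow> (\<lambda>y. c * f y) \<in> wL2 \<mu> n"
  using wL2_lincomb[of f \<mu> n f c 0] by simp

lemma wnorm_lincomb:
  assumes "f \<in> wL2 \<mu> n" "g \<in> wL2 \<mu> n"
  shows "wnorm \<mu> n (\<lambda>y. a * f y + b * g y) \<le> \<bar>a\<bar> * wnorm \<mu> n f + \<bar>b\<bar> * wnorm \<mu> n g"
  using L2_norm_lincomb[OF assms[THEN wL2_L2], of a b] by (simp add: wnorm_def algebra_simps)

lemma wnorm_diff:
  assumes "f \<in> wL2 \<mu> n" "g \<in> wL2 \<mu> n"
  shows "wnorm \<mu> n (\<lambda>y. f y - c * g y) \<le> wnorm \<mu> n f + \<bar>c\<bar> * wnorm \<mu> n g"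
  using wnorm_lincomb[OF assms, of 1 "- c"] by simp

lemma wnorm_cmult: "wnorm \<mu> n (\<lambda>y. c * f y) = \<bar>c\<bar> * wnorm \<mu> n f"
proof -
  have "(\<lambda>y. (weight \<mu> n y * (c * f y))\<^sup>2) = (\<lambda>y. c\<^sup>2 * (weight \<mu> n y * f y)\<^sup>2)"
    by (auto simp: power_mult_distrib)
  then show ?thesis
    by (simp add: wnorm_def L2_norm_def real_sqrt_mult)
qed

lemma wL2_cong_AE:
  assumes "f \<in> wL2 \<mu> n" and [measurable]: "g \<in> borel_measurable halfline" and "AE y in halfline. f y = g y"
  shows "g \<in> wL2 \<mu> n"
proof (rule wL2I)
  have "AE y in halfline. weight \<mu> n y * f y = weight \<mu> n y * g y"
    using assms(3) by eventually_elim simp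
  then show "(\<lambda>y. weight \<mu> n y * g y) \<in> L2 halfline"
    by (intro L2_cong_AE[OF wL2_L2[OF assms(1)]]) measurable
qed measurable

lemma wnorm_cong_AE:
  assumes [measurable]: "f \<in> borel_measurable halfline" "g \<in> borel_measurable halfline"
    and "AE y in halfline. f y = g y"
  shows "wnorm \<mu> n f = wnorm \<mu> n g"
  unfolding wnorm_def
proof (rule L2_norm_cong_AE)
  show "AE y in halfline. weight \<mu> n y * f y = weight \<mu> n y * g y"
    using assms(3) by eventually_elim simp
qed measurable

lemma winner_cong_AE:
  assumes [measurable]: "f \<in> borel_measurable halfline" "f' \<in> borel_measurable halfline"
    "g \<in> borel_measurable halfline" "g' \<in> borel_measurable halfline"
    and "AE y in halfline. f y = f' y" "AE y in halfline. g y = g' y"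
  shows "winner \<mu> n f g = winner \<mu> n f' g'"
  unfolding winner_def
proof (rule integral_cong_AE)
  show "AE y in halfline. weight \<mu> n y * f y * (weight \<mu> n y * g y) = weight \<mu> n y * f' y * (weight \<mu> n y * g' y)"
    using assms(5,6) by eventually_elim simp
qed measurable

lemma winner_commute: "winner \<mu> n f g = winner \<mu> n g f"
  by (simp add: winner_def mult.commute)

lemma winner_self: "winner \<mu> n f f = (wnorm \<mu> n f)\<^sup>2"
  unfolding winner_def wnorm_def L2_norm_square by (simp add: power2_eq_square)

lemma winner_lincomb_left:
  assumes "f \<in> wL2 \<mu> n" "g \<in> wL2 \<mu> n" "h \<in> wL2 \<mu> n"
  shows "winner \<mu> n (\<lambda>y. a * f y + b * g y) h = a * winner \<mu> n f h + b * winner \<mu> n g h"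
proof -
  have "winner \<mu> n (\<lambda>y. a * f y + b * g y) h
      = (\<integral>y. a * (weight \<mu> n y * f y * (weight \<mu> n y * h y)) + b * (weight \<mu> n y * g y * (weight \<mu> n y * h y)) \<partial>halfline)"
    unfolding winner_def by (intro Bochner_Integration.integral_cong) (auto simp: algebra_simps)
  also have "\<dots> = a * winner \<mu> n f h + b * winner \<mu> n g h"
    using L2_integrable_mult[OF wL2_L2 wL2_L2, OF assms(1,3)] L2_integrable_mult[OF wL2_L2 wL2_L2, OF assms(2,3)]
    by (simp add: winner_def)
  finally show ?thesis .
qed

lemma winner_le:
  "f \<in> wL2 \<mu> n \<Longrightarrow> g \<in> wL2 \<mu> n \<Longrightarrow> \<bar>winner \<mu> n f g\<bar> \<le> wnorm \<mu> n f * wnorm \<mu> n g"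
  unfolding winner_def wnorm_def by (intro L2_cauchy_schwarz wL2_L2)

lemma wL2_mult: "f \<in> wL2 \<mu> (Suc n) \<Longrightarrow> (\<lambda>y. y * f y) \<in> wL2 \<mu> n"
proof (rule wL2I)
  assume f: "f \<in> wL2 \<mu> (Suc n)"
  then have [measurable]: "f \<in> borel_measurable halfline" by (rule wL2_measurable)
  have [measurable]: "(\<lambda>y::real. y) \<in> borel_measurable halfline" by (rule measurable_halflineI) simp
  show "(\<lambda>y. y * f y) \<in> borel_measurable halfline" by measurable
  show "(\<lambda>y. weight \<mu> n y * (y * f y)) \<in> L2 halfline"
    using wL2_L2[OF f] by (simp add: weight_def ac_simps)
qed

text \<open>Half of the decay exp (-2 c y) of the square absorbs the polynomial, the other half is
  integrated.\<close>

lemma power_exp_L2: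
  assumes "0 < c"
  shows "(\<lambda>y. y ^ p * exp (- (c * y))) \<in> L2 halfline"
proof -
  have [measurable]: "(\<lambda>y::real. y ^ p * exp (- (c * y))) \<in> borel_measurable halfline"
    by (rule measurable_halflineI) measurable
  define K where "K = (real (2 * p) / c) ^ (2 * p)"
  have le: "(y ^ p * exp (- (c * y)))\<^sup>2 \<le> K * exp (- (c * y))" if "0 < y" for y :: real
  proof -
    have "(y ^ p * exp (- (c * y)))\<^sup>2 = y ^ (2 * p) * exp (- (2 * (c * y)))"
      unfolding power_mult_distrib power_even_eq exp_of_nat_mult[symmetric] by simp
    also have "\<dots> \<le> (K * exp (c * y)) * exp (- (2 * (c * y)))"
      unfolding K_def using that assms by (intro mult_right_mono power_le_exp) auto
    also have "\<dots> = K * exp (- (c * y))"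
      by (simp add: mult_exp_exp mult.assoc)
    finally show ?thesis .
  qed
  have K0: "0 \<le> K" using assms by (simp add: K_def)
  have "(\<integral>\<^sup>+y. ennreal ((y ^ p * exp (- (c * y)))\<^sup>2) \<partial>halfline) \<le> (\<integral>\<^sup>+y. ennreal K * ennreal (exp (- (c * \<bar>0 - y\<bar>))) \<partial>halfline)"
    using le K0 by (intro nn_integral_mono) (auto simp: ennreal_mult'[symmetric])
  also have "\<dots> = ennreal K * (\<integral>\<^sup>+y. ennreal (exp (- (c * \<bar>0 - y\<bar>))) \<partial>halfline)"
    by (intro nn_integral_cmult measurable_compose[OF measurable_halflineI measurable_ennreal]) measurable
  also have "\<dots> \<le> ennreal K * ennreal (2 / c)"
    by (intro mult_left_mono nn_integral_exp_kernel assms) simp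
  also have "\<dots> < \<infinity>" by (simp add: ennreal_mult_less_top)
  finally have "integrable halfline (\<lambda>y. (y ^ p * exp (- (c * y)))\<^sup>2)"
    by (intro integrableI_nonneg) auto
  then show ?thesis by (simp add: L2_def)
qed

text \<open>Cauchy-Schwarz against \<open>y ^ (m - n) * exp (- (\<mu> / 2 * y))\<close>, the
  quotient of y^m by the weight. The condition n <= m keeps this quotient bounded near 0 and makes
  the subtraction of naturals a true one.\<close>

lemma wL2_moment:
  assumes f: "f \<in> wL2 \<mu> n" and \<mu>: "0 < \<mu>" and "n \<le> m"
  shows "integrable halfline (\<lambda>y. y ^ m * f y)"
    and "\<bar>\<integral>y. y ^ m * f y \<partial>halfline\<bar>
      \<le> L2_norm halfline (\<lambda>y. y ^ (m - n) * exp (- (\<mu> / 2 * y))) * wnorm \<mu> n f"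
proof -
  have eq: "(\<lambda>y. (y ^ (m - n) * exp (- (\<mu> / 2 * y))) * (weight \<mu> n y * f y)) = (\<lambda>y. y ^ m * f y)"
  proof
    fix y :: real
    have "y ^ m = y ^ (m - n) * y ^ n"
      using \<open>n \<le> m\<close> by (simp flip: power_add)
    then show "(y ^ (m - n) * exp (- (\<mu> / 2 * y))) * (weight \<mu> n y * f y) = y ^ m * f y"
      by (simp add: weight_def exp_minus)
  qed
  have E: "(\<lambda>y. y ^ (m - n) * exp (- (\<mu> / 2 * y))) \<in> L2 halfline"
    using power_exp_L2[of "\<mu> / 2"] \<mu> by simp
  show "integrable halfline (\<lambda>y. y ^ m * f y)"
    using L2_integrable_mult[OF E wL2_L2[OF f]] unfolding eq .
  show "\<bar>\<integral>y. y ^ m * f y \<partial>halfline\<bar>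
      \<le> L2_norm halfline (\<lambda>y. y ^ (m - n) * exp (- (\<mu> / 2 * y))) * wnorm \<mu> n f"
    using L2_cauchy_schwarz[OF E wL2_L2[OF f]] unfolding eq wnorm_def .
qed

lemma wL2_moments_from: "f \<in> wL2 \<mu> n \<Longrightarrow> 0 < \<mu> \<Longrightarrow> f \<in> moments_from n"
  by (auto simp: moments_from_def wL2_moment(1) wL2_measurable)

lemma wL2_exp_kernel:
  fixes b c :: real and g u :: "real \<Rightarrow> real"
  assumes b: "0 < b" and c: "0 \<le> c" and g: "g \<in> wL2 \<mu> n" and u [measurable]: "u \<in> borel_measurable halfline"
    and le: "\<And>y. 0 < y \<Longrightarrow> \<bar>weight \<mu> n y * u y\<bar>
      \<le> c * (\<integral>x. exp (- (b * \<bar>y - x\<bar>)) * \<bar>weight \<mu> n x * g x\<bar> \<partial>halfline)"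
  shows "u \<in> wL2 \<mu> n \<and> wnorm \<mu> n u \<le> c * (2 / b) * wnorm \<mu> n g"
  using exp_kernel_L2[OF b c wL2_L2[OF g], of "\<lambda>y. weight \<mu> n y * u y"] le
  by (auto simp: wL2_def wnorm_def)

lemma exp_kernel_integrable:
  assumes b: "0 < b" and g: "g \<in> L2 halfline"
  shows "integrable halfline (\<lambda>x. exp (- (b * \<bar>y - x\<bar>)) * \<bar>g x\<bar>)"
proof -
  have [measurable]: "(\<lambda>x::real. exp (- (b * \<bar>y - x\<bar>))) \<in> borel_measurable halfline"
    by (rule measurable_halflineI) measurable
  have "(\<integral>\<^sup>+x. ennreal ((exp (- (b * \<bar>y - x\<bar>)))\<^sup>2) \<partial>halfline) = (\<integral>\<^sup>+x. ennreal (exp (- (2 * b * \<bar>y - x\<bar>))) \<partial>halfline)"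
    by (simp add: exp_double[symmetric] mult.assoc)
  also have "\<dots> < \<infinity>"
    using nn_integral_exp_kernel[of "2 * b" y] b by (auto intro: le_less_trans)
  finally have E: "(\<lambda>x. exp (- (b * \<bar>y - x\<bar>))) \<in> L2 halfline"
    unfolding L2_def by (auto intro!: integrableI_nonneg)
  have "(\<lambda>x. \<bar>g x\<bar>) \<in> L2 halfline"
    using g by (auto simp: L2_def)
  then show ?thesis by (rule L2_integrable_mult[OF E])
qed

text \<open>From x down to y the exponential part of the weight loses exp (-(mu/2) (x - y)), and the
  power only decreases. This decay turns a tail integral into an integral against an exponential
  kernel.\<close>

lemma weight_le_exp:
  assumes "0 < y" "y \<le> x" "0 < \<mu>"
  shows "weight \<mu> n y \<le> exp (- (\<mu> / 2 * (x - y))) * weight \<mu> n x"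
proof -
  have "exp (- (\<mu> / 2 * (x - y))) * weight \<mu> n x = x ^ n * (exp (- (\<mu> / 2 * (x - y))) * exp (\<mu> / 2 * x))"
    by (simp add: weight_def ac_simps)
  also have "exp (- (\<mu> / 2 * (x - y))) * exp (\<mu> / 2 * x) = exp (\<mu> / 2 * y)"
    by (simp add: mult_exp_exp field_simps)
  finally have "exp (- (\<mu> / 2 * (x - y))) * weight \<mu> n x = x ^ n * exp (\<mu> / 2 * y)" .
  moreover have "y ^ n * exp (\<mu> / 2 * y) \<le> x ^ n * exp (\<mu> / 2 * y)"
    using assms by (intro mult_right_mono power_mono) auto
  ultimately show ?thesis by (simp only: weight_def)
qed

lemma weighted_tail_le:
  assumes f: "f \<in> wL2 \<mu> n" and \<mu>: "0 < \<mu>" and y: "0 < y"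
  shows "weight \<mu> n y * (\<integral>x. indicator {y<..} x * \<bar>f x\<bar> \<partial>halfline)
    \<le> (\<integral>x. exp (- (\<mu> / 2 * \<bar>y - x\<bar>)) * \<bar>weight \<mu> n x * f x\<bar> \<partial>halfline)"
proof -
  have f': "f \<in> moments_from n" using f \<mu> by (rule wL2_moments_from)
  have "integrable halfline (\<lambda>x. \<bar>indicator {y<..} x * f x\<bar>)"
    using moments_from_tail_integrable'[OF f' y] by simp
  then have i: "integrable halfline (\<lambda>x. weight \<mu> n y * (indicator {y<..} x * \<bar>f x\<bar>))"
    by (simp add: abs_mult)
  have "weight \<mu> n y * (\<integral>x. indicator {y<..} x * \<bar>f x\<bar> \<partial>halfline)
      = (\<integral>x. weight \<mu> n y * (indicator {y<..} x * \<bar>f x\<bar>) \<partial>halfline)"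
    by simp
  also have "\<dots> \<le> (\<integral>x. exp (- (\<mu> / 2 * \<bar>y - x\<bar>)) * \<bar>weight \<mu> n x * f x\<bar> \<partial>halfline)"
  proof (rule integral_mono[OF i])
    show "integrable halfline (\<lambda>x. exp (- (\<mu> / 2 * \<bar>y - x\<bar>)) * \<bar>weight \<mu> n x * f x\<bar>)"
      by (rule exp_kernel_integrable) (use \<mu> wL2_L2[OF f] in auto)
    show "weight \<mu> n y * (indicator {y<..} x * \<bar>f x\<bar>) \<le> exp (- (\<mu> / 2 * \<bar>y - x\<bar>)) * \<bar>weight \<mu> n x * f x\<bar>"
      if "x \<in> space halfline" for x
    proof (cases "y < x")
      case True
      have "weight \<mu> n y * \<bar>f x\<bar> \<le> (exp (- (\<mu> / 2 * (x - y))) * weight \<mu> n x) * \<bar>f x\<bar>"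
        using True y \<mu> by (intro mult_right_mono weight_le_exp) auto
      then show ?thesis
        using True weight_pos[of x \<mu> n] that by (simp add: abs_mult ac_simps)
    qed simp
  qed
  finally show ?thesis .
qed

lemma abs_tail_integral_le:
  assumes "f \<in> moments_from n" "0 < y"
  shows "\<bar>tail_integral f y\<bar> \<le> (\<integral>x. indicator {y<..} x * \<bar>f x\<bar> \<partial>halfline)"
proof -
  have "\<bar>tail_integral f y\<bar> \<le> (\<integral>x. \<bar>indicator {y<..} x * f x\<bar> \<partial>halfline)"
    using assms by (simp add: tail_integral_halfline integral_abs_bound)
  then show ?thesis by (simp add: abs_mult)
qed

text \<open>Schur's test with b = mu/2, whose factor 2/b is the constant 4/mu. It is the same for
  every n, since only monotonicity of the power y^n enters.\<close>

lemma wL2_tail_integral: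
  assumes f: "f \<in> wL2 \<mu> n" and \<mu>: "0 < \<mu>"
  shows "tail_integral f \<in> wL2 \<mu> n" and "wnorm \<mu> n (tail_integral f) \<le> 4 / \<mu> * wnorm \<mu> n f"
proof -
  have f': "f \<in> moments_from n" using f \<mu> by (rule wL2_moments_from)
  have "tail_integral f \<in> wL2 \<mu> n \<and> wnorm \<mu> n (tail_integral f) \<le> 1 * (2 / (\<mu> / 2)) * wnorm \<mu> n f"
  proof (rule wL2_exp_kernel[OF _ _ f])
    fix y :: real assume y: "0 < y"
    have "\<bar>weight \<mu> n y * tail_integral f y\<bar> \<le> weight \<mu> n y * (\<integral>x. indicator {y<..} x * \<bar>f x\<bar> \<partial>halfline)"
      using abs_tail_integral_le[OF f' y] weight_pos[OF y, of \<mu> n] by (simp add: abs_mult)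
    also note weighted_tail_le[OF f \<mu> y]
    finally show "\<bar>weight \<mu> n y * tail_integral f y\<bar>
        \<le> 1 * (\<integral>x. exp (- (\<mu> / 2 * \<bar>y - x\<bar>)) * \<bar>weight \<mu> n x * f x\<bar> \<partial>halfline)" by simp
  qed (use \<mu> f' in \<open>auto intro: measurable_tail_integral moments_from_measurable\<close>)
  then show "tail_integral f \<in> wL2 \<mu> n" and "wnorm \<mu> n (tail_integral f) \<le> 4 / \<mu> * wnorm \<mu> n f"
    by auto
qed

section \<open>Coercivity of y D in the weighted norm\<close>

section \<open>The energy inequality\<close>

text \<open>With J = \<open>tail_integral Z\<close> one has Z = - J', so the inner product is minus
  the integral of W (J^2/2)' for W = y^(2n+1) exp (mu y). Integration by parts moves the derivative
  to W, and the term mu y in W' = (2n + 1 + mu y) y^(2n) exp (mu y) may be dropped from below. The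
  pairing is finite because y Z and J both lie in the space of index n.\<close>

lemma energy_inequality:
  assumes Z: "Z \<in> wL2 \<mu> (Suc n)" and IZ: "tail_integral Z \<in> wL2 \<mu> n" and \<mu>: "0 < \<mu>"
  shows "real (2 * n + 1) / 2 * (wnorm \<mu> n (tail_integral Z))\<^sup>2
    \<le> winner \<mu> n (\<lambda>y. y * Z y) (tail_integral Z)"
proof -
  let ?J = "tail_integral Z"
  define f where "f = (\<lambda>y. Z y * ?J y)"
  define W where "W = (\<lambda>y::real. y ^ (2 * n + 1) * exp (\<mu> * y))"
  define W' where "W' = (\<lambda>y::real. (real (2 * n + 1) + \<mu> * y) * (y ^ (2 * n) * exp (\<mu> * y)))"
  have Zm: "Z \<in> moments_from (Suc n)" using Z \<mu> by (rule wL2_moments_from)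
  have [measurable]: "Z \<in> borel_measurable halfline" using Z by (rule wL2_measurable)
  have [measurable]: "?J \<in> borel_measurable halfline" using IZ by (rule wL2_measurable)
  have fm: "f \<in> borel_measurable halfline" unfolding f_def by measurable
  have W: "(W has_real_derivative W' y) (at y)" for y
    unfolding W_def W'_def
    by (rule derivative_eq_intros refl | simp)+ (simp add: algebra_simps)
  have W'm: "W' \<in> borel_measurable borel" unfolding W'_def by measurable
  have eq: "(\<lambda>y. weight \<mu> n y * (y * Z y) * (weight \<mu> n y * ?J y)) = (\<lambda>y. f y * W y)"
  proof
    fix y
    have "weight \<mu> n y * (y * Z y) * (weight \<mu> n y * ?J y) = (weight \<mu> n y)\<^sup>2 * y * f y"
      by (simp add: f_def power2_eq_square)
    then show "weight \<mu> n y * (y * Z y) * (weight \<mu> n y * ?J y) = f y * W y"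
      unfolding weight_square by (simp only: W_def power_add power_one_right mult.commute mult.left_commute)
  qed
  have i: "integrable halfline (\<lambda>y. f y * W y)"
    using L2_integrable_mult[OF wL2_L2[OF wL2_mult[OF Z]] wL2_L2[OF IZ]] unfolding eq .
  have W0: "W 0 = 0" by (simp add: W_def)
  have i': "integrable halfline (\<lambda>x. indicator {0<..} x * (f x * (W x - W 0)))"
    by (rule Bochner_Integration.integrable_cong[OF refl, THEN iffD2, OF _ i]) (simp add: W0)
  have pos: "0 \<le> W' x" if "0 \<le> x" for x
    using that \<mu> by (simp add: W'_def)
  note * = tail_fubini_primitive[OF order_refl fm W'm W pos i']
  have If: "tail_integral f y = (?J y)\<^sup>2 / 2" if "0 < y" for y
    using tail_integral_square(2)[OF Zm that] by (simp add: f_def)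
  \<comment> \<open>Integrability of J^2 against the larger weight W' is an output of
    Fubini.\<close>
  have i2: "integrable halfline (\<lambda>y. W' y * ((?J y)\<^sup>2 / 2))"
    by (rule Bochner_Integration.integrable_cong[OF refl, THEN iffD1, OF _ *(1)]) (simp add: If)
  have "winner \<mu> n (\<lambda>y. y * Z y) ?J = (\<integral>y. f y * W y \<partial>halfline)"
    unfolding winner_def eq ..
  also have "\<dots> = (\<integral>x. indicator {0<..} x * (f x * (W x - W 0)) \<partial>halfline)"
    by (intro Bochner_Integration.integral_cong) (auto simp: W0)
  also have "\<dots> = (\<integral>y. indicator {0<..} y * (W' y * tail_integral f y) \<partial>halfline)"
    by (rule *(2)[symmetric]) auto
  also have "\<dots> = (\<integral>y. W' y * ((?J y)\<^sup>2 / 2) \<partial>halfline)"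
    by (intro Bochner_Integration.integral_cong) (auto simp: If)
  finally have 1: "winner \<mu> n (\<lambda>y. y * Z y) ?J = (\<integral>y. W' y * ((?J y)\<^sup>2 / 2) \<partial>halfline)" .
  have "real (2 * n + 1) / 2 * (wnorm \<mu> n ?J)\<^sup>2 = (\<integral>y. real (2 * n + 1) / 2 * (weight \<mu> n y * ?J y)\<^sup>2 \<partial>halfline)"
    by (simp add: wnorm_def L2_norm_square del: of_nat_add of_nat_mult)
  also have "\<dots> \<le> (\<integral>y. W' y * ((?J y)\<^sup>2 / 2) \<partial>halfline)"
  proof (rule integral_mono[OF _ i2])
    show "integrable halfline (\<lambda>y. real (2 * n + 1) / 2 * (weight \<mu> n y * ?J y)\<^sup>2)"
      by (intro Bochner_Integration.integrable_mult_right L2_integrable_square wL2_L2[OF IZ])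
    show "real (2 * n + 1) / 2 * (weight \<mu> n y * ?J y)\<^sup>2 \<le> W' y * ((?J y)\<^sup>2 / 2)" if "y \<in> space halfline" for y
    proof -
      have "real (2 * n + 1) * ((y ^ (2 * n) * exp (\<mu> * y)) * ((?J y)\<^sup>2 / 2))
          \<le> (real (2 * n + 1) + \<mu> * y) * ((y ^ (2 * n) * exp (\<mu> * y)) * ((?J y)\<^sup>2 / 2))"
        using that \<mu> by (intro mult_right_mono mult_nonneg_nonneg) auto
      then show ?thesis
        by (simp add: W'_def power_mult_distrib weight_square ac_simps del: of_nat_add of_nat_mult)
    qed
  qed
  finally show ?thesis using 1 by simp
qed

section \<open>Lower bounds for 1 - aI modulo its kernel\<close>

section \<open>Inverting the operator $1 - aI$\<close>

lemma interval_exp_integrable: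
  assumes F: "F \<in> moments_from n" and y: "0 < y" and a: "0 < a"
  shows "integrable halfline (\<lambda>x. indicator {y<..<z} x * (exp (a * x) * F x))"
proof (rule Bochner_Integration.integrable_bound)
  show "integrable halfline (\<lambda>x. exp (a * z) * (indicator {y<..} x * F x))"
    by (intro Bochner_Integration.integrable_mult_right moments_from_tail_integrable'[OF F y])
  have [measurable]: "F \<in> borel_measurable halfline" using F by (rule moments_from_measurable)
  have [measurable]: "(\<lambda>x. exp (a * x)) \<in> borel_measurable halfline"
    by (rule measurable_halflineI) measurable
  show "(\<lambda>x. indicator {y<..<z} x * (exp (a * x) * F x)) \<in> borel_measurable halfline" by measurable
  have "norm (indicator {y<..<z} x * (exp (a * x) * F x)) \<le> norm (exp (a * z) * (indicator {y<..} x * F x))" for x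
  proof (cases "x \<in> {y<..<z}")
    case True
    then have "exp (a * x) * \<bar>F x\<bar> \<le> exp (a * z) * \<bar>F x\<bar>"
      using a by (intro mult_right_mono) auto
    with True show ?thesis by (simp add: abs_mult)
  qed simp
  then show "AE x in halfline. norm (indicator {y<..<z} x * (exp (a * x) * F x))
      \<le> norm (exp (a * z) * (indicator {y<..} x * F x))" by simp
qed

text \<open>
  The function \<open>J = I F\<close> solves \<open>J' + a J = - (F - a J)\<close>, which is the variation of constants formula
  below in integrated form.
\<close>

lemma tail_integral_variation_of_constants:
  assumes F: "F \<in> moments_from n" and y: "0 < y" "y \<le> z" and a: "0 < a"
  shows "exp (a * y) * tail_integral F y - exp (a * z) * tail_integral F z
    = (\<integral>x. indicator {y<..<z} x * (exp (a * x) * (F x - a * tail_integral F x)) \<partial>halfline)"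
proof -
  let ?J = "tail_integral F"
  have J: "?J \<in> moments_from n" using F by (rule moments_from_tail_integral')
  define K where "K = (\<lambda>x. exp (a * x))"
  define \<kappa> where "\<kappa> = (\<lambda>x. a * exp (a * x))"
  have K: "(K has_real_derivative \<kappa> x) (at x)" for x
    unfolding K_def \<kappa>_def by (auto intro!: derivative_eq_intros)
  have \<kappa>: "\<kappa> \<in> borel_measurable borel" unfolding \<kappa>_def by measurable
  have \<kappa>0: "0 \<le> \<kappa> x" for x using a by (simp add: \<kappa>_def)
  have [measurable]: "F \<in> borel_measurable halfline" using F by (rule moments_from_measurable)
  have [measurable]: "(\<lambda>x. indicator {..<z} x :: real) \<in> borel_measurable halfline"
    by (rule measurable_halflineI) measurable
  \<comment> \<open>Cutting F off at z keeps the product with the exponentially growing kernel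
    integrable; below z the tail of the cut function is \<open>?J x - ?J z\<close>.\<close>
  define f where "f = (\<lambda>x. indicator {..<z} x * F x)"
  have fm: "f \<in> borel_measurable halfline" unfolding f_def by measurable
  have iF: "integrable halfline (\<lambda>x. indicator {y<..<z} x * (K x * F x))"
    unfolding K_def by (rule interval_exp_integrable[OF F y(1) a])
  have iJ: "integrable halfline (\<lambda>x. indicator {y<..<z} x * (K x * ?J x))"
    unfolding K_def by (rule interval_exp_integrable[OF J y(1) a])
  have i0: "integrable halfline (\<lambda>x. indicator {y<..<z} x * F x)"
  proof (rule Bochner_Integration.integrable_bound[OF moments_from_tail_integrable'[OF F y(1)]])
    show "AE x in halfline. norm (indicator {y<..<z} x * F x) \<le> norm (indicator {y<..} x * F x)"
      by (auto simp: indicator_def)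
  qed measurable
  have "integrable halfline (\<lambda>x. indicator {y<..<z} x * (K x * F x) - K y * (indicator {y<..<z} x * F x))"
    using iF i0 by (intro Bochner_Integration.integrable_diff Bochner_Integration.integrable_mult_right)
  then have i: "integrable halfline (\<lambda>x. indicator {y<..} x * (f x * (K x - K y)))"
    by (rule Bochner_Integration.integrable_cong[OF refl, THEN iffD1, rotated])
       (case_tac "y < x"; case_tac "x < z"; simp add: f_def algebra_simps)
  have If: "tail_integral f x = indicator {..<z} x * (?J x - ?J z)" if "y < x" for x
  proof -
    have x: "0 < x" using that y by simp
    have 1: "tail_integral f x = (\<integral>t. indicator {x<..<z} t * F t \<partial>halfline)"
      unfolding tail_integral_halfline[OF less_imp_le[OF x]]
      by (intro Bochner_Integration.integral_cong) (auto simp: f_def indicator_def)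
    show ?thesis
    proof (cases "x < z")
      case True
      then show ?thesis unfolding 1 using tail_integral_diff_interval[OF F x, of z] by simp
    qed (simp add: 1)
  qed
  have i\<kappa>: "integrable halfline (\<lambda>x. indicator {y<..<z} x * \<kappa> x)"
  proof (rule integrableI_bounded)
    have [measurable]: "\<kappa> \<in> borel_measurable halfline" using \<kappa> by (rule measurable_halflineI)
    show "(\<lambda>x. indicator {y<..<z} x * \<kappa> x) \<in> borel_measurable halfline" by measurable
    show "(\<integral>\<^sup>+x. ennreal (norm (indicator {y<..<z} x * \<kappa> x)) \<partial>halfline) < \<infinity>"
      using halfline_FTC(1)[OF less_imp_le[OF y(1)] y(2) \<kappa> K \<kappa>0] by (simp add: abs_mult)
  qed
  have "(\<integral>x. a * (indicator {y<..<z} x * (K x * ?J x)) - ?J z * (indicator {y<..<z} x * \<kappa> x) \<partial>halfline)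
      = (\<integral>x. indicator {y<..} x * (\<kappa> x * tail_integral f x) \<partial>halfline)"
    by (intro Bochner_Integration.integral_cong refl)
       (auto simp: If K_def \<kappa>_def indicator_def algebra_simps)
  also have "\<dots> = (\<integral>x. indicator {y<..} x * (f x * (K x - K y)) \<partial>halfline)"
    by (rule tail_fubini_primitive(2)[OF _ fm \<kappa> K \<kappa>0 i]) (use y in auto)
  also have "\<dots> = (\<integral>x. indicator {y<..<z} x * (K x * F x) - K y * (indicator {y<..<z} x * F x) \<partial>halfline)"
    by (intro Bochner_Integration.integral_cong refl) (auto simp: f_def indicator_def algebra_simps)
  also have "\<dots> = (\<integral>x. indicator {y<..<z} x * (K x * F x) \<partial>halfline) - K y * (?J y - ?J z)"
    using iF i0 tail_integral_diff_interval[OF F y] by simp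
  also have "(\<integral>x. a * (indicator {y<..<z} x * (K x * ?J x)) - ?J z * (indicator {y<..<z} x * \<kappa> x) \<partial>halfline)
      = a * (\<integral>x. indicator {y<..<z} x * (K x * ?J x) \<partial>halfline) - ?J z * (K z - K y)"
    using iJ i\<kappa> halfline_FTC(2)[OF less_imp_le[OF y(1)] y(2) \<kappa> K \<kappa>0] by simp
  finally have eq: "K y * ?J y - K z * ?J z = (\<integral>x. indicator {y<..<z} x * (K x * F x) \<partial>halfline)
      - a * (\<integral>x. indicator {y<..<z} x * (K x * ?J x) \<partial>halfline)"
    by (simp add: algebra_simps)
  also have "\<dots> = (\<integral>x. indicator {y<..<z} x * (K x * F x) - a * (indicator {y<..<z} x * (K x * ?J x)) \<partial>halfline)"
    using iF iJ by simp
  also have "\<dots> = (\<integral>x. indicator {y<..<z} x * (K x * (F x - a * ?J x)) \<partial>halfline)"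
    by (intro Bochner_Integration.integral_cong refl) (simp add: algebra_simps)
  finally show ?thesis by (simp add: K_def)
qed

text \<open>For x >= 1 one has y <= x (1 + (y - x)), so y^n / x^n is at most (1 + (y - x))^n. Of the
  surplus decay 2 b = a - mu/2 one half absorbs this polynomial through \<open>power_le_exp\<close>,
  and the other half remains.\<close>

lemma weight_exp_le:
  assumes "1 \<le> x" "x \<le> y" "0 < b" "a = \<mu> / 2 + 2 * b"
  shows "weight \<mu> n y * exp (- (a * (y - x))) \<le> (real n / b) ^ n * exp b * (exp (- (b * (y - x))) * weight \<mu> n x)"
proof -
  have "x * 1 + (y - x) * 1 \<le> x * 1 + (y - x) * x"
    using assms by (intro add_left_mono mult_left_mono) auto
  then have "y \<le> x * (1 + (y - x))"
    by (simp add: algebra_simps)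
  then have "y ^ n \<le> (x * (1 + (y - x))) ^ n"
    using assms by (intro power_mono) auto
  also have "\<dots> = x ^ n * (1 + (y - x)) ^ n" by (rule power_mult_distrib)
  also have "\<dots> \<le> x ^ n * ((real n / b) ^ n * exp (b * (1 + (y - x))))"
    using assms by (intro mult_left_mono power_le_exp) auto
  finally have "y ^ n * (exp (\<mu> / 2 * y) * exp (- (a * (y - x))))
      \<le> x ^ n * ((real n / b) ^ n * exp (b * (1 + (y - x)))) * (exp (\<mu> / 2 * y) * exp (- (a * (y - x))))"
    by (intro mult_right_mono) auto
  also have "\<dots> = x ^ n * (real n / b) ^ n * (exp (b * (1 + (y - x))) * (exp (\<mu> / 2 * y) * exp (- (a * (y - x)))))"
    by (simp only: mult.assoc)
  also have "exp (b * (1 + (y - x))) * (exp (\<mu> / 2 * y) * exp (- (a * (y - x))))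
      = exp b * (exp (- (b * (y - x))) * exp (\<mu> / 2 * x))"
    unfolding mult_exp_exp assms(4) by (simp add: field_simps)
  finally show ?thesis
    by (simp only: weight_def mult.assoc mult.left_commute mult.commute)
qed

lemma halfline_not_null: "\<not> (AE y in halfline. False)"
proof
  assume "AE y in halfline. False"
  then have "AE y in lborel. y \<notin> {0<..<1::real}"
    unfolding AE_halfline by eventually_elim auto
  moreover have "{y \<in> space lborel. \<not> y \<notin> {0<..<1::real}} = {0<..<1}" by auto
  ultimately show False
    using AE_iff_measurable[of "{0<..<1::real}" lborel "\<lambda>y. y \<notin> {0<..<1}"] by simp
qed

text \<open>Used to see that exponentials have nonzero moments, so that they can serve to adjust a
  moment.\<close>

lemma halfline_integral_pos:
  fixes f :: "real \<Rightarrow> real"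
  assumes "integrable halfline f" "\<And>y. 0 < y \<Longrightarrow> 0 < f y"
  shows "0 < (\<integral>y. f y \<partial>halfline)"
proof -
  have nn: "AE y in halfline. 0 \<le> f y"
    by (rule AE_I2) (use assms(2) in \<open>auto intro: less_imp_le\<close>)
  have "(\<integral>y. f y \<partial>halfline) \<noteq> 0"
  proof
    assume "(\<integral>y. f y \<partial>halfline) = 0"
    then have "AE y in halfline. f y = 0"
      using integral_nonneg_eq_0_iff_AE[OF assms(1) nn] by simp
    moreover have "AE y in halfline. 0 < f y" by (rule AE_I2) (use assms(2) in auto)
    ultimately have "AE y in halfline. False" by eventually_elim simp
    with halfline_not_null show False by simp
  qed
  with integral_nonneg_AE[OF nn] show ?thesis by simp
qed

text \<open>A slower decay only enlarges the kernel; this merges the different rates on the two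
  sides of 1 into a single rate b.\<close>

lemma exp_kernel_mono:
  assumes "0 < b" "b \<le> b'" "g \<in> L2 halfline"
  shows "(\<integral>x. exp (- (b' * \<bar>y - x\<bar>)) * \<bar>g x\<bar> \<partial>halfline) \<le> (\<integral>x. exp (- (b * \<bar>y - x\<bar>)) * \<bar>g x\<bar> \<partial>halfline)"
  using assms by (intro integral_mono exp_kernel_integrable mult_right_mono) (auto intro!: mult_right_mono)

text \<open>R is the solution of R' + a R = - G that vanishes at 1. For y <= 1 it is an integral of
  G over (y, 1), controlled because the weight increases; for y >= 1 it is an integral over (1, y)
  with kernel exp (-a (y - x)), whose decay beats the growth rate mu/2 of the weight. A start at 0
  would fail, since the ratios y^n / x^n of weights are unbounded as x tends to 0.\<close>

lemma tail_integral_particular_bound: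
  assumes F: "F \<in> wL2 \<mu> n" and \<mu>: "0 < \<mu>" and a: "\<mu> / 2 < a"
    and b: "b = min (\<mu> / 2) ((a - \<mu> / 2) / 2)" and C: "C = exp a + (real n / ((a - \<mu> / 2) / 2)) ^ n * exp ((a - \<mu> / 2) / 2)"
  defines "R \<equiv> \<lambda>y. tail_integral F y - exp a * tail_integral F 1 * exp (- (a * y))"
    and "G \<equiv> \<lambda>y. F y - a * tail_integral F y"
  shows "R \<in> wL2 \<mu> n" and "wnorm \<mu> n R \<le> C * (2 / b) * wnorm \<mu> n G"
proof -
  let ?J = "tail_integral F"
  have a0: "0 < a" using a \<mu> by simp
  have J: "?J \<in> wL2 \<mu> n" using wL2_tail_integral(1)[OF F \<mu>] .
  have G: "G \<in> wL2 \<mu> n" unfolding G_def by (rule wL2_diff[OF F J])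
  have Fm: "F \<in> moments_from n" and Gm: "G \<in> moments_from n"
    using F G \<mu> by (auto intro: wL2_moments_from)
  have b0: "0 < b" using a \<mu> b by simp
  have C0: "0 \<le> C" using a unfolding C by (intro add_nonneg_nonneg mult_nonneg_nonneg zero_le_power) auto
  have [measurable]: "?J \<in> borel_measurable halfline" using J by (rule wL2_measurable)
  have [measurable]: "(\<lambda>y. exp (- (a * y))) \<in> borel_measurable halfline" by (rule measurable_halflineI) measurable
  have Rm: "R \<in> borel_measurable halfline" unfolding R_def by measurable
  define T where "T = (\<lambda>b y. \<integral>x. exp (- (b * \<bar>y - x\<bar>)) * \<bar>weight \<mu> n x * G x\<bar> \<partial>halfline)"
  have T0: "0 \<le> T b' y" for b' y unfolding T_def by simp
  have T_mono: "T b' y \<le> T b y" if "b \<le> b'" for b' y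
    unfolding T_def by (rule exp_kernel_mono[OF b0 that wL2_L2[OF G]])
  have "R \<in> wL2 \<mu> n \<and> wnorm \<mu> n R \<le> C * (2 / b) * wnorm \<mu> n G"
  proof (rule wL2_exp_kernel[OF b0 C0 G Rm])
    fix y :: real assume y: "0 < y"
    have R: "R y = exp (- (a * y)) * (exp (a * y) * ?J y - exp a * ?J 1)"
      by (simp add: R_def algebra_simps mult_exp_exp)
    have "\<bar>weight \<mu> n y * R y\<bar> \<le> C * T b y"
    proof (cases "y \<le> 1")
      case True
      have "R y = exp (- (a * y)) * (\<integral>x. indicator {y<..<1} x * (exp (a * x) * G x) \<partial>halfline)"
        unfolding R G_def using tail_integral_variation_of_constants[OF Fm y True a0] by simp
      then have "\<bar>R y\<bar> = \<bar>\<integral>x. exp (- (a * y)) * (indicator {y<..<1} x * (exp (a * x) * G x)) \<partial>halfline\<bar>"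
        by simp
      also have "\<dots> \<le> (\<integral>x. \<bar>exp (- (a * y)) * (indicator {y<..<1} x * (exp (a * x) * G x))\<bar> \<partial>halfline)"
        by (rule integral_abs_bound)
      also have "\<dots> \<le> (\<integral>x. exp a * \<bar>indicator {y<..} x * G x\<bar> \<partial>halfline)"
      proof (rule integral_mono)
        show "integrable halfline (\<lambda>x. \<bar>exp (- (a * y)) * (indicator {y<..<1} x * (exp (a * x) * G x))\<bar>)"
          by (intro integrable_abs Bochner_Integration.integrable_mult_right interval_exp_integrable[OF Gm y a0])
        show "integrable halfline (\<lambda>x. exp a * \<bar>indicator {y<..} x * G x\<bar>)"
          by (intro integrable_abs Bochner_Integration.integrable_mult_right moments_from_tail_integrable'[OF Gm y])
        show "\<bar>exp (- (a * y)) * (indicator {y<..<1} x * (exp (a * x) * G x))\<bar> \<le> exp a * \<bar>indicator {y<..} x * G x\<bar>" for x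
        proof (cases "x \<in> {y<..<1}")
          case True
          have "a * (x - y) \<le> a * 1" using True a0 y by (intro mult_left_mono) auto
          then have "exp (- (a * y)) * exp (a * x) \<le> exp a"
            by (simp add: mult_exp_exp algebra_simps)
          then have "exp (- (a * y)) * exp (a * x) * \<bar>G x\<bar> \<le> exp a * \<bar>G x\<bar>"
            by (intro mult_right_mono) auto
          with True show ?thesis by (simp add: abs_mult)
        qed auto
      qed
      finally have "\<bar>R y\<bar> \<le> exp a * (\<integral>x. indicator {y<..} x * \<bar>G x\<bar> \<partial>halfline)"
        by (simp add: abs_mult)
      then have "weight \<mu> n y * \<bar>R y\<bar> \<le> weight \<mu> n y * (exp a * (\<integral>x. indicator {y<..} x * \<bar>G x\<bar> \<partial>halfline))"
        using weight_pos[OF y, of \<mu> n] by (intro mult_left_mono) auto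
      also have "\<dots> = exp a * (weight \<mu> n y * (\<integral>x. indicator {y<..} x * \<bar>G x\<bar> \<partial>halfline))"
        by simp
      also have "\<dots> \<le> exp a * T (\<mu> / 2) y"
        unfolding T_def by (intro mult_left_mono weighted_tail_le[OF G \<mu> y]) simp
      also have "\<dots> \<le> C * T b y"
      proof (rule mult_mono[OF _ T_mono C0 T0])
        show "exp a \<le> C" unfolding C using a by (simp add: zero_le_power)
        show "b \<le> \<mu> / 2" unfolding b by simp
      qed
      finally show ?thesis using weight_pos[OF y, of \<mu> n] by (simp add: abs_mult)
    next
      case False
      \<comment> \<open>Half of the surplus a - mu/2, matching the split in
        \<open>weight_exp_le\<close>.\<close>
      define b' where "b' = (a - \<mu> / 2) / 2"
      have b': "0 < b'" "a = \<mu> / 2 + 2 * b'" using a by (auto simp: b'_def field_simps)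
      have "R y = - (exp (- (a * y)) * (\<integral>x. indicator {1<..<y} x * (exp (a * x) * G x) \<partial>halfline))"
        unfolding R G_def using tail_integral_variation_of_constants[OF Fm _ _ a0, of 1 y] False
        by (simp add: algebra_simps)
      then have "weight \<mu> n y * \<bar>R y\<bar> = weight \<mu> n y * exp (- (a * y)) * \<bar>\<integral>x. indicator {1<..<y} x * (exp (a * x) * G x) \<partial>halfline\<bar>"
        by (simp add: abs_mult)
      also have "\<dots> \<le> weight \<mu> n y * exp (- (a * y)) * (\<integral>x. \<bar>indicator {1<..<y} x * (exp (a * x) * G x)\<bar> \<partial>halfline)"
        using weight_pos[OF y, of \<mu> n] by (intro mult_left_mono integral_abs_bound) auto
      also have "\<dots> = (\<integral>x. weight \<mu> n y * exp (- (a * y)) * \<bar>indicator {1<..<y} x * (exp (a * x) * G x)\<bar> \<partial>halfline)"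
        by simp
      also have "\<dots> \<le> (\<integral>x. ((real n / b') ^ n * exp b') * (exp (- (b' * \<bar>y - x\<bar>)) * \<bar>weight \<mu> n x * G x\<bar>) \<partial>halfline)"
      proof (rule integral_mono)
        show "integrable halfline (\<lambda>x. weight \<mu> n y * exp (- (a * y)) * \<bar>indicator {1<..<y} x * (exp (a * x) * G x)\<bar>)"
          by (intro integrable_abs Bochner_Integration.integrable_mult_right interval_exp_integrable[OF Gm _ a0]) simp
        show "integrable halfline (\<lambda>x. ((real n / b') ^ n * exp b') * (exp (- (b' * \<bar>y - x\<bar>)) * \<bar>weight \<mu> n x * G x\<bar>))"
          by (intro Bochner_Integration.integrable_mult_right exp_kernel_integrable b' wL2_L2[OF G])
        show "weight \<mu> n y * exp (- (a * y)) * \<bar>indicator {1<..<y} x * (exp (a * x) * G x)\<bar>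
            \<le> ((real n / b') ^ n * exp b') * (exp (- (b' * \<bar>y - x\<bar>)) * \<bar>weight \<mu> n x * G x\<bar>)"
          if "x \<in> space halfline" for x
        proof (cases "x \<in> {1<..<y}")
          case True
          have "weight \<mu> n y * exp (- (a * (y - x))) * \<bar>G x\<bar>
              \<le> (real n / b') ^ n * exp b' * (exp (- (b' * (y - x))) * weight \<mu> n x) * \<bar>G x\<bar>"
            using True by (intro mult_right_mono weight_exp_le b') auto
          moreover have "exp (- (a * (y - x))) = exp (- (a * y)) * exp (a * x)"
            by (simp add: mult_exp_exp algebra_simps)
          moreover have "\<bar>weight \<mu> n x\<bar> = weight \<mu> n x" "\<bar>y - x\<bar> = y - x"
            using True weight_pos[of x \<mu> n] by auto
          ultimately show ?thesis
            using True by (simp add: abs_mult mult.assoc)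
        next
          case False
          then show ?thesis using b' by (auto intro!: mult_nonneg_nonneg zero_le_power)
        qed
      qed
      also have "\<dots> = ((real n / b') ^ n * exp b') * T b' y" by (simp add: T_def)
      also have "\<dots> \<le> C * T b y"
      proof (rule mult_mono[OF _ T_mono C0 T0])
        show "(real n / b') ^ n * exp b' \<le> C" unfolding C b'_def by simp
        show "b \<le> b'" unfolding b b'_def by (rule min.cobounded2)
      qed
      finally show ?thesis using weight_pos[OF y, of \<mu> n] by (simp add: abs_mult)
    qed
    then show "\<bar>weight \<mu> n y * R y\<bar> \<le> C * (\<integral>x. exp (- (b * \<bar>y - x\<bar>)) * \<bar>weight \<mu> n x * G x\<bar> \<partial>halfline)"
      by (simp add: T_def)
  qed
  then show "R \<in> wL2 \<mu> n" "wnorm \<mu> n R \<le> C * (2 / b) * wnorm \<mu> n G" by auto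
qed

text \<open>Since F = G + a J and J differs from R by a multiple of E = exp (-a y), one has F = P +
  c E with P = G + a R already bounded by G. The n-th moment of E is positive, so the moment of F
  determines c up to the moment of P, which Cauchy-Schwarz bounds. The condition mu/2 < a puts E
  into the space.\<close>

lemma resolvent_bound:
  assumes \<mu>: "0 < \<mu>" and a: "\<mu> / 2 < a"
  obtains C where "0 \<le> C"
    and "\<And>F. F \<in> wL2 \<mu> n \<Longrightarrow>
      wnorm \<mu> n F \<le> C * (wnorm \<mu> n (\<lambda>y. F y - a * tail_integral F y) + \<bar>\<integral>y. y ^ n * F y \<partial>halfline\<bar>)"
proof -
  have a0: "0 < a" using a \<mu> by simp
  define b where "b = min (\<mu> / 2) ((a - \<mu> / 2) / 2)"
  define C1 where "C1 = (exp a + (real n / ((a - \<mu> / 2) / 2)) ^ n * exp ((a - \<mu> / 2) / 2)) * (2 / b)"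
  have b0: "0 < b" using a \<mu> by (simp add: b_def)
  have C1: "0 \<le> C1"
    unfolding C1_def using a b0 by (intro mult_nonneg_nonneg add_nonneg_nonneg zero_le_power) auto
  define E where "E = (\<lambda>y. exp (- (a * y)))"
  have E: "E \<in> wL2 \<mu> n"
  proof (rule wL2I)
    show "E \<in> borel_measurable halfline" unfolding E_def by (rule measurable_halflineI) measurable
    have "(\<lambda>y. weight \<mu> n y * E y) = (\<lambda>y. y ^ n * exp (- ((a - \<mu> / 2) * y)))"
      by (auto simp: weight_def E_def mult_exp_exp mult.assoc algebra_simps)
    then show "(\<lambda>y. weight \<mu> n y * E y) \<in> L2 halfline"
      using power_exp_L2[of "a - \<mu> / 2" n] a by simp
  qed
  define e where "e = (\<integral>y. y ^ n * E y \<partial>halfline)"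
  have e: "0 < e"
    unfolding e_def by (rule halfline_integral_pos[OF wL2_moment(1)[OF E \<mu>]]) (auto simp: E_def)
  define M where "M = L2_norm halfline (\<lambda>y. y ^ (n - n) * exp (- (\<mu> / 2 * y)))"
  have M: "0 \<le> M" by (simp add: M_def L2_norm_nonneg)
  \<comment> \<open>The bound for P = G + a R in terms of G.\<close>
  define D where "D = 1 + a * C1"
  have D: "0 \<le> D" using a0 C1 by (simp add: D_def)
  define C where "C = D + (1 + M * D) * (wnorm \<mu> n E / e)"
  have "wnorm \<mu> n F \<le> C * (wnorm \<mu> n (\<lambda>y. F y - a * tail_integral F y) + \<bar>\<integral>y. y ^ n * F y \<partial>halfline\<bar>)"
    if F: "F \<in> wL2 \<mu> n" for F
  proof -
    define G where "G = (\<lambda>y. F y - a * tail_integral F y)"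
    define R where "R = (\<lambda>y. tail_integral F y - exp a * tail_integral F 1 * exp (- (a * y)))"
    define c where "c = a * (exp a * tail_integral F 1)"
    have R: "R \<in> wL2 \<mu> n" "wnorm \<mu> n R \<le> C1 * wnorm \<mu> n G"
      using tail_integral_particular_bound[OF F \<mu> a b_def refl] by (simp_all add: R_def G_def C1_def)
    have G: "G \<in> wL2 \<mu> n" unfolding G_def by (rule wL2_diff[OF F wL2_tail_integral(1)[OF F \<mu>]])
    define P where "P = (\<lambda>y. 1 * G y + a * R y)"
    have P: "P \<in> wL2 \<mu> n" unfolding P_def by (rule wL2_lincomb[OF G R(1)])
    have "wnorm \<mu> n P \<le> wnorm \<mu> n G + a * wnorm \<mu> n R"
      using wnorm_lincomb[OF G R(1), of 1 a] a0 by (simp add: P_def)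
    also have "\<dots> \<le> D * wnorm \<mu> n G"
      using mult_left_mono[OF R(2), of a] a0 by (simp add: D_def algebra_simps)
    finally have Pn: "wnorm \<mu> n P \<le> D * wnorm \<mu> n G" .
    have F_eq: "F = (\<lambda>y. 1 * P y + c * E y)"
      by (auto simp: P_def G_def R_def c_def E_def algebra_simps)
    have "(\<integral>y. y ^ n * F y \<partial>halfline) = (\<integral>y. y ^ n * P y + c * (y ^ n * E y) \<partial>halfline)"
      by (subst F_eq) (simp add: algebra_simps)
    also have "\<dots> = (\<integral>y. y ^ n * P y \<partial>halfline) + c * e"
      using wL2_moment(1)[OF P \<mu> order_refl] wL2_moment(1)[OF E \<mu> order_refl] by (simp add: e_def)
    finally have "c * e = (\<integral>y. y ^ n * F y \<partial>halfline) - (\<integral>y. y ^ n * P y \<partial>halfline)" by simp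
    moreover have "\<bar>c * e\<bar> = \<bar>c\<bar> * e" using e by (simp add: abs_mult)
    ultimately have "\<bar>c\<bar> * e \<le> \<bar>\<integral>y. y ^ n * F y \<partial>halfline\<bar> + \<bar>\<integral>y. y ^ n * P y \<partial>halfline\<bar>"
      by linarith
    also have "\<bar>\<integral>y. y ^ n * P y \<partial>halfline\<bar> \<le> M * wnorm \<mu> n P"
      using wL2_moment(2)[OF P \<mu> order_refl] by (simp add: M_def)
    also have "M * wnorm \<mu> n P \<le> M * (D * wnorm \<mu> n G)"
      by (rule mult_left_mono[OF Pn M])
    finally have c: "\<bar>c\<bar> \<le> (\<bar>\<integral>y. y ^ n * F y \<partial>halfline\<bar> + M * (D * wnorm \<mu> n G)) / e"
      using e by (simp add: field_simps)
    let ?m = "\<bar>\<integral>y. y ^ n * F y \<partial>halfline\<bar>" and ?g = "wnorm \<mu> n G"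
    have g: "0 \<le> ?g" by (rule wnorm_nonneg)
    have "?m + M * (D * ?g) \<le> (1 + M * D) * (?g + ?m)"
      using g M D by (simp add: algebra_simps)
    have "wnorm \<mu> n F \<le> wnorm \<mu> n P + \<bar>c\<bar> * wnorm \<mu> n E"
      using wnorm_lincomb[OF P E, of 1 c] by (subst F_eq) simp
    also have "\<dots> \<le> D * ?g + (?m + M * (D * ?g)) / e * wnorm \<mu> n E"
      by (intro add_mono Pn mult_right_mono c wnorm_nonneg)
    also have "\<dots> \<le> D * (?g + ?m) + ((1 + M * D) * (?g + ?m)) / e * wnorm \<mu> n E"
      using g D e \<open>?m + M * (D * ?g) \<le> (1 + M * D) * (?g + ?m)\<close>
      by (intro add_mono mult_left_mono mult_right_mono divide_right_mono wnorm_nonneg) auto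
    also have "\<dots> = C * (?g + ?m)" by (simp add: C_def algebra_simps)
    finally show ?thesis by (simp add: G_def)
  qed
  moreover have "0 \<le> C"
    unfolding C_def using D M e wnorm_nonneg[of \<mu> n E] by (intro add_nonneg_nonneg mult_nonneg_nonneg) auto
  ultimately show thesis by (rule that[rotated])
qed

section \<open>Closure properties of smooth functions and a flat function at 0\<close>

section \<open>Smooth functions and bumps\<close>

definition smooth :: "(real \<Rightarrow> real) \<Rightarrow> bool" where
  "smooth f \<longleftrightarrow> (\<forall>n x. (deriv ^^ n) f field_differentiable at x)"

text \<open>Smoothness by coinduction: a set of differentiable functions closed under
  \<open>deriv\<close> consists of smooth functions. This avoids formulas for iterated
  derivatives.\<close>

lemma smooth_class:
  assumes "f \<in> S" and S: "\<And>f. f \<in> S \<Longrightarrow> deriv f \<in> S \<and> (\<forall>x. f field_differentiable at x)"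
  shows "smooth f"
proof -
  have "(deriv ^^ n) f \<in> S" for n
    by (induction n) (use assms in auto)
  then show ?thesis using S by (auto simp: smooth_def)
qed

lemma smooth_differentiable: "smooth f \<Longrightarrow> f field_differentiable at x"
  unfolding smooth_def by (metis funpow_0)

lemma smooth_deriv: "smooth f \<Longrightarrow> smooth (deriv f)"
  unfolding smooth_def by (metis funpow_Suc_right comp_apply)

lemma smooth_has_derivative: "smooth f \<Longrightarrow> (f has_real_derivative deriv f x) (at x)"
  using smooth_differentiable DERIV_deriv_iff_field_differentiable by blast

lemma smooth_continuous: "smooth f \<Longrightarrow> continuous_on S f"
  by (meson continuous_at_imp_continuous_on field_differentiable_imp_continuous_at smooth_differentiable)

lemma smooth_funpow: "smooth f \<Longrightarrow> smooth ((deriv ^^ n) f)"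
  by (induction n) (auto intro: smooth_deriv)

text \<open>Generated so that the derivative of each member is again a member, by the sum, product
  and chain rules; the Leibniz rule of order n never appears.\<close>

inductive_set smooth_closure :: "(real \<Rightarrow> real) set" where
  base: "smooth f \<Longrightarrow> f \<in> smooth_closure"
| const: "(\<lambda>_. c) \<in> smooth_closure"
| add: "f \<in> smooth_closure \<Longrightarrow> g \<in> smooth_closure \<Longrightarrow> (\<lambda>x. f x + g x) \<in> smooth_closure"
| mult: "f \<in> smooth_closure \<Longrightarrow> g \<in> smooth_closure \<Longrightarrow> (\<lambda>x. f x * g x) \<in> smooth_closure"
| affine: "f \<in> smooth_closure \<Longrightarrow> (\<lambda>x. f (c * x + d)) \<in> smooth_closure"

lemma smooth_closure_deriv:
  "f \<in> smooth_closure \<Longrightarrow> \<exists>f'\<in>smooth_closure. \<forall>x. (f has_real_derivative f' x) (at x)"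
proof (induction rule: smooth_closure.induct)
  case (base f)
  then show ?case
    using smooth_has_derivative smooth_closure.base smooth_deriv by blast
next
  case (const c)
  show ?case by (rule bexI[OF _ smooth_closure.const[of 0]]) auto
next
  case (add f g)
  then obtain f' g' where fg: "f' \<in> smooth_closure" "g' \<in> smooth_closure"
    "\<And>x. (f has_real_derivative f' x) (at x)" "\<And>x. (g has_real_derivative g' x) (at x)" by blast
  show ?case
    by (rule bexI[OF _ smooth_closure.add[OF fg(1,2)]]) (auto intro!: derivative_eq_intros fg)
next
  case (mult f g)
  then obtain f' g' where fg: "f' \<in> smooth_closure" "g' \<in> smooth_closure"
    "\<And>x. (f has_real_derivative f' x) (at x)" "\<And>x. (g has_real_derivative g' x) (at x)" by blast
  show ?case
    by (rule bexI[OF _ smooth_closure.add[OF smooth_closure.mult[OF fg(1) mult(2)] smooth_closure.mult[OF fg(2) mult(1)]]])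
       (auto intro!: derivative_eq_intros fg)
next
  case (affine f c d)
  then obtain f' where f: "f' \<in> smooth_closure" "\<And>x. (f has_real_derivative f' x) (at x)" by blast
  have "((\<lambda>x. f (c * x + d)) has_real_derivative c * f' (c * x + d)) (at x)" for x
  proof -
    have "((\<lambda>x. c * x + d) has_real_derivative c) (at x)" by (auto intro!: derivative_eq_intros)
    from DERIV_chain2[OF f(2) this] show ?thesis by (simp add: mult.commute)
  qed
  then show ?case
    by (intro bexI[OF _ smooth_closure.mult[OF smooth_closure.const smooth_closure.affine[OF f(1)]]]) auto
qed

lemma smooth_closure_smooth:
  assumes "f \<in> smooth_closure"
  shows "smooth f"
proof (rule smooth_class[OF assms])
  fix f assume "f \<in> smooth_closure"
  then obtain f' where f': "f' \<in> smooth_closure" "\<And>x. (f has_real_derivative f' x) (at x)"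
    using smooth_closure_deriv by blast
  then have "deriv f = f'" using DERIV_imp_deriv by blast
  then show "deriv f \<in> smooth_closure \<and> (\<forall>x. f field_differentiable at x)"
    using f' field_differentiable_def by blast
qed

lemma smooth_add: "smooth f \<Longrightarrow> smooth g \<Longrightarrow> smooth (\<lambda>x. f x + g x)"
  and smooth_mult: "smooth f \<Longrightarrow> smooth g \<Longrightarrow> smooth (\<lambda>x. f x * g x)"
  by (rule smooth_closure_smooth[OF smooth_closure.add[OF smooth_closure.base smooth_closure.base]], assumption+)
     (rule smooth_closure_smooth[OF smooth_closure.mult[OF smooth_closure.base smooth_closure.base]], assumption+)

lemma smooth_affine: "smooth f \<Longrightarrow> smooth (\<lambda>x. f (c * x + d))"
  by (rule smooth_closure_smooth, rule smooth_closure.affine, rule smooth_closure.base)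

lemma smooth_cmult: "smooth f \<Longrightarrow> smooth (\<lambda>x. c * f x)"
  by (rule smooth_closure_smooth, rule smooth_closure.mult[OF smooth_closure.const], rule smooth_closure.base)

lemma smooth_diff:
  assumes "smooth f" "smooth g"
  shows "smooth (\<lambda>x. f x - g x)"
  using smooth_add[OF assms(1) smooth_cmult[OF assms(2), of "-1"]] by simp

lemma smooth_shift: "smooth f \<Longrightarrow> smooth (\<lambda>x. f (x - d))"
  using smooth_affine[of f 1 "- d"] by simp

text \<open>An antiderivative is not produced by the operations of \<open>smooth_closure\<close>, so
  the set closed under \<open>deriv\<close> is f itself together with all iterated derivatives of
  \<open>f'\<close>.\<close>

lemma smooth_from_deriv:
  assumes "\<And>x. (f has_real_derivative f' x) (at x)" "smooth f'"
  shows "smooth f"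
proof (rule smooth_class[of f "insert f (range (\<lambda>n. (deriv ^^ n) f'))"])
  have "deriv f = f'" using assms(1) DERIV_imp_deriv by blast
  then have "deriv f = (deriv ^^ 0) f'" by simp
  moreover have "deriv ((deriv ^^ n) f') = (deriv ^^ Suc n) f'" for n by simp
  moreover have "f field_differentiable at x" for x
    using assms(1) field_differentiable_def by blast
  ultimately show "deriv g \<in> insert f (range (\<lambda>n. (deriv ^^ n) f')) \<and> (\<forall>x. g field_differentiable at x)"
    if "g \<in> insert f (range (\<lambda>n. (deriv ^^ n) f'))" for g
    using that assms(2) unfolding smooth_def by blast
qed simp

lemma funpow_deriv_diff:
  assumes "smooth f" "smooth g"
  shows "(deriv ^^ n) (\<lambda>x. f x - g x) = (\<lambda>x. (deriv ^^ n) f x - (deriv ^^ n) g x)"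
proof (induction n)
  case (Suc n)
  have "deriv (\<lambda>x. (deriv ^^ n) f x - (deriv ^^ n) g x) = (\<lambda>x. deriv ((deriv ^^ n) f) x - deriv ((deriv ^^ n) g) x)"
    by (rule ext, rule DERIV_imp_deriv)
       (intro DERIV_diff smooth_has_derivative smooth_funpow assms)
  then show ?case by (simp add: Suc)
qed simp

lemma funpow_deriv_shift:
  assumes "smooth f"
  shows "(deriv ^^ n) (\<lambda>x. f (x - d)) = (\<lambda>x. (deriv ^^ n) f (x - d))"
proof (induction n)
  case (Suc n)
  have "((\<lambda>x. (deriv ^^ n) f (x - d)) has_real_derivative deriv ((deriv ^^ n) f) (x - d)) (at x)" for x
  proof -
    have "((\<lambda>x. x - d) has_real_derivative 1) (at x)" by (auto intro!: derivative_eq_intros)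
    from DERIV_chain2[OF smooth_has_derivative[OF smooth_funpow[OF assms]] this] show ?thesis by simp
  qed
  then have "deriv (\<lambda>x. (deriv ^^ n) f (x - d)) = (\<lambda>x. deriv ((deriv ^^ n) f) (x - d))"
    using DERIV_imp_deriv by blast
  then show ?case by (simp add: Suc)
qed simp

text \<open>The classical flat function is the case p = 1; polynomials in 1/x in front make the
  family closed under differentiation.\<close>

definition exp_inv :: "real poly \<Rightarrow> real \<Rightarrow> real" where
  "exp_inv p x = (if 0 < x then poly p (1 / x) * exp (- (1 / x)) else 0)"

lemma poly_exp_tendsto_0: "((\<lambda>t. poly p t * exp (- t)) \<longlongrightarrow> (0::real)) at_top"
proof -
  have "((\<lambda>t. \<Sum>i\<le>degree p. coeff p i * (t ^ i / exp t)) \<longlongrightarrow> (\<Sum>i\<le>degree p. coeff p i * 0)) at_top"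
    by (intro tendsto_intros tendsto_power_div_exp_0)
  moreover have "(\<lambda>t. poly p t * exp (- t)) = (\<lambda>t. \<Sum>i\<le>degree p. coeff p i * (t ^ i / exp t))"
    by (simp add: poly_altdef sum_distrib_right exp_minus divide_inverse mult.assoc)
  ultimately show ?thesis by simp
qed

text \<open>With t = 1/x the chain rule gives t^2 (p(t) - p'(t)) exp (-t), and
  \<open>[:0, 0, 1:]\<close> is t^2. At 0 from the right the difference quotient is t p(t) exp (-t),
  which tends to 0 as t grows.\<close>

lemma exp_inv_deriv:
  "(exp_inv p has_real_derivative exp_inv ([:0, 0, 1:] * (p - pderiv p)) x) (at x)"
proof -
  consider "0 < x" | "x < 0" | "x = 0" by linarith
  then show ?thesis
  proof cases
    case 1
    have "((\<lambda>x. poly p (1 / x) * exp (- (1 / x))) has_real_derivative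
        exp_inv ([:0, 0, 1:] * (p - pderiv p)) x) (at x)"
      using 1 by (auto intro!: derivative_eq_intros poly_DERIV[THEN DERIV_chain2]
          simp: exp_inv_def field_simps power2_eq_square)
    then show ?thesis
      by (rule has_field_derivative_transform_within_open[where S = "{0<..}"])
         (use 1 in \<open>auto simp: exp_inv_def\<close>)
  next
    case 2
    have "((\<lambda>x. 0) has_real_derivative exp_inv ([:0, 0, 1:] * (p - pderiv p)) x) (at x)"
      using 2 by (simp add: exp_inv_def)
    then show ?thesis
      by (rule has_field_derivative_transform_within_open[where S = "{..<0}"])
         (use 2 in \<open>auto simp: exp_inv_def\<close>)
  next
    case 3
    have "((\<lambda>h. poly (pCons 0 p) (inverse h) * exp (- inverse h)) \<longlongrightarrow> 0) (at_right 0)"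
      by (rule filterlim_compose[OF poly_exp_tendsto_0 filterlim_inverse_at_top_right])
    then have right: "((\<lambda>h. exp_inv p h / h) \<longlongrightarrow> 0) (at_right 0)"
      by (rule Lim_transform_eventually)
         (auto simp: eventually_at_filter exp_inv_def divide_inverse intro!: always_eventually)
    have left: "((\<lambda>h. exp_inv p h / h) \<longlongrightarrow> 0) (at_left 0)"
      by (rule Lim_transform_eventually[OF tendsto_const])
         (auto simp: eventually_at_filter exp_inv_def intro!: always_eventually)
    have "((\<lambda>h. exp_inv p h / h) \<longlongrightarrow> 0) (at 0)"
      using left right by (simp add: filterlim_split_at)
    then show ?thesis
      unfolding 3 by (simp add: DERIV_def exp_inv_def[of _ 0])
  qed
qed

lemma smooth_exp_inv: "smooth (exp_inv p)"
proof (rule smooth_class[of _ "range exp_inv"])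
  fix f assume "f \<in> range exp_inv"
  then obtain p where "f = exp_inv p" by blast
  then show "deriv f \<in> range exp_inv \<and> (\<forall>x. f field_differentiable at x)"
    using exp_inv_deriv[of p] DERIV_imp_deriv[OF exp_inv_deriv, of p] field_differentiable_def
    by (metis (no_types, lifting) ext rangeI)
qed simp

section \<open>Test functions and the fundamental lemma of the calculus of variations\<close>

section \<open>Test functions\<close>

lemma test_function_iff:
  "test_function \<phi> \<longleftrightarrow> smooth \<phi> \<and> (\<exists>a b. 0 < a \<and> a \<le> b \<and> (\<forall>x. x \<notin> {a..b} \<longrightarrow> \<phi> x = 0))"
  by (simp add: test_function_def smooth_def)

lemma test_function_smooth: "test_function \<phi> \<Longrightarrow> smooth \<phi>"
  by (simp add: test_function_iff)

lemma test_function_deriv: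
  assumes "test_function \<phi>"
  shows "test_function (deriv \<phi>)"
proof -
  obtain a b where ab: "0 < a" "a \<le> b" "\<forall>x. x \<notin> {a..b} \<longrightarrow> \<phi> x = 0"
    using assms by (auto simp: test_function_iff)
  have "deriv \<phi> x = 0" if x: "x \<notin> {a..b}" for x
  proof -
    have "((\<lambda>_. 0) has_real_derivative 0) (at x)" by simp
    then have "(\<phi> has_real_derivative 0) (at x)"
      by (rule has_field_derivative_transform_within_open[where S = "- {a..b}"]) (use x ab in auto)
    then show ?thesis by (rule DERIV_imp_deriv)
  qed
  then show ?thesis
    using assms ab smooth_deriv unfolding test_function_iff by blast
qed

lemma test_function_funpow: "test_function \<phi> \<Longrightarrow> test_function ((deriv ^^ n) \<phi>)"
  by (induction n) (auto intro: test_function_deriv)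

lemma test_function_shift:
  assumes "test_function \<phi>" "0 \<le> R"
  shows "test_function (\<lambda>x. \<phi> (x - R))"
proof -
  obtain a b where ab: "0 < a" "a \<le> b" "\<forall>x. x \<notin> {a..b} \<longrightarrow> \<phi> x = 0"
    using assms by (auto simp: test_function_iff)
  then have "0 < a + R" "a + R \<le> b + R" "\<forall>x. x \<notin> {a + R..b + R} \<longrightarrow> \<phi> (x - R) = 0"
    using assms(2) by auto
  then show ?thesis
    using smooth_shift assms unfolding test_function_iff by blast
qed

lemma test_function_bounded:
  assumes "test_function \<phi>"
  obtains B where "0 \<le> B" "\<And>x. \<bar>\<phi> x\<bar> \<le> B"
proof -
  obtain a b where ab: "0 < a" "a \<le> b" "\<forall>x. x \<notin> {a..b} \<longrightarrow> \<phi> x = 0"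
    using assms by (auto simp: test_function_iff)
  have "bounded (\<phi> ` {a..b})"
    by (intro compact_imp_bounded compact_continuous_image smooth_continuous test_function_smooth assms) simp
  then obtain B where B: "\<forall>x\<in>{a..b}. \<bar>\<phi> x\<bar> \<le> B" by (auto simp: bounded_iff)
  then have "\<bar>\<phi> x\<bar> \<le> max 0 B" for x
    using ab(3) by (cases "x \<in> {a..b}") (auto simp: le_max_iff_disj)
  then show ?thesis by (intro that[of "max 0 B"]) auto
qed

lemma test_function_measurable: "test_function \<phi> \<Longrightarrow> \<phi> \<in> borel_measurable borel"
  by (intro borel_measurable_continuous_onI smooth_continuous test_function_smooth)

text \<open>The factor n + 1 pushes both flat factors to 1 on the open interval, so for growing n
  these functions, bounded by 1, tend to its indicator.\<close>

definition bump :: "real \<Rightarrow> real \<Rightarrow> nat \<Rightarrow> real \<Rightarrow> real" where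
  "bump a b n x = exp_inv 1 (real (Suc n) * (x - a)) * exp_inv 1 (real (Suc n) * (b - x))"

lemma test_function_bump:
  assumes "0 < a" "a \<le> b"
  shows "test_function (bump a b n)"
proof -
  have "smooth (\<lambda>x. exp_inv 1 (real (Suc n) * x + (- real (Suc n) * a)) * exp_inv 1 ((- real (Suc n)) * x + real (Suc n) * b))"
    by (intro smooth_mult smooth_affine smooth_exp_inv)
  then have "smooth (bump a b n)"
    unfolding bump_def by (simp add: algebra_simps)
  moreover have "bump a b n x = 0" if "x \<notin> {a..b}" for x
    using that by (auto simp: bump_def exp_inv_def zero_less_mult_iff simp del: of_nat_Suc)
  ultimately show ?thesis using assms unfolding test_function_iff by blast
qed

lemma bump_bound: "\<bar>bump a b n x\<bar> \<le> 1"
proof -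
  have "0 \<le> exp_inv 1 x \<and> exp_inv 1 x \<le> 1" for x by (simp add: exp_inv_def)
  then show ?thesis unfolding bump_def by (simp add: mult_le_one abs_mult)
qed

lemma bump_tendsto: "(\<lambda>n. bump a b n x) \<longlonglongrightarrow> indicator {a<..<b} x"
proof -
  have 1: "(\<lambda>n. exp_inv 1 (real (Suc n) * c)) \<longlonglongrightarrow> 1" if "0 < c" for c :: real
  proof -
    have "(\<lambda>n. exp (- (1 / (real (Suc n) * c)))) \<longlonglongrightarrow> 1"
      using that by real_asymp
    then show ?thesis using that by (simp add: exp_inv_def)
  qed
  show ?thesis
  proof (cases "x \<in> {a<..<b}")
    case True
    have "(\<lambda>n. bump a b n x) \<longlonglongrightarrow> 1 * 1"
      unfolding bump_def by (intro tendsto_mult 1) (use True in auto)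
    with True show ?thesis by simp
  next
    case False
    then have "bump a b n x = 0" for n
      by (auto simp: bump_def exp_inv_def zero_less_mult_iff simp del: of_nat_Suc)
    with False show ?thesis by simp
  qed
qed

text \<open>As \<open>ennreal\<close> truncates at 0, the two densities are the positive and the
  negative part of f. The measures agree on all rays, which generate the Borel sets, so the parts
  agree almost everywhere; one of them vanishes at each point, hence so does f.\<close>

lemma AE_zero_of_tail_integrals:
  fixes f :: "real \<Rightarrow> real"
  assumes f: "integrable lborel f" and 0: "\<And>x. (\<integral>y. indicator {x<..} y * f y \<partial>lborel) = 0"
  shows "AE y in lborel. f y = 0"
proof -
  have [measurable]: "f \<in> borel_measurable borel" using f by auto
  have fin: "(\<integral>\<^sup>+y. ennreal (c * f y) * indicator {x<..} y \<partial>lborel) < \<infinity>" if "\<bar>c\<bar> = 1" for c x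
  proof -
    have "(\<integral>\<^sup>+y. ennreal (c * f y) * indicator {x<..} y \<partial>lborel) \<le> (\<integral>\<^sup>+y. ennreal (norm (f y)) \<partial>lborel)"
      using that by (intro nn_integral_mono) (auto simp: indicator_def abs_if split: if_splits)
    also have "\<dots> < \<infinity>" using f by (simp add: integrable_iff_bounded)
    finally show ?thesis .
  qed
  have eq: "density lborel (\<lambda>y. ennreal (f y)) = density lborel (\<lambda>y. ennreal (- f y))"
  proof (rule measure_eqI_lessThan)
    fix x
    show "emeasure (density lborel (\<lambda>y. ennreal (f y))) {x<..} < \<infinity>"
      using fin[of 1 x] by (simp add: emeasure_density)
    have i: "integrable lborel (\<lambda>y. indicator {x<..} y * f y)"
      using integrable_mult_indicator[OF _ f, of "{x<..}"] by simp
    have "(\<integral>\<^sup>+y. ennreal (indicator {x<..} y * f y) \<partial>lborel) = (\<integral>\<^sup>+y. ennreal (f y) * indicator {x<..} y \<partial>lborel)"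
      "(\<integral>\<^sup>+y. ennreal (- (indicator {x<..} y * f y)) \<partial>lborel) = (\<integral>\<^sup>+y. ennreal (- f y) * indicator {x<..} y \<partial>lborel)"
      by (auto intro!: nn_integral_cong simp: indicator_def)
    then have "enn2real (\<integral>\<^sup>+y. ennreal (f y) * indicator {x<..} y \<partial>lborel)
        = enn2real (\<integral>\<^sup>+y. ennreal (- f y) * indicator {x<..} y \<partial>lborel)"
      using 0[of x] real_lebesgue_integral_def[OF i] by simp
    moreover have "(\<integral>\<^sup>+y. ennreal (f y) * indicator {x<..} y \<partial>lborel) < top"
      "(\<integral>\<^sup>+y. ennreal (- f y) * indicator {x<..} y \<partial>lborel) < top"
      using fin[of 1 x] fin[of "-1" x] by auto
    ultimately have "(\<integral>\<^sup>+y. ennreal (f y) * indicator {x<..} y \<partial>lborel) = (\<integral>\<^sup>+y. ennreal (- f y) * indicator {x<..} y \<partial>lborel)"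
      by (metis ennreal_enn2real)
    then show "emeasure (density lborel (\<lambda>y. ennreal (f y))) {x<..} = emeasure (density lborel (\<lambda>y. ennreal (- f y))) {x<..}"
      by (simp add: emeasure_density)
  qed auto
  have "(\<integral>\<^sup>+y. ennreal (f y) \<partial>lborel) \<le> (\<integral>\<^sup>+y. ennreal (norm (f y)) \<partial>lborel)"
    by (intro nn_integral_mono) (auto intro: ennreal_leI)
  also have "\<dots> < \<infinity>" using f by (simp add: integrable_iff_bounded)
  finally have "(\<integral>\<^sup>+y. ennreal (f y) \<partial>lborel) \<noteq> \<infinity>" by simp
  then have "AE y in lborel. ennreal (f y) = ennreal (- f y)"
    using eq by (subst (asm) finite_density_unique) auto
  then show ?thesis
  proof eventually_elim
    case (elim y)
    show ?case
    proof (cases "0 \<le> f y")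
      case True
      then have "ennreal (- f y) = 0" by (intro ennreal_neg) simp
      with elim True show ?thesis by simp
    next
      case False
      then have "ennreal (f y) = 0" by (intro ennreal_neg) simp
      with elim False show ?thesis by simp
    qed
  qed
qed

lemma loc_integrable_diff:
  assumes "loc_integrable f" "loc_integrable g"
  shows "loc_integrable (\<lambda>y. f y - g y)"
  using assms unfolding loc_integrable_def by (auto intro: set_integral_diff)

lemma loc_integrable_test_function:
  assumes f: "loc_integrable f" and \<phi>: "test_function \<phi>"
  shows "integrable halfline (\<lambda>y. f y * \<phi> y)"
proof -
  obtain a b where ab: "0 < a" "a \<le> b" "\<forall>x. x \<notin> {a..b} \<longrightarrow> \<phi> x = 0"
    using \<phi> by (auto simp: test_function_iff)
  obtain B where B: "0 \<le> B" "\<And>x. \<bar>\<phi> x\<bar> \<le> B" using test_function_bounded[OF \<phi>] by blast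
  have [measurable]: "\<phi> \<in> borel_measurable borel" by (rule test_function_measurable[OF \<phi>])
  have f': "integrable lborel (\<lambda>y. indicator {a..b} y * f y)"
    using f ab by (auto simp: loc_integrable_def set_integrable_def)
  have "integrable lborel (\<lambda>y. (indicator {a..b} y * f y) * \<phi> y)"
  proof (rule Bochner_Integration.integrable_bound)
    show "integrable lborel (\<lambda>y. B * (indicator {a..b} y * f y))" using f' by simp
    have [measurable]: "(\<lambda>y. indicator {a..b} y * f y) \<in> borel_measurable lborel" using f' by auto
    show "(\<lambda>y. indicator {a..b} y * f y * \<phi> y) \<in> borel_measurable lborel" by measurable
    show "AE y in lborel. norm (indicator {a..b} y * f y * \<phi> y) \<le> norm (B * (indicator {a..b} y * f y))"
    proof (rule AE_I2)
      fix y
      have "\<bar>indicator {a..b} y * f y\<bar> * \<bar>\<phi> y\<bar> \<le> \<bar>indicator {a..b} y * f y\<bar> * B"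
        by (intro mult_left_mono B) auto
      then show "norm (indicator {a..b} y * f y * \<phi> y) \<le> norm (B * (indicator {a..b} y * f y))"
        using B(1) by (simp add: abs_mult mult.commute)
    qed
  qed
  moreover have "(\<lambda>y. (indicator {a..b} y * f y) * \<phi> y) = (\<lambda>y. indicator {0<..} y *\<^sub>R (f y * \<phi> y))"
    using ab by (auto simp: indicator_def fun_eq_iff)
  ultimately show ?thesis
    unfolding integrable_halfline set_integrable_def by simp
qed

text \<open>Bumps converge boundedly to the indicator of an interval, so p has integral 0 over every
  (a, b) with a > 0. The previous lemma is applied to p cut off to (1/(n+1), n+1), where it is
  integrable, and countably many of these intervals exhaust the half-line.\<close>

lemma fundamental_lemma_calculus_of_variations:
  assumes p: "loc_integrable p" and 0: "\<And>\<phi>. test_function \<phi> \<Longrightarrow> (\<integral>y. p y * \<phi> y \<partial>halfline) = 0"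
  shows "AE y in halfline. p y = 0"
proof -
  have interval: "(\<integral>y. indicator {a<..<b} y * p y \<partial>lborel) = 0" if "0 < a" "a \<le> b" for a b
  proof -
    have i: "integrable lborel (\<lambda>y. indicator {a..b} y * p y)"
      using p that by (auto simp: loc_integrable_def set_integrable_def)
    then have [measurable]: "(\<lambda>y. indicator {a..b} y * p y) \<in> borel_measurable borel" by auto
    have [measurable]: "bump a b n \<in> borel_measurable borel" for n
      by (rule test_function_measurable[OF test_function_bump[OF that]])
    have "(\<lambda>n. \<integral>y. (indicator {a..b} y * p y) * bump a b n y \<partial>lborel)
        \<longlonglongrightarrow> (\<integral>y. (indicator {a..b} y * p y) * indicator {a<..<b} y \<partial>lborel)"
    proof (rule integral_dominated_convergence[where w = "\<lambda>y. \<bar>indicator {a..b} y * p y\<bar>"])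
      show "AE y in lborel. (\<lambda>n. indicator {a..b} y * p y * bump a b n y) \<longlonglongrightarrow> indicator {a..b} y * p y * indicator {a<..<b} y"
        by (intro AE_I2 tendsto_intros bump_tendsto)
      show "AE y in lborel. norm (indicator {a..b} y * p y * bump a b n y) \<le> \<bar>indicator {a..b} y * p y\<bar>" for n
      proof (rule AE_I2)
        fix y
        have "\<bar>indicator {a..b} y * p y\<bar> * \<bar>bump a b n y\<bar> \<le> \<bar>indicator {a..b} y * p y\<bar> * 1"
          by (intro mult_left_mono bump_bound) auto
        then show "norm (indicator {a..b} y * p y * bump a b n y) \<le> \<bar>indicator {a..b} y * p y\<bar>"
          by (simp add: abs_mult)
      qed
      show "integrable lborel (\<lambda>y. \<bar>indicator {a..b} y * p y\<bar>)" using i by simp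
    qed measurable
    moreover have "(\<integral>y. (indicator {a..b} y * p y) * bump a b n y \<partial>lborel) = 0" for n
    proof -
      have "bump a b n y = 0" if "y \<notin> {a..b}" for y
        using that by (auto simp: bump_def exp_inv_def zero_less_mult_iff simp del: of_nat_Suc)
      then have "(\<integral>y. (indicator {a..b} y * p y) * bump a b n y \<partial>lborel) = (\<integral>y. p y * bump a b n y \<partial>halfline)"
        unfolding integral_halfline set_lebesgue_integral_def using that(1)
        by (intro Bochner_Integration.integral_cong) (auto simp: indicator_def)
      then show ?thesis using 0[OF test_function_bump[OF that]] by simp
    qed
    ultimately have "(\<lambda>n::nat. 0) \<longlonglongrightarrow> (\<integral>y. (indicator {a..b} y * p y) * indicator {a<..<b} y \<partial>lborel)"
      by simp
    from LIMSEQ_unique[OF this tendsto_const]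
    have "(\<integral>y. (indicator {a..b} y * p y) * indicator {a<..<b} y \<partial>lborel) = 0" .
    also have "(\<integral>y. (indicator {a..b} y * p y) * indicator {a<..<b} y \<partial>lborel) = (\<integral>y. indicator {a<..<b} y * p y \<partial>lborel)"
      by (intro Bochner_Integration.integral_cong) (auto simp: indicator_def)
    finally show ?thesis .
  qed
  have ae: "AE y in lborel. indicator {1 / real (Suc n)<..<real (Suc n)} y * p y = 0" for n
  proof (rule AE_zero_of_tail_integrals)
    define a b where "a = 1 / real (Suc n)" and "b = real (Suc n)"
    have ab: "0 < a" "a \<le> b" by (auto simp: a_def b_def field_simps)
    have i: "integrable lborel (\<lambda>y. indicator {a..b} y * p y)"
      using p ab by (auto simp: loc_integrable_def set_integrable_def)
    have "integrable lborel (\<lambda>y. indicator {a<..<b} y *\<^sub>R (indicator {a..b} y * p y))"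
      by (intro integrable_mult_indicator i) simp
    also have "(\<lambda>y. indicator {a<..<b} y *\<^sub>R (indicator {a..b} y * p y)) = (\<lambda>y. indicator {a<..<b} y * p y)"
      by (auto simp: indicator_def fun_eq_iff)
    finally show "integrable lborel (\<lambda>y. indicator {1 / real (Suc n)<..<real (Suc n)} y * p y)"
      by (simp add: a_def b_def)
    show "(\<integral>y. indicator {x<..} y * (indicator {1 / real (Suc n)<..<real (Suc n)} y * p y) \<partial>lborel) = 0" for x
    proof -
      \<comment> \<open>The outer \<open>max b (max x a)\<close> keeps the endpoints ordered when x
        lies beyond b; the interval is then empty.\<close>
      have "(\<lambda>y. indicator {x<..} y * (indicator {a<..<b} y * p y)) = (\<lambda>y. indicator {max x a<..<max b (max x a)} y * p y)"
        by (auto simp: indicator_def fun_eq_iff)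
      then have "(\<integral>y. indicator {x<..} y * (indicator {a<..<b} y * p y) \<partial>lborel)
          = (\<integral>y. indicator {max x a<..<max b (max x a)} y * p y \<partial>lborel)" by simp
      also have "\<dots> = 0" using ab by (intro interval) auto
      finally show ?thesis by (simp add: a_def b_def)
    qed
  qed
  have "AE y in lborel. \<forall>n. indicator {1 / real (Suc n)<..<real (Suc n)} y * p y = 0"
    unfolding AE_all_countable by (rule allI, rule ae)
  then show ?thesis unfolding AE_halfline
  proof eventually_elim
    case (elim y)
    show ?case
    proof
      assume "0 < y"
      obtain n where n: "max y (1 / y) < real n" using reals_Archimedean2 by blast
      then have "y < real (Suc n)" "1 / y < real (Suc n)" by auto
      then have "1 / real (Suc n) < y" using \<open>0 < y\<close> by (simp add: field_simps)
      with \<open>y < real (Suc n)\<close> show "p y = 0" using elim[rule_format, of n] by simp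
    qed
  qed
qed

section \<open>Weak derivatives and their inversion by primitives vanishing at infinity\<close>

section \<open>Weak derivatives\<close>

lemma has_weak_deriv_halfline:
  "has_weak_deriv n f g \<longleftrightarrow> loc_integrable f \<and> loc_integrable g \<and>
     (\<forall>\<phi>. test_function \<phi> \<longrightarrow>
        (\<integral>y. f y * (deriv ^^ n) \<phi> y \<partial>halfline) = (-1) ^ n * (\<integral>y. g y * \<phi> y \<partial>halfline))"
  by (simp add: has_weak_deriv_def integral_halfline)

lemma has_weak_deriv_unique:
  assumes "has_weak_deriv n f g" "has_weak_deriv n f g'"
  shows "AE y in halfline. g y = g' y"
proof -
  have loc: "loc_integrable g" "loc_integrable g'"
    using assms by (auto simp: has_weak_deriv_halfline)
  have "AE y in halfline. g y - g' y = 0"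
  proof (rule fundamental_lemma_calculus_of_variations)
    show "loc_integrable (\<lambda>y. g y - g' y)" using loc by (rule loc_integrable_diff)
    fix \<phi> assume \<phi>: "test_function \<phi>"
    then have "(-1) ^ n * (\<integral>y. g y * \<phi> y \<partial>halfline) = (-1) ^ n * (\<integral>y. g' y * \<phi> y \<partial>halfline)"
      using assms by (auto simp: has_weak_deriv_halfline)
    then have "(\<integral>y. g y * \<phi> y \<partial>halfline) = (\<integral>y. g' y * \<phi> y \<partial>halfline)" by simp
    then show "(\<integral>y. (g y - g' y) * \<phi> y \<partial>halfline) = 0"
      using loc[THEN loc_integrable_test_function[OF _ \<phi>]] by (simp add: left_diff_distrib)
  qed
  then show ?thesis by eventually_elim simp
qed

lemma has_weak_deriv_weak_deriv: "has_weak_deriv n f g \<Longrightarrow> has_weak_deriv n f (weak_deriv n f)"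
  using someI[of "has_weak_deriv n f" g] by (simp add: weak_deriv_def)

lemma has_weak_deriv_lincomb:
  assumes "has_weak_deriv n f g" "has_weak_deriv n f' g'"
  shows "has_weak_deriv n (\<lambda>y. a * f y + b * f' y) (\<lambda>y. a * g y + b * g' y)"
proof -
  have loc: "loc_integrable f" "loc_integrable g" "loc_integrable f'" "loc_integrable g'"
    using assms by (auto simp: has_weak_deriv_halfline)
  have lin: "loc_integrable (\<lambda>y. a * u y + b * v y)" if "loc_integrable u" "loc_integrable v" for u v
    using that unfolding loc_integrable_def by (auto intro!: set_integral_add set_integrable_mult_right)
  have "(\<integral>y. (a * u y + b * v y) * \<phi> y \<partial>halfline)
      = a * (\<integral>y. u y * \<phi> y \<partial>halfline) + b * (\<integral>y. v y * \<phi> y \<partial>halfline)"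
    if "loc_integrable u" "loc_integrable v" "test_function \<phi>" for u v \<phi>
  proof -
    have "(\<integral>y. (a * u y + b * v y) * \<phi> y \<partial>halfline) = (\<integral>y. a * (u y * \<phi> y) + b * (v y * \<phi> y) \<partial>halfline)"
      by (simp add: algebra_simps)
    then show ?thesis
      using loc_integrable_test_function[OF that(1,3)] loc_integrable_test_function[OF that(2,3)] by simp
  qed
  note int = this
  show ?thesis
    unfolding has_weak_deriv_halfline
  proof (intro conjI allI impI lin loc)
    fix \<phi> assume \<phi>: "test_function \<phi>"
    show "(\<integral>y. (a * f y + b * f' y) * (deriv ^^ n) \<phi> y \<partial>halfline)
        = (-1) ^ n * (\<integral>y. (a * g y + b * g' y) * \<phi> y \<partial>halfline)"
      unfolding int[OF loc(1,3) test_function_funpow[OF \<phi>]] int[OF loc(2,4) \<phi>]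
      using assms \<phi> by (simp add: has_weak_deriv_halfline distrib_left mult.left_commute)
  qed
qed

text \<open>\<open>loc_integrable\<close> speaks of compact intervals only; measurability on the
  whole half-line comes from the pointwise limit of the cut-offs to [1/(n+1), n+1].\<close>

lemma loc_integrable_measurable:
  assumes "loc_integrable f"
  shows "f \<in> borel_measurable halfline"
proof -
  have "(\<lambda>y. indicator {0<..} y * f y) \<in> borel_measurable lborel"
  proof (rule borel_measurable_LIMSEQ_real)
    show "(\<lambda>y. indicator {1 / real (Suc n)..real (Suc n)} y * f y) \<in> borel_measurable lborel" for n
    proof -
      have "1 / real (Suc n) \<le> real (Suc n)" "0 < 1 / real (Suc n)" by (simp_all add: field_simps)
      then have "set_integrable lborel {1 / real (Suc n)..real (Suc n)} f"
        using assms unfolding loc_integrable_def by blast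
      from borel_measurable_integrable[OF this[unfolded set_integrable_def]] show ?thesis
        by (simp only: real_scaleR_def)
    qed
    show "(\<lambda>n. indicator {1 / real (Suc n)..real (Suc n)} y * f y) \<longlonglongrightarrow> indicator {0<..} y * f y" for y
    proof (cases "0 < y")
      case True
      obtain N where N: "max y (1 / y) < real N" using reals_Archimedean2 by blast
      have "eventually (\<lambda>n. indicator {1 / real (Suc n)..real (Suc n)} y * f y = indicator {0<..} y * f y) sequentially"
        using eventually_ge_at_top[of N]
      proof eventually_elim
        case (elim n)
        then have "y \<le> real (Suc n)" "1 / y \<le> real (Suc n)" using N by auto
        then have "1 / real (Suc n) \<le> y" using True by (simp add: field_simps)
        then show ?case using True \<open>y \<le> real (Suc n)\<close> by simp
      qed
      then show ?thesis by (rule tendsto_eventually)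
    next
      case False
      then have "y < 1 / real (Suc n)" for n
        by (smt (verit) divide_pos_pos of_nat_0_less_iff zero_less_Suc)
      then have "y \<notin> {1 / real (Suc n)..real (Suc n)}" for n
        using not_le by auto
      with False show ?thesis by simp
    qed
  qed
  then show ?thesis
    unfolding measurable_halfline set_borel_measurable_def by simp
qed

lemma has_weak_deriv_measurable:
  "has_weak_deriv n f g \<Longrightarrow> f \<in> borel_measurable halfline"
  "has_weak_deriv n f g \<Longrightarrow> g \<in> borel_measurable halfline"
  by (auto simp: has_weak_deriv_def loc_integrable_measurable)

lemma moments_from_loc_integrable:
  assumes f: "f \<in> moments_from n"
  shows "loc_integrable f"
  unfolding loc_integrable_def
proof (intro allI impI)
  fix a b :: real assume "0 < a" "a \<le> b"
  then have "integrable halfline (\<lambda>x. indicator {a / 2<..} x * f x)"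
    by (intro moments_from_tail_integrable'[OF f]) simp
  then have "integrable lborel (\<lambda>x. indicator {0<..} x *\<^sub>R (indicator {a / 2<..} x * f x))"
    unfolding integrable_halfline set_integrable_def .
  then have "integrable lborel (\<lambda>x. indicator {a..b} x *\<^sub>R (indicator {0<..} x *\<^sub>R (indicator {a / 2<..} x * f x)))"
    by (rule integrable_mult_indicator[rotated]) simp
  also have "(\<lambda>x. indicator {a..b} x *\<^sub>R (indicator {0<..} x *\<^sub>R (indicator {a / 2<..} x * f x)))
      = (\<lambda>x. indicator {a..b} x *\<^sub>R f x)"
    using \<open>0 < a\<close> by (auto simp: indicator_def fun_eq_iff)
  finally show "set_integrable lborel {a..b} f" unfolding set_integrable_def .
qed

lemma test_function_FTC:
  assumes \<phi>: "test_function \<phi>" and x: "0 < x"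
  shows "(\<integral>y. indicator {0<..<x} y * deriv \<phi> y \<partial>halfline) = \<phi> x"
proof -
  obtain a b where ab: "0 < a" "a \<le> b" "\<forall>x. x \<notin> {a..b} \<longrightarrow> \<phi> x = 0"
    using \<phi> by (auto simp: test_function_iff)
  have [measurable]: "deriv \<phi> \<in> borel_measurable borel"
    by (rule test_function_measurable[OF test_function_deriv[OF \<phi>]])
  have sm: "smooth \<phi>" by (rule test_function_smooth[OF \<phi>])
  have "(\<integral>y. indicator {0<..<x} y * deriv \<phi> y \<partial>halfline) = (\<integral>y. indicator {0<..} y *\<^sub>R (indicator {0<..<x} y * deriv \<phi> y) \<partial>lborel)"
    unfolding integral_halfline set_lebesgue_integral_def ..
  also have "\<dots> = (\<integral>y. deriv \<phi> y * indicator {0..x} y \<partial>lborel)"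
  proof (rule integral_cong_AE)
    have "AE y in lborel. y \<noteq> 0 \<and> y \<noteq> x"
      using AE_lborel_singleton[of 0] AE_lborel_singleton[of x] by eventually_elim auto
    then show "AE y in lborel. indicator {0<..} y *\<^sub>R (indicator {0<..<x} y * deriv \<phi> y) = deriv \<phi> y * indicator {0..x} y"
      by eventually_elim (auto simp: indicator_def)
  qed measurable
  also have "\<dots> = \<phi> x - \<phi> 0"
  proof (rule integral_FTC_Icc_real)
    show "0 \<le> x" using x by simp
    show "(\<phi> has_real_derivative deriv \<phi> y) (at y)" for y by (rule smooth_has_derivative[OF sm])
    show "isCont (deriv \<phi>) y" for y
      using smooth_has_derivative[OF smooth_deriv[OF sm]] DERIV_isCont by blast
  qed
  finally show ?thesis using ab by simp
qed

text \<open>The weak form of (I f)' = - f: Fubini with the signed kernel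
  \<open>deriv \<phi>\<close>, whose integral over (0, x) is \<open>\<phi> x\<close>.\<close>

lemma tail_integral_test_function:
  assumes f: "f \<in> moments_from n" and \<phi>: "test_function \<phi>"
  shows "(\<integral>y. tail_integral f y * deriv \<phi> y \<partial>halfline) = (\<integral>y. f y * \<phi> y \<partial>halfline)"
proof -
  have \<phi>': "test_function (deriv \<phi>)" by (rule test_function_deriv[OF \<phi>])
  obtain a b where ab: "0 < a" "a \<le> b" "\<forall>x. x \<notin> {a..b} \<longrightarrow> deriv \<phi> x = 0"
    using \<phi>' by (auto simp: test_function_iff)
  obtain M where M: "0 \<le> M" "\<And>x. \<bar>deriv \<phi> x\<bar> \<le> M" using test_function_bounded[OF \<phi>'] by blast
  \<comment> \<open>The support of \<open>deriv \<phi>\<close> stays away from 0, so the majorant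
    may vanish for x <= a/2. This makes f B integrable although f may be singular at 0.\<close>
  define B where "B = (\<lambda>x. indicator {a / 2<..} x * (M * (b - a)))"
  have m: "deriv \<phi> \<in> borel_measurable halfline"
    by (rule measurable_halflineI[OF test_function_measurable[OF \<phi>']])
  have "(\<integral>y. tail_integral f y * deriv \<phi> y \<partial>halfline)
      = (\<integral>y. indicator {0<..} y * (deriv \<phi> y * tail_integral f y) \<partial>halfline)"
    by (intro Bochner_Integration.integral_cong) auto
  also have "\<dots> = (\<integral>x. indicator {0<..} x * (f x * (\<integral>y. indicator {0<..<x} y * deriv \<phi> y \<partial>halfline)) \<partial>halfline)"
  proof (rule tail_fubini(2)[OF order_refl moments_from_measurable[OF f] m, of B])
    fix x :: real assume x: "0 < x"
    show "0 \<le> B x" using M ab by (simp add: B_def)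
    show "(\<integral>\<^sup>+y. ennreal (indicator {0<..<x} y * \<bar>deriv \<phi> y\<bar>) \<partial>halfline) \<le> ennreal (B x)"
    proof (cases "a / 2 < x")
      case True
      have "(\<integral>\<^sup>+y. ennreal (indicator {0<..<x} y * \<bar>deriv \<phi> y\<bar>) \<partial>halfline)
          \<le> (\<integral>\<^sup>+y. ennreal M * indicator {a..b} y \<partial>lborel)"
        unfolding nn_integral_halfline
      proof (rule nn_integral_mono)
        fix y
        show "ennreal (indicator {0<..<x} y * \<bar>deriv \<phi> y\<bar>) * indicator {0<..} y \<le> ennreal M * indicator {a..b} y"
          using ab(3) M(2)[of y] by (auto simp: indicator_def intro: ennreal_leI)
      qed
      also have "\<dots> = ennreal (M * (b - a))"
        using ab M by (simp add: nn_integral_cmult_indicator ennreal_mult)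
      finally show ?thesis using True by (simp add: B_def)
    next
      case False
      then have "indicator {0<..<x} y * \<bar>deriv \<phi> y\<bar> = 0" for y
        using ab by (auto simp: indicator_def)
      then show ?thesis by (simp only: ennreal_0 nn_integral_const) simp
    qed
  next
    have "integrable halfline (\<lambda>x. indicator {a / 2<..} x * f x * (M * (b - a)))"
      using ab by (intro Bochner_Integration.integrable_mult_left moments_from_tail_integrable'[OF f]) auto
    then show "integrable halfline (\<lambda>x. indicator {0<..} x * (f x * B x))"
      by (rule Bochner_Integration.integrable_cong[OF refl, THEN iffD1, rotated]) (simp add: B_def)
  qed
  also have "\<dots> = (\<integral>x. f x * \<phi> x \<partial>halfline)"
    by (intro Bochner_Integration.integral_cong refl) (simp add: test_function_FTC[OF \<phi>])
  finally show ?thesis .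
qed

text \<open>The antiderivative that vanishes at infinity, hence the minus sign; its iterates serve
  as an inverse of D^k.\<close>

definition primitive :: "(real \<Rightarrow> real) \<Rightarrow> real \<Rightarrow> real" where
  "primitive f = (\<lambda>y. - tail_integral f y)"

lemma moments_from_primitive: "f \<in> moments_from (Suc n) \<Longrightarrow> primitive f \<in> moments_from n"
  and moments_from_primitive': "f \<in> moments_from n \<Longrightarrow> primitive f \<in> moments_from n"
  unfolding primitive_def
  by (intro moments_from_uminus moments_from_tail_integral; assumption)
     (intro moments_from_uminus moments_from_tail_integral'; assumption)

lemma moments_from_primitive_funpow': "f \<in> moments_from n \<Longrightarrow> (primitive ^^ k) f \<in> moments_from n"
  by (induction k) (auto intro: moments_from_primitive')

lemma moments_from_primitive_funpow: "f \<in> moments_from (n + k) \<Longrightarrow> (primitive ^^ k) f \<in> moments_from n"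
  by (induction k arbitrary: n) (auto intro: moments_from_primitive)

text \<open>Each tail integral takes one derivative off the test function.\<close>

lemma has_weak_deriv_primitive:
  assumes "f \<in> moments_from n"
  shows "has_weak_deriv k ((primitive ^^ k) f) f"
proof (induction k)
  case 0
  show ?case using moments_from_loc_integrable[OF assms] by (simp add: has_weak_deriv_halfline)
next
  case (Suc k)
  have g: "(primitive ^^ j) f \<in> moments_from n" for j
    by (rule moments_from_primitive_funpow'[OF assms])
  have "(\<integral>y. (primitive ^^ Suc k) f y * (deriv ^^ Suc k) \<phi> y \<partial>halfline) = (-1) ^ Suc k * (\<integral>y. f y * \<phi> y \<partial>halfline)"
    if \<phi>: "test_function \<phi>" for \<phi>
  proof -
    have "(\<integral>y. (primitive ^^ Suc k) f y * (deriv ^^ Suc k) \<phi> y \<partial>halfline)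
        = - (\<integral>y. tail_integral ((primitive ^^ k) f) y * deriv ((deriv ^^ k) \<phi>) y \<partial>halfline)"
      by (simp add: primitive_def)
    also have "\<dots> = - (\<integral>y. (primitive ^^ k) f y * (deriv ^^ k) \<phi> y \<partial>halfline)"
      by (simp add: tail_integral_test_function[OF g test_function_funpow[OF \<phi>]])
    also have "\<dots> = (-1) ^ Suc k * (\<integral>y. f y * \<phi> y \<partial>halfline)"
      using Suc \<phi> by (simp add: has_weak_deriv_halfline)
    finally show ?thesis .
  qed
  then show ?case
    using moments_from_loc_integrable[OF g] moments_from_loc_integrable[OF assms]
    unfolding has_weak_deriv_halfline by blast
qed

text \<open>The difference of psi and its translate has integral 0, so its antiderivative again has
  compact support: it is an antiderivative of psi, constant beyond the support of psi, minus its own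
  translate.\<close>

lemma test_function_average:
  assumes \<psi>: "test_function \<psi>" and R: "0 \<le> R"
  obtains A where "test_function A" "deriv A = (\<lambda>x. \<psi> x - \<psi> (x - R))"
proof -
  obtain a b where ab: "0 < a" "a \<le> b" "\<forall>x. x \<notin> {a..b} \<longrightarrow> \<psi> x = 0"
    using \<psi> by (auto simp: test_function_iff)
  have sm: "smooth \<psi>" by (rule test_function_smooth[OF \<psi>])
  define \<Psi> where "\<Psi> = (\<lambda>x. integral {0..x} \<psi>)"
  have low: "\<Psi> x = 0" if "x < a" for x
  proof -
    have "\<Psi> x = integral {0..x} (\<lambda>_. 0)"
      unfolding \<Psi>_def by (rule integral_cong) (use that ab in auto)
    then show ?thesis by simp
  qed
  have D: "(\<Psi> has_real_derivative \<psi> x) (at x)" for x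
  proof (cases "x < a")
    case True
    have "((\<lambda>_. 0) has_real_derivative \<psi> x) (at x)" using ab True by simp
    then show ?thesis
      by (rule has_field_derivative_transform_within_open[where S = "{..<a}"]) (use True low in auto)
  next
    case False
    \<comment> \<open>Since x >= a > 0 is interior to \<open>{0..x + 1}\<close>, the derivative
      within the interval is the two-sided one.\<close>
    have "(\<Psi> has_real_derivative \<psi> x) (at x within {0..x + 1})"
      unfolding \<Psi>_def by (rule integral_has_real_derivative[OF smooth_continuous[OF sm]]) (use False ab in auto)
    then show ?thesis
      using False ab by (simp add: at_within_Icc_at)
  qed
  have high: "\<Psi> x = \<Psi> b" if "b \<le> x" for x
  proof (cases "x = b")
    case False
    then have "b < x" using that by simp
    moreover have "continuous_on {b..x} \<Psi>"
      using D by (meson DERIV_isCont continuous_at_imp_continuous_on)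
    moreover have "(\<Psi> has_real_derivative 0) (at y)" if "b < y" "y < x" for y
      using D[of y] ab that by simp
    ultimately show ?thesis by (intro DERIV_isconst2[of b x \<Psi> x]) auto
  qed simp
  define A where "A = (\<lambda>x. \<Psi> x - \<Psi> (x - R))"
  have A: "(A has_real_derivative \<psi> x - \<psi> (x - R)) (at x)" for x
  proof -
    have "((\<lambda>x. x - R) has_real_derivative 1) (at x)" by (auto intro!: derivative_eq_intros)
    from DERIV_chain2[OF D this] show ?thesis
      unfolding A_def by (intro DERIV_diff D) simp
  qed
  have "smooth A"
    by (rule smooth_from_deriv[OF A]) (intro smooth_diff smooth_shift sm)
  moreover have "A x = 0" if "x \<notin> {a..b + R}" for x
  proof (cases "x < a")
    case True
    then show ?thesis using low R by (simp add: A_def)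
  next
    case False
    then have "b + R < x" using that by auto
    then show ?thesis using high[of x] high[of "x - R"] R by (simp add: A_def)
  qed
  ultimately have "test_function A"
    using ab R unfolding test_function_iff by (intro conjI exI[of _ a] exI[of _ "b + R"]) auto
  moreover have "deriv A = (\<lambda>x. \<psi> x - \<psi> (x - R))"
    using A DERIV_imp_deriv by blast
  ultimately show ?thesis by (rule that)
qed

text \<open>
  A function whose \<open>k\<close>-th weak derivative vanishes is a polynomial, hence zero when it is
  integrable at infinity. The polynomial is never needed: testing against \<open>A\<close> with
  \<open>A' = \<psi> - \<psi>(\<sqdot> - R)\<close> and letting \<open>R\<close> tend to infinity lowers \<open>k\<close> directly.
\<close>

lemma weak_deriv_zero:
  assumes p: "loc_integrable p" and int: "integrable halfline (\<lambda>y. y * p y)"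
    and 0: "\<And>\<phi>. test_function \<phi> \<Longrightarrow> (\<integral>y. p y * (deriv ^^ k) \<phi> y \<partial>halfline) = 0"
  shows "AE y in halfline. p y = 0"
proof (rule fundamental_lemma_calculus_of_variations[OF p])
  have pm [measurable]: "p \<in> borel_measurable halfline" by (rule loc_integrable_measurable[OF p])
  \<comment> \<open>The premise stays inside the induction, because lowering k by one uses it for
    other test functions than the one in the conclusion.\<close>
  have "(\<forall>\<phi>. test_function \<phi> \<longrightarrow> (\<integral>y. p y * (deriv ^^ k) \<phi> y \<partial>halfline) = 0)
      \<longrightarrow> (\<forall>\<phi>. test_function \<phi> \<longrightarrow> (\<integral>y. p y * \<phi> y \<partial>halfline) = 0)"
  proof (induction k)
    case (Suc k)
    have "(\<integral>y. p y * (deriv ^^ k) \<psi> y \<partial>halfline) = 0"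
      if 0: "\<forall>\<phi>. test_function \<phi> \<longrightarrow> (\<integral>y. p y * (deriv ^^ Suc k) \<phi> y \<partial>halfline) = 0"
        and \<psi>: "test_function \<psi>" for \<psi>
    proof -
      define \<eta> where "\<eta> = (deriv ^^ k) \<psi>"
      have \<eta>: "test_function \<eta>" unfolding \<eta>_def by (rule test_function_funpow[OF \<psi>])
      obtain a b where ab: "0 < a" "a \<le> b" "\<forall>x. x \<notin> {a..b} \<longrightarrow> \<eta> x = 0"
        using \<eta> by (auto simp: test_function_iff)
      obtain B where B: "0 \<le> B" "\<And>x. \<bar>\<eta> x\<bar> \<le> B" using test_function_bounded[OF \<eta>] by blast
      \<comment> \<open>By the choice of A, the hypothesis of order k + 1 says that the pairing of p
        with eta is invariant under translation to the right.\<close>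
      have shift: "(\<integral>y. p y * \<eta> y \<partial>halfline) = (\<integral>y. p y * \<eta> (y - real n) \<partial>halfline)" for n
      proof -
        obtain A where A: "test_function A" "deriv A = (\<lambda>x. \<psi> x - \<psi> (x - real n))"
          using test_function_average[OF \<psi>, of "real n"] by auto
        have sm: "smooth \<psi>" by (rule test_function_smooth[OF \<psi>])
        have eq: "(deriv ^^ Suc k) A = (\<lambda>x. \<eta> x - \<eta> (x - real n))"
          unfolding funpow_Suc_right comp_apply A(2) \<eta>_def
          by (simp add: funpow_deriv_diff[OF sm smooth_shift[OF sm]] funpow_deriv_shift[OF sm])
        have "0 = (\<integral>y. p y * \<eta> y - p y * \<eta> (y - real n) \<partial>halfline)"
          using 0[rule_format, OF A(1)] unfolding eq right_diff_distrib by simp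
        also have "\<dots> = (\<integral>y. p y * \<eta> y \<partial>halfline) - (\<integral>y. p y * \<eta> (y - real n) \<partial>halfline)"
          by (intro Bochner_Integration.integral_diff loc_integrable_test_function[OF p] \<eta> test_function_shift) simp
        finally show ?thesis by simp
      qed
      have "(\<lambda>n. \<integral>y. p y * \<eta> (y - real n) \<partial>halfline) \<longlonglongrightarrow> (\<integral>y. 0 \<partial>halfline)"
      \<comment> \<open>On the support of a translate y >= a holds, so |p| is at most y |p| / a,
        which is integrable.\<close>
      proof (rule integral_dominated_convergence[where w = "\<lambda>y. B / a * \<bar>y * p y\<bar>"])
        show "integrable halfline (\<lambda>y. B / a * \<bar>y * p y\<bar>)" using int by simp
        have "(\<lambda>y. \<eta> (y - real n)) \<in> borel_measurable halfline" for n
          by (intro measurable_halflineI test_function_measurable test_function_shift \<eta>) simp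
        then show "(\<lambda>y. p y * \<eta> (y - real n)) \<in> borel_measurable halfline" for n by measurable
        show "AE y in halfline. (\<lambda>n. p y * \<eta> (y - real n)) \<longlonglongrightarrow> 0"
        proof (rule AE_I2)
          fix y :: real
          obtain N where N: "y < real N" using reals_Archimedean2 by blast
          have "eventually (\<lambda>n. p y * \<eta> (y - real n) = 0) sequentially"
            using eventually_ge_at_top[of N] by eventually_elim (use N ab in auto)
          then show "(\<lambda>n. p y * \<eta> (y - real n)) \<longlonglongrightarrow> 0" by (rule tendsto_eventually)
        qed
        show "AE y in halfline. norm (p y * \<eta> (y - real n)) \<le> B / a * \<bar>y * p y\<bar>" for n
        proof (rule AE_I2)
          fix y assume y: "y \<in> space halfline"
          show "norm (p y * \<eta> (y - real n)) \<le> B / a * \<bar>y * p y\<bar>"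
          proof (cases "y - real n \<in> {a..b}")
            case True
            then have "1 \<le> y / a" using ab by (simp add: field_simps)
            then have "1 * \<bar>p y\<bar> \<le> y / a * \<bar>p y\<bar>" by (intro mult_right_mono) auto
            then have "\<bar>p y\<bar> * \<bar>\<eta> (y - real n)\<bar> \<le> (y / a * \<bar>p y\<bar>) * B"
              using y ab by (intro mult_mono B) auto
            then show ?thesis using y by (simp add: abs_mult mult.commute mult.left_commute)
          next
            case False
            then show ?thesis using ab B(1) by simp
          qed
        qed
      qed auto
      then have "(\<lambda>n::nat. \<integral>y. p y * \<eta> y \<partial>halfline) \<longlonglongrightarrow> 0"
        unfolding shift[symmetric] by simp
      then show ?thesis unfolding \<eta>_def by (simp add: LIMSEQ_const_iff)
    qed
    then show ?case using Suc by blast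
  qed simp
  then show "(\<integral>y. p y * \<phi> y \<partial>halfline) = 0" if "test_function \<phi>" for \<phi>
    using 0 that by blast
qed

text \<open>h and the k-th primitive of f have the same k-th derivative, and both are integrable
  against y, so \<open>weak_deriv_zero\<close> applies to their difference. The index k + 1 for f is
  what k primitives reduce to 1.\<close>

lemma has_weak_deriv_imp_primitive:
  assumes h: "has_weak_deriv k h f" and f: "f \<in> moments_from (Suc k)"
    and int: "integrable halfline (\<lambda>y. y * h y)"
  shows "AE y in halfline. h y = (primitive ^^ k) f y"
proof -
  have g: "(primitive ^^ k) f \<in> moments_from 1"
    using moments_from_primitive_funpow[of f 1 k] f by simp
  have w: "has_weak_deriv k ((primitive ^^ k) f) f" by (rule has_weak_deriv_primitive[OF f])
  have loc: "loc_integrable h" "loc_integrable ((primitive ^^ k) f)"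
    using h w by (auto simp: has_weak_deriv_halfline)
  have "AE y in halfline. h y - (primitive ^^ k) f y = 0"
  proof (rule weak_deriv_zero[OF loc_integrable_diff[OF loc], of k])
    have "integrable halfline (\<lambda>y. y * (primitive ^^ k) f y)"
      using moments_from_integrable[OF g order_refl] by simp
    then show "integrable halfline (\<lambda>y. y * (h y - (primitive ^^ k) f y))"
      using int by (simp add: right_diff_distrib)
    fix \<phi> assume \<phi>: "test_function \<phi>"
    then show "(\<integral>y. (h y - (primitive ^^ k) f y) * (deriv ^^ k) \<phi> y \<partial>halfline) = 0"
      using h w loc[THEN loc_integrable_test_function[OF _ test_function_funpow[OF \<phi>]]]
      by (simp add: left_diff_distrib has_weak_deriv_halfline)
  qed
  then show ?thesis by eventually_elim simp
qed

section \<open>Membership and norm in terms of the k-th derivative\<close>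

section \<open>The spaces $X_{k,\mu}$\<close>

lemma X_norm_eq_wnorm: "X_norm k \<mu> h = wnorm \<mu> (Suc k) (weak_deriv k h)"
  unfolding X_norm_def wnorm_def L2_norm_def integral_halfline[symmetric]
  by (simp add: power_mult_distrib weight_square ac_simps del: power_Suc)

lemma X_space_iff:
  "h \<in> X_space k \<mu> \<longleftrightarrow> (\<exists>g. has_weak_deriv k h g) \<and> weak_deriv k h \<in> wL2 \<mu> (Suc k) \<and>
     integrable halfline (\<lambda>y. y * h y) \<and> (\<integral>y. y * h y \<partial>halfline) = 0"
proof -
  have "(\<lambda>y. y ^ (k + 1) * weak_deriv k h y) \<in> L2_exp \<mu> \<longleftrightarrow> weak_deriv k h \<in> wL2 \<mu> (Suc k)"
    if "\<exists>g. has_weak_deriv k h g"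
  proof -
    have m [measurable]: "weak_deriv k h \<in> borel_measurable halfline"
      using that has_weak_deriv_weak_deriv has_weak_deriv_measurable(2) by blast
    have [measurable]: "(\<lambda>y::real. y ^ (k + 1)) \<in> borel_measurable halfline"
      by (rule measurable_halflineI) measurable
    have "(\<lambda>y. y ^ (k + 1) * weak_deriv k h y) \<in> borel_measurable halfline"
      by measurable
    moreover have "(\<lambda>y. (y ^ (k + 1) * weak_deriv k h y)\<^sup>2 * exp (\<mu> * y)) = (\<lambda>y. (weight \<mu> (Suc k) y * weak_deriv k h y)\<^sup>2)"
      by (auto simp: power_mult_distrib weight_square power_mult[symmetric] mult.commute mult.left_commute simp del: power_Suc)
    moreover have "(\<lambda>y. weight \<mu> (Suc k) y * weak_deriv k h y) \<in> borel_measurable halfline"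
      by measurable
    ultimately show ?thesis
      using m by (simp add: L2_exp_def wL2_def L2_def measurable_halfline[symmetric] integrable_halfline[symmetric])
  qed
  then show ?thesis
    unfolding X_space_def mem_Collect_eq integrable_halfline[symmetric] integral_halfline[symmetric] by blast
qed

lemma has_weak_deriv_cong:
  assumes "has_weak_deriv n f g" "AE y in halfline. f y = f' y" "loc_integrable f'"
  shows "has_weak_deriv n f' g"
proof -
  have "(\<integral>y. f' y * (deriv ^^ n) \<phi> y \<partial>halfline) = (\<integral>y. f y * (deriv ^^ n) \<phi> y \<partial>halfline)"
    if \<phi>: "test_function \<phi>" for \<phi>
  proof (rule integral_cong_AE)
    show "AE y in halfline. f' y * (deriv ^^ n) \<phi> y = f y * (deriv ^^ n) \<phi> y"
      using assms(2) by eventually_elim simp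
    have "loc_integrable f" using assms(1) by (simp add: has_weak_deriv_halfline)
    then show "(\<lambda>y. f y * (deriv ^^ n) \<phi> y) \<in> borel_measurable halfline"
      "(\<lambda>y. f' y * (deriv ^^ n) \<phi> y) \<in> borel_measurable halfline"
      using assms(3) loc_integrable_test_function test_function_funpow[OF \<phi>] borel_measurable_integrable by blast+
  qed
  then show ?thesis using assms unfolding has_weak_deriv_halfline by simp
qed

text \<open>\<open>weak_deriv\<close> is a choice among representatives, so an explicit derivative
  agrees with it only almost everywhere; uniqueness of weak derivatives transfers the weighted
  bound.\<close>

lemma X_spaceI:
  assumes h: "has_weak_deriv k h f" and f: "f \<in> wL2 \<mu> (Suc k)"
    and int: "integrable halfline (\<lambda>y. y * h y)" "(\<integral>y. y * h y \<partial>halfline) = 0"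
  shows "h \<in> X_space k \<mu>" and "AE y in halfline. weak_deriv k h y = f y"
proof -
  have w: "has_weak_deriv k h (weak_deriv k h)" by (rule has_weak_deriv_weak_deriv[OF h])
  show ae: "AE y in halfline. weak_deriv k h y = f y" by (rule has_weak_deriv_unique[OF w h])
  then have "AE y in halfline. f y = weak_deriv k h y" by eventually_elim simp
  then have "weak_deriv k h \<in> wL2 \<mu> (Suc k)"
    by (rule wL2_cong_AE[OF f has_weak_deriv_measurable(2)[OF w]])
  then show "h \<in> X_space k \<mu>" using h int unfolding X_space_iff by blast
qed

lemma X_space_weak_deriv:
  assumes "h \<in> X_space k \<mu>"
  shows "has_weak_deriv k h (weak_deriv k h)" and "weak_deriv k h \<in> wL2 \<mu> (Suc k)"
    and "integrable halfline (\<lambda>y. y * h y)" and "(\<integral>y. y * h y \<partial>halfline) = 0"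
    and "weak_deriv k h \<in> borel_measurable halfline" and "h \<in> borel_measurable halfline"
    and "loc_integrable h"
proof -
  from assms show 1: "has_weak_deriv k h (weak_deriv k h)"
    unfolding X_space_iff using has_weak_deriv_weak_deriv by blast
  from assms show "weak_deriv k h \<in> wL2 \<mu> (Suc k)"
    and "integrable halfline (\<lambda>y. y * h y)" and "(\<integral>y. y * h y \<partial>halfline) = 0"
    unfolding X_space_iff by auto
  from 1 show "weak_deriv k h \<in> borel_measurable halfline" and "h \<in> borel_measurable halfline"
    and "loc_integrable h"
    by (auto intro: has_weak_deriv_measurable simp: has_weak_deriv_halfline)
qed

lemma X_space_lincomb:
  assumes f: "f \<in> X_space k \<mu>" and g: "g \<in> X_space k \<mu>"
  shows "(\<lambda>y. a * f y + b * g y) \<in> X_space k \<mu>"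
    and "AE y in halfline. weak_deriv k (\<lambda>y. a * f y + b * g y) y = a * weak_deriv k f y + b * weak_deriv k g y"
proof -
  note F = X_space_weak_deriv[OF f] and G = X_space_weak_deriv[OF g]
  have eq: "(\<lambda>y. y * (a * f y + b * g y)) = (\<lambda>y. a * (y * f y) + b * (y * g y))"
    by (auto simp: algebra_simps)
  note * = X_spaceI[OF has_weak_deriv_lincomb[OF F(1) G(1)] wL2_lincomb[OF F(2) G(2)], of a b]
  show "(\<lambda>y. a * f y + b * g y) \<in> X_space k \<mu>"
    by (rule *(1)) (use F(3,4) G(3,4) in \<open>auto simp: eq\<close>)
  show "AE y in halfline. weak_deriv k (\<lambda>y. a * f y + b * g y) y = a * weak_deriv k f y + b * weak_deriv k g y"
    by (rule *(2)) (use F(3,4) G(3,4) in \<open>auto simp: eq\<close>)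
qed

lemma X_norm_lincomb:
  assumes f: "f \<in> X_space k \<mu>" and g: "g \<in> X_space k \<mu>"
  shows "X_norm k \<mu> (\<lambda>y. a * f y + b * g y) \<le> \<bar>a\<bar> * X_norm k \<mu> f + \<bar>b\<bar> * X_norm k \<mu> g"
proof -
  have [measurable]: "weak_deriv k f \<in> borel_measurable halfline" "weak_deriv k g \<in> borel_measurable halfline"
    "weak_deriv k (\<lambda>y. a * f y + b * g y) \<in> borel_measurable halfline"
    using X_space_weak_deriv(5)[OF f] X_space_weak_deriv(5)[OF g] X_space_weak_deriv(5)[OF X_space_lincomb(1)[OF f g]]
    by auto
  have "X_norm k \<mu> (\<lambda>y. a * f y + b * g y) = wnorm \<mu> (Suc k) (\<lambda>y. a * weak_deriv k f y + b * weak_deriv k g y)"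
    unfolding X_norm_eq_wnorm by (rule wnorm_cong_AE[OF _ _ X_space_lincomb(2)[OF f g]]) measurable
  also have "\<dots> \<le> \<bar>a\<bar> * X_norm k \<mu> f + \<bar>b\<bar> * X_norm k \<mu> g"
    unfolding X_norm_eq_wnorm by (intro wnorm_lincomb X_space_weak_deriv(2) f g)
  finally show ?thesis .
qed

lemma X_norm_nonneg: "0 \<le> X_norm k \<mu> f"
  by (simp add: X_norm_eq_wnorm wnorm_nonneg)

lemma X_space_weak_deriv_cong:
  assumes "f \<in> X_space k \<mu>" "g \<in> X_space k \<mu>" "f \<approx>\<^sub>+ g"
  shows "AE y in halfline. weak_deriv k f y = weak_deriv k g y"
  using has_weak_deriv_unique[OF has_weak_deriv_cong[OF X_space_weak_deriv(1)[OF assms(1)]] X_space_weak_deriv(1)[OF assms(2)]]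
    assms X_space_weak_deriv(7)[OF assms(2)]
  by (simp add: ae_eq_halfline)

lemma X_norm_cong:
  assumes "f \<in> X_space k \<mu>" "g \<in> X_space k \<mu>" "f \<approx>\<^sub>+ g"
  shows "X_norm k \<mu> f = X_norm k \<mu> g"
  unfolding X_norm_eq_wnorm
  by (rule wnorm_cong_AE[OF X_space_weak_deriv(5)[OF assms(1)] X_space_weak_deriv(5)[OF assms(2)] X_space_weak_deriv_cong[OF assms]])

text \<open>Integrability of y h excludes polynomials, so the k-th derivative determines h; its
  moments of order at least k + 1 become moments of h of order at least 1.\<close>

lemma X_space_primitive:
  assumes h: "h \<in> X_space k \<mu>" and \<mu>: "0 < \<mu>"
  shows "AE y in halfline. h y = (primitive ^^ k) (weak_deriv k h) y"
    and "h \<in> moments_from 1"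
proof -
  have F: "weak_deriv k h \<in> moments_from (Suc k)"
    by (rule wL2_moments_from[OF X_space_weak_deriv(2)[OF h] \<mu>])
  show ae: "AE y in halfline. h y = (primitive ^^ k) (weak_deriv k h) y"
    by (rule has_weak_deriv_imp_primitive[OF X_space_weak_deriv(1)[OF h] F X_space_weak_deriv(3)[OF h]])
  then have "AE y in halfline. (primitive ^^ k) (weak_deriv k h) y = h y" by eventually_elim simp
  then show "h \<in> moments_from 1"
    using moments_from_primitive_funpow[of "weak_deriv k h" 1 k] F
    by (intro moments_from_cong_AE[OF _ X_space_weak_deriv(6)[OF h]]) auto
qed

section \<open>Moments of tail integrals and of iterated primitives\<close>

section \<open>Moments\<close>

definition moment :: "nat \<Rightarrow> (real \<Rightarrow> real) \<Rightarrow> real" where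
  "moment m f = (\<integral>y. y ^ m * f y \<partial>halfline)"

lemma moment_lincomb:
  assumes "f \<in> moments_from n" "g \<in> moments_from n" "n \<le> m"
  shows "moment m (\<lambda>y. a * f y + b * g y) = a * moment m f + b * moment m g"
proof -
  have "(\<lambda>y. y ^ m * (a * f y + b * g y)) = (\<lambda>y. a * (y ^ m * f y) + b * (y ^ m * g y))"
    by (auto simp: algebra_simps)
  then show ?thesis
    using assms moments_from_integrable by (simp add: moment_def)
qed

lemma moment_cong_AE:
  assumes [measurable]: "f \<in> borel_measurable halfline" "g \<in> borel_measurable halfline"
    and "AE y in halfline. f y = g y"
  shows "moment m f = moment m g"
  unfolding moment_def
proof (rule integral_cong_AE)
  have [measurable]: "(\<lambda>y::real. y ^ m) \<in> borel_measurable halfline"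
    by (rule measurable_halflineI) measurable
  show "(\<lambda>y. y ^ m * f y) \<in> borel_measurable halfline" "(\<lambda>y. y ^ m * g y) \<in> borel_measurable halfline"
    by measurable
  show "AE y in halfline. y ^ m * f y = y ^ m * g y" using assms(3) by eventually_elim simp
qed

lemma moment_cong: "(\<And>y. 0 < y \<Longrightarrow> f y = g y) \<Longrightarrow> moment m f = moment m g"
  unfolding moment_def by (intro Bochner_Integration.integral_cong) auto

lemma moment_mult: "moment m (\<lambda>y. y * f y) = moment (Suc m) f"
  by (simp add: moment_def ac_simps)

lemma moment_tail: "f \<in> moments_from n \<Longrightarrow> n \<le> Suc m \<Longrightarrow> moment m (tail_integral f) = moment (Suc m) f / real (Suc m)"
  unfolding moment_def by (rule moment_tail_integral)

lemma moment_primitive: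
  assumes "f \<in> moments_from n" "n \<le> Suc m"
  shows "moment m (primitive f) = - (moment (Suc m) f / real (Suc m))"
proof -
  have "moment m (primitive f) = - moment m (tail_integral f)"
    by (simp add: moment_def primitive_def)
  then show ?thesis using moment_tail[OF assms] by simp
qed

text \<open>Integrations by parts contribute the factors - 1/(m + j) for j = 1, ..., k. In this way
  moments of h are read off from D^k h.\<close>

lemma moment_primitive_funpow:
  "f \<in> moments_from n \<Longrightarrow> n \<le> m + k \<Longrightarrow> moment m ((primitive ^^ k) f) = (-1) ^ k * fact m / fact (m + k) * moment (m + k) f"
proof (induction k arbitrary: m f n)
  case (Suc k)
  have p: "primitive f \<in> moments_from (m + k)"
    by (rule moments_from_primitive, rule moments_from_mono[OF Suc.prems(1)]) (use Suc.prems in simp)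
  have "moment m ((primitive ^^ Suc k) f) = (-1) ^ k * fact m / fact (m + k) * moment (m + k) (primitive f)"
    unfolding funpow_Suc_right comp_apply by (rule Suc.IH[OF p]) simp
  also have "moment (m + k) (primitive f) = - (moment (Suc (m + k)) f / real (Suc (m + k)))"
    by (rule moment_primitive[OF Suc.prems(1)]) (use Suc.prems in simp)
  finally show ?case by (simp del: of_nat_Suc)
qed simp

section \<open>Conjugation of the generator to y D, and its dissipativity\<close>

section \<open>The operator $1 - aI$ and the generator\<close>

definition tail_diff :: "real \<Rightarrow> (real \<Rightarrow> real) \<Rightarrow> real \<Rightarrow> real" where
  "tail_diff a f = (\<lambda>y. f y - a * tail_integral f y)"

lemma tail_diff_moments_from: "f \<in> moments_from n \<Longrightarrow> tail_diff a f \<in> moments_from n"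
  unfolding tail_diff_def by (intro moments_from_diff moments_from_tail_integral')

lemma tail_diff_wL2:
  assumes "f \<in> wL2 \<mu> n" "0 < \<mu>"
  shows "tail_diff a f \<in> wL2 \<mu> n" and "wnorm \<mu> n (tail_diff a f) \<le> (1 + \<bar>a\<bar> * (4 / \<mu>)) * wnorm \<mu> n f"
proof -
  note I = wL2_tail_integral[OF assms]
  show "tail_diff a f \<in> wL2 \<mu> n" unfolding tail_diff_def by (rule wL2_diff[OF assms(1) I(1)])
  have "wnorm \<mu> n (tail_diff a f) \<le> wnorm \<mu> n f + \<bar>a\<bar> * wnorm \<mu> n (tail_integral f)"
    unfolding tail_diff_def by (rule wnorm_diff[OF assms(1) I(1)])
  also have "\<dots> \<le> wnorm \<mu> n f + \<bar>a\<bar> * (4 / \<mu> * wnorm \<mu> n f)"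
    by (intro add_left_mono mult_left_mono I(2)) simp
  finally show "wnorm \<mu> n (tail_diff a f) \<le> (1 + \<bar>a\<bar> * (4 / \<mu>)) * wnorm \<mu> n f"
    by (simp add: algebra_simps)
qed

lemma measurable_tail_diff: "f \<in> borel_measurable halfline \<Longrightarrow> tail_diff a f \<in> borel_measurable halfline"
  unfolding tail_diff_def
  by (intro borel_measurable_diff borel_measurable_times borel_measurable_const measurable_tail_integral)

lemma tail_diff_cong_AE:
  assumes "f \<in> borel_measurable halfline" "g \<in> borel_measurable halfline" "AE y in halfline. f y = g y"
  shows "AE y in halfline. tail_diff a f y = tail_diff a g y"
proof -
  have "AE y in halfline. 0 < y" by (rule AE_I2) simp
  with assms(3) show ?thesis
    by eventually_elim (simp add: tail_diff_def tail_integral_cong_AE[OF assms])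
qed

lemma tail_diff_cong: "(\<And>y. 0 < y \<Longrightarrow> f y = g y) \<Longrightarrow> 0 < y \<Longrightarrow> tail_diff a f y = tail_diff a g y"
  unfolding tail_diff_def using tail_integral_cong[of f g y] by simp

lemma tail_diff_lincomb:
  assumes "f \<in> moments_from n" "g \<in> moments_from n" "0 < y"
  shows "tail_diff a (\<lambda>y. b * f y + c * g y) y = b * tail_diff a f y + c * tail_diff a g y"
  using tail_integral_lincomb[OF assms] by (simp add: tail_diff_def algebra_simps)

lemma primitive_tail_diff:
  assumes f: "f \<in> moments_from n" and y: "0 < y"
  shows "primitive (tail_diff a f) y = tail_diff a (primitive f) y"
proof -
  have "tail_integral (\<lambda>y. 1 * f y + (- a) * tail_integral f y) y = 1 * tail_integral f y + (- a) * tail_integral (tail_integral f) y"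
    by (rule tail_integral_lincomb[OF f moments_from_tail_integral'[OF f] y])
  then show ?thesis
    using y by (simp add: primitive_def tail_diff_def tail_integral_uminus)
qed

lemma primitive_cong: "(\<And>y. 0 < y \<Longrightarrow> f y = g y) \<Longrightarrow> 0 < y \<Longrightarrow> primitive f y = primitive g y"
  unfolding primitive_def using tail_integral_cong[of f g y] by simp

lemma primitive_funpow_cong:
  "(\<And>y. 0 < y \<Longrightarrow> f y = g y) \<Longrightarrow> 0 < y \<Longrightarrow> (primitive ^^ k) f y = (primitive ^^ k) g y"
  by (induction k arbitrary: y) (auto intro: primitive_cong)

text \<open>Tail integrals commute with each other, so applying \<open>tail_diff a\<close> to D^k h
  amounts to applying it to h and differentiating k times.\<close>

lemma primitive_funpow_tail_diff:
  assumes f: "f \<in> moments_from n"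
  shows "0 < y \<Longrightarrow> (primitive ^^ k) (tail_diff a f) y = tail_diff a ((primitive ^^ k) f) y"
proof (induction k arbitrary: y)
  case (Suc k)
  have "primitive ((primitive ^^ k) (tail_diff a f)) y = primitive (tail_diff a ((primitive ^^ k) f)) y"
    by (rule primitive_cong[OF Suc.IH Suc.prems])
  also have "\<dots> = tail_diff a (primitive ((primitive ^^ k) f)) y"
    by (rule primitive_tail_diff[OF moments_from_primitive_funpow'[OF f] Suc.prems])
  finally show ?case by simp
qed simp

text \<open>In terms of derivatives: \<open>D\<^sup>k (y z) = y D\<^sup>k z + k D\<^sup>k\<^sup>-\<^sup>1 z\<close> for \<open>z\<close> the \<open>k\<close>-th primitive of \<open>Z\<close>.\<close>

lemma primitive_funpow_mult:
  "Z \<in> moments_from n \<Longrightarrow> 0 < y \<Longrightarrow>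
    (primitive ^^ k) (\<lambda>y. y * Z y + real k * primitive Z y) y = y * (primitive ^^ k) Z y"
proof (induction k arbitrary: Z)
  case (Suc k)
  let ?P = "primitive Z"
  have Z: "Z \<in> moments_from (Suc n)" by (rule moments_from_mono[OF Suc.prems(1)]) simp
  have P: "?P \<in> moments_from n" by (rule moments_from_primitive'[OF Suc.prems(1)])
  have "primitive (\<lambda>y. y * Z y + real (Suc k) * ?P y) y = y * ?P y + real k * primitive ?P y" if "0 < y" for y
  proof -
    have "tail_integral (\<lambda>y. 1 * (y * Z y) + real (Suc k) * ?P y) y
        = 1 * tail_integral (\<lambda>y. y * Z y) y + real (Suc k) * tail_integral ?P y"
      by (rule tail_integral_lincomb[OF moments_from_mult[OF Z] P that])
    then have "tail_integral (\<lambda>y. y * Z y + real (Suc k) * ?P y) y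
        = tail_integral (\<lambda>y. y * Z y) y + real (Suc k) * tail_integral ?P y"
      by (simp only: mult_1)
    moreover have "tail_integral ?P y = - tail_integral (tail_integral Z) y"
      unfolding primitive_def using that by (simp add: tail_integral_uminus)
    moreover note tail_integral_mult[OF Z that]
    moreover have "primitive f y = - tail_integral f y" for f
      by (rule primitive_def[THEN fun_cong])
    ultimately show ?thesis
      by (simp only:) (simp add: algebra_simps)
  qed
  then have "(primitive ^^ k) (primitive (\<lambda>y. y * Z y + real (Suc k) * ?P y)) y
      = (primitive ^^ k) (\<lambda>y. y * ?P y + real k * primitive ?P y) y"
    using Suc.prems(2) by (intro primitive_funpow_cong) auto
  also have "\<dots> = y * (primitive ^^ k) ?P y" by (rule Suc.IH[OF P Suc.prems(2)])
  finally show ?case unfolding funpow_Suc_right comp_apply .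
qed simp

definition exp_convolution :: "real \<Rightarrow> (real \<Rightarrow> real) \<Rightarrow> real \<Rightarrow> real" where
  "exp_convolution a H y = (\<integral>x. indicator {..<y} x * (H x * exp (- (a * (y - x)))) \<partial>halfline)"

text \<open>The profile is 2 a exp (-a y); together with the prefactor 2/rho = a the last term of
  \<open>coag_L\<close> becomes 2 a^2 times \<open>exp_convolution\<close>.\<close>

lemma convolution_g_profile:
  assumes "a = 2 / \<rho>"
  shows "convolution H (g_profile \<rho>) y = 2 * a * exp_convolution a H y"
proof -
  have "convolution H (g_profile \<rho>) y
      = (\<integral>x. indicator {0<..} x *\<^sub>R (2 * a * (indicator {..<y} x * (H x * exp (- (a * (y - x)))))) \<partial>lborel)"
    unfolding convolution_def set_lebesgue_integral_def
  proof (intro Bochner_Integration.integral_cong refl)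
    fix x
    have "g_profile \<rho> (y - x) = 2 * a * exp (- (a * (y - x)))"
      by (simp add: g_profile_def assms minus_divide_left)
    then show "indicator {0<..<y} x *\<^sub>R (H x * g_profile \<rho> (y - x))
        = indicator {0<..} x *\<^sub>R (2 * a * (indicator {..<y} x * (H x * exp (- (a * (y - x))))))"
      by (simp add: indicator_def)
  qed
  also have "\<dots> = (\<integral>x. 2 * a * (indicator {..<y} x * (H x * exp (- (a * (y - x))))) \<partial>halfline)"
    unfolding integral_halfline set_lebesgue_integral_def ..
  finally show ?thesis by (simp add: exp_convolution_def)
qed

lemma integral_exp_tail:
  assumes "0 < a" "0 \<le> m"
  shows "(\<integral>z. indicator {m<..} z * exp (- (a * (z - x))) \<partial>halfline) = exp (- (a * (m - x))) / a"
proof -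
  have [measurable]: "(\<lambda>z. exp (- (a * (z - x)))) \<in> borel_measurable halfline"
    by (rule measurable_halflineI) measurable
  have "(\<integral>\<^sup>+z. ennreal (indicator {m<..} z * exp (- (a * (z - x)))) \<partial>halfline)
      = (\<integral>\<^sup>+z. ennreal (exp (- (a * (m - x)))) * (ennreal (exp (- (a * (z - m)))) * indicator {m..} z) \<partial>lborel)"
    unfolding nn_integral_halfline
  proof (rule nn_integral_cong_AE)
    have "AE z in lborel. z \<noteq> m" by (rule AE_lborel_singleton)
    then show "AE z in lborel. ennreal (indicator {m<..} z * exp (- (a * (z - x)))) * indicator {0<..} z
        = ennreal (exp (- (a * (m - x)))) * (ennreal (exp (- (a * (z - m)))) * indicator {m..} z)"
    proof eventually_elim
      case (elim z)
      have "exp (- (a * (z - x))) = exp (- (a * (m - x))) * exp (- (a * (z - m)))"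
        by (simp add: mult_exp_exp algebra_simps)
      then show ?case
        using elim assms(2) by (auto simp: indicator_def ennreal_mult'[symmetric])
    qed
  qed
  also have "\<dots> = ennreal (exp (- (a * (m - x)))) * ennreal (1 / a)"
    by (subst nn_integral_cmult) (auto simp: nn_integral_exp_tail[OF assms(1)])
  also have "\<dots> = ennreal (exp (- (a * (m - x))) / a)"
    using assms(1) by (simp add: ennreal_mult'[symmetric])
  finally have "(\<integral>z. indicator {m<..} z * exp (- (a * (z - x))) \<partial>halfline) = enn2real (ennreal (exp (- (a * (m - x))) / a))"
    by (subst integral_eq_nn_integral) auto
  then show ?thesis using assms(1) by simp
qed

text \<open>
  The convolution \<open>e\<close> of \<open>H\<close> with \<open>exp (- a y)\<close> solves \<open>e' = H - a e\<close>, so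
  \<open>(1 - a I) e = - I H\<close>.
\<close>

lemma exp_convolution_tail:
  assumes H: "H \<in> moments_from 0" and a: "0 < a"
  shows "exp_convolution a H \<in> borel_measurable halfline"
    and "0 < y \<Longrightarrow> tail_diff a (exp_convolution a H) y = - tail_integral H y"
proof -
  have [measurable]: "H \<in> borel_measurable halfline" using H by (rule moments_from_measurable)
  have iH: "integrable halfline H" using moments_from_integrable[OF H order_refl] by simp
  define G where "G = (\<lambda>y p. H (fst p) * indicator {fst p<..} (snd p) * (indicator {y<..} (snd p) * exp (- (a * (snd p - fst p)))) :: real)"
  have id: "(\<lambda>x::real. x) \<in> borel_measurable halfline" by (rule measurable_halflineI) simp
  have [measurable]: "fst \<in> borel_measurable (halfline \<Otimes>\<^sub>M halfline)" "snd \<in> borel_measurable (halfline \<Otimes>\<^sub>M halfline)"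
    using measurable_compose[OF measurable_fst id] measurable_compose[OF measurable_snd id] by auto
  have Gm [measurable]: "G y \<in> borel_measurable (halfline \<Otimes>\<^sub>M halfline)" for y
    unfolding G_def
    by (intro borel_measurable_times indicator_greater_halfline measurable_compose[OF measurable_fst, of H]) measurable
  have G: "integrable (halfline \<Otimes>\<^sub>M halfline) (G y)" for y
  proof (rule integrableI_bounded[OF Gm])
    have "(\<integral>\<^sup>+p. ennreal (norm (G y p)) \<partial>(halfline \<Otimes>\<^sub>M halfline))
        = (\<integral>\<^sup>+x. (\<integral>\<^sup>+z. ennreal (norm (G y (x, z))) \<partial>halfline) \<partial>halfline)"
      by (rule halfline.nn_integral_fst[symmetric]) measurable
    also have "\<dots> \<le> (\<integral>\<^sup>+x. ennreal \<bar>H x\<bar> * ennreal (2 / a) \<partial>halfline)"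
    proof (rule nn_integral_mono)
      fix x
      have "(\<integral>\<^sup>+z. ennreal (norm (G y (x, z))) \<partial>halfline) \<le> (\<integral>\<^sup>+z. ennreal \<bar>H x\<bar> * ennreal (exp (- (a * \<bar>x - z\<bar>))) \<partial>halfline)"
        by (rule nn_integral_mono) (auto simp: G_def indicator_def abs_mult ennreal_mult'[symmetric])
      also have "\<dots> = ennreal \<bar>H x\<bar> * (\<integral>\<^sup>+z. ennreal (exp (- (a * \<bar>x - z\<bar>))) \<partial>halfline)"
        by (intro nn_integral_cmult measurable_compose[OF measurable_halflineI measurable_ennreal]) measurable
      also have "\<dots> \<le> ennreal \<bar>H x\<bar> * ennreal (2 / a)"
        by (intro mult_left_mono nn_integral_exp_kernel a) simp
      finally show "(\<integral>\<^sup>+z. ennreal (norm (G y (x, z))) \<partial>halfline) \<le> ennreal \<bar>H x\<bar> * ennreal (2 / a)" .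
    qed
    also have "\<dots> = (\<integral>\<^sup>+x. ennreal (norm (H x)) \<partial>halfline) * ennreal (2 / a)"
      by (subst nn_integral_multc) auto
    also have "\<dots> < \<infinity>"
      using iH by (simp add: integrable_iff_bounded ennreal_mult_less_top)
    finally show "(\<integral>\<^sup>+p. ennreal (norm (G y p)) \<partial>(halfline \<Otimes>\<^sub>M halfline)) < \<infinity>" .
  qed
  have inner: "(\<integral>x. G y (x, z) \<partial>halfline) = indicator {y<..} z * exp_convolution a H z" for y z
  proof -
    have "(\<integral>x. G y (x, z) \<partial>halfline) = (\<integral>x. indicator {y<..} z * (indicator {..<z} x * (H x * exp (- (a * (z - x))))) \<partial>halfline)"
      by (intro Bochner_Integration.integral_cong) (auto simp: G_def indicator_def)
    then show ?thesis by (simp add: exp_convolution_def)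
  qed
  have "integrable halfline (\<lambda>z. \<integral>x. G 0 (x, z) \<partial>halfline)"
    using halfline2.integrable_snd[of "\<lambda>x z. G 0 (x, z)"] G[of 0] by simp
  then have "integrable halfline (exp_convolution a H)"
    unfolding inner by (rule Bochner_Integration.integrable_cong[OF refl, THEN iffD1, rotated]) simp
  then show m: "exp_convolution a H \<in> borel_measurable halfline" by auto
  assume y: "0 < y"
  have i1: "integrable halfline (\<lambda>x. indicator {y<..} x * H x)"
    by (rule moments_from_tail_integrable'[OF H y])
  have i2: "integrable halfline (\<lambda>x. indicator {..<y} x * (H x * exp (- (a * (y - x)))))"
  proof (rule Bochner_Integration.integrable_bound[OF iH])
    have [measurable]: "(\<lambda>x. exp (- (a * (y - x)))) \<in> borel_measurable halfline" "(\<lambda>x. indicator {..<y} x :: real) \<in> borel_measurable halfline"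
      by (rule measurable_halflineI; measurable)+
    show "(\<lambda>x. indicator {..<y} x * (H x * exp (- (a * (y - x))))) \<in> borel_measurable halfline" by measurable
    show "AE x in halfline. norm (indicator {..<y} x * (H x * exp (- (a * (y - x))))) \<le> norm (H x)"
    proof (rule AE_I2)
      fix x
      have "\<bar>H x\<bar> * exp (- (a * (y - x))) \<le> \<bar>H x\<bar> * 1" if "x < y"
        using that a by (intro mult_left_mono) auto
      then show "norm (indicator {..<y} x * (H x * exp (- (a * (y - x))))) \<le> norm (H x)"
        by (cases "x < y") (simp_all add: abs_mult)
    qed
  qed
  have "tail_integral (exp_convolution a H) y = (\<integral>z. (\<integral>x. G y (x, z) \<partial>halfline) \<partial>halfline)"
    unfolding inner tail_integral_halfline[OF less_imp_le[OF y]] ..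
  also have "\<dots> = (\<integral>x. (\<integral>z. G y (x, z) \<partial>halfline) \<partial>halfline)"
    using halfline2.Fubini_integral[of "\<lambda>x z. G y (x, z)"] G[of y] by simp
  \<comment> \<open>For fixed x the variable z runs over z > max x y. Where x > y the exponential is
    1, which gives I H / a; where x < y it is the kernel of the convolution at y.\<close>
  also have "\<dots> = (\<integral>x. H x * (exp (- (a * (max x y - x))) / a) \<partial>halfline)"
  proof (intro Bochner_Integration.integral_cong refl)
    fix x assume "x \<in> space halfline"
    have "(\<integral>z. G y (x, z) \<partial>halfline) = (\<integral>z. H x * (indicator {max x y<..} z * exp (- (a * (z - x)))) \<partial>halfline)"
      by (intro Bochner_Integration.integral_cong) (auto simp: G_def indicator_def)
    also have "\<dots> = H x * (\<integral>z. indicator {max x y<..} z * exp (- (a * (z - x))) \<partial>halfline)" by simp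
    also have "\<dots> = H x * (exp (- (a * (max x y - x))) / a)"
      using y by (subst integral_exp_tail[OF a]) auto
    finally show "(\<integral>z. G y (x, z) \<partial>halfline) = H x * (exp (- (a * (max x y - x))) / a)" .
  qed
  also have "\<dots> = (\<integral>x. (1 / a) * (indicator {y<..} x * H x) + (1 / a) * (indicator {..<y} x * (H x * exp (- (a * (y - x))))) \<partial>halfline)"
  proof (rule integral_cong_AE)
    have [measurable]: "(\<lambda>x. exp (- (a * (max x y - x))) / a) \<in> borel_measurable halfline"
      by (rule measurable_halflineI) measurable
    show "(\<lambda>x. H x * (exp (- (a * (max x y - x))) / a)) \<in> borel_measurable halfline" by measurable
    show "(\<lambda>x. (1 / a) * (indicator {y<..} x * H x) + (1 / a) * (indicator {..<y} x * (H x * exp (- (a * (y - x)))))) \<in> borel_measurable halfline"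
      using i1 i2 by (intro borel_measurable_add borel_measurable_times borel_measurable_const borel_measurable_integrable)
    have "AE x in halfline. x \<noteq> y" unfolding AE_halfline using AE_lborel_singleton[of y] by eventually_elim simp
    then show "AE x in halfline. H x * (exp (- (a * (max x y - x))) / a)
        = (1 / a) * (indicator {y<..} x * H x) + (1 / a) * (indicator {..<y} x * (H x * exp (- (a * (y - x)))))"
      by eventually_elim (auto simp: indicator_def max_def)
  qed
  also have "\<dots> = (1 / a) * tail_integral H y + (1 / a) * exp_convolution a H y"
    unfolding exp_convolution_def tail_integral_halfline[OF less_imp_le[OF y]] using i1 i2 by simp
  finally show "tail_diff a (exp_convolution a H) y = - tail_integral H y"
    using a by (simp add: tail_diff_def field_simps)
qed

text \<open>
  For \<open>h = - I u\<close> and \<open>H = I h\<close> the generator is \<open>v = y u - 2 a H + 2 a\<^sup>2 e\<close>. Applying \<open>1 - a I\<close>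
  twice removes the convolution and conjugates the generator to \<open>y D\<close>.
\<close>

lemma tail_diff_generator:
  assumes u: "u \<in> moments_from 2" and a: "0 < a"
  defines "h \<equiv> primitive u"
  defines "H \<equiv> tail_integral h"
  defines "e \<equiv> exp_convolution a H"
  assumes e: "e \<in> moments_from 1"
  defines "v \<equiv> \<lambda>y. 1 * (y * u y) + 1 * ((- 2 * a) * H y + (2 * a\<^sup>2) * e y)"
  shows "v \<in> moments_from 1"
    and "\<And>y. 0 < y \<Longrightarrow> tail_diff a v y = 1 * (y * tail_diff a u y) + (- a) * H y"
    and "\<And>y. 0 < y \<Longrightarrow> tail_diff a (tail_diff a v) y = y * tail_diff a (tail_diff a u) y"
proof -
  have h: "h \<in> moments_from 1"
    unfolding h_def by (rule moments_from_primitive) (use u in \<open>simp add: numeral_2_eq_2\<close>)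
  have H: "H \<in> moments_from 0" unfolding H_def by (rule moments_from_tail_integral) (use h in simp)
  have H1: "H \<in> moments_from 1" by (rule moments_from_mono[OF H]) simp
  have yu: "(\<lambda>y. y * u y) \<in> moments_from 1" by (rule moments_from_mult) (use u in \<open>simp add: numeral_2_eq_2\<close>)
  have E: "(\<lambda>y. (- 2 * a) * H y + (2 * a\<^sup>2) * e y) \<in> moments_from 1" by (rule moments_from_lincomb[OF H1 e])
  show v: "v \<in> moments_from 1" unfolding v_def by (rule moments_from_lincomb[OF yu E])
  have Iu: "tail_integral u y = - h y" for y by (simp add: h_def primitive_def)
  have IIu: "tail_integral (tail_integral u) y = - H y" if "0 < y" for y
    unfolding H_def h_def primitive_def using that by (simp add: tail_integral_uminus)
  define u1 where "u1 = tail_diff a u"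
  have u1: "u1 \<in> moments_from 2" unfolding u1_def by (rule tail_diff_moments_from[OF u])
  have yu1: "(\<lambda>y. y * u1 y) \<in> moments_from 1" by (rule moments_from_mult) (use u1 in \<open>simp add: numeral_2_eq_2\<close>)
  \<comment> \<open>The commutator contributes + a H from y u, which leaves - a H of the term - 2 a
    H; the convolution disappears because 2 a^2 (1 - a I) e = - 2 a^2 I H cancels the + 2 a^2 I H
    that comes from - 2 a H.\<close>
  have 1: "tail_diff a v y = 1 * (y * u1 y) + (- a) * H y" if y: "0 < y" for y
  proof -
    have "tail_integral v y = 1 * tail_integral (\<lambda>y. y * u y) y + 1 * tail_integral (\<lambda>y. (- 2 * a) * H y + (2 * a\<^sup>2) * e y) y"
      unfolding v_def by (rule tail_integral_lincomb[OF yu E y])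
    also have "tail_integral (\<lambda>y. (- 2 * a) * H y + (2 * a\<^sup>2) * e y) y = (- 2 * a) * tail_integral H y + (2 * a\<^sup>2) * tail_integral e y"
      by (rule tail_integral_lincomb[OF H1 e y])
    also have "tail_integral (\<lambda>y. y * u y) y = - (y * h y) - H y"
      using tail_integral_mult[OF u y] Iu[of y] IIu[OF y] by simp
    finally have Iv: "tail_integral v y
        = 1 * (- (y * h y) - H y) + 1 * ((- 2 * a) * tail_integral H y + (2 * a\<^sup>2) * tail_integral e y)" .
    have e: "e y = a * tail_integral e y - tail_integral H y"
      using exp_convolution_tail(2)[OF H a y] by (simp add: tail_diff_def e_def)
    have vy: "v y = 1 * (y * u y) + 1 * ((- 2 * a) * H y + (2 * a\<^sup>2) * e y)" by (simp add: v_def)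
    show ?thesis
      unfolding tail_diff_def u1_def Iv Iu vy e by (simp add: algebra_simps power2_eq_square)
  qed
  then show "\<And>y. 0 < y \<Longrightarrow> tail_diff a v y = 1 * (y * tail_diff a u y) + (- a) * H y"
    by (simp add: u1_def)
  show "tail_diff a (tail_diff a v) y = y * tail_diff a (tail_diff a u) y" if y: "0 < y" for y
  proof -
    \<comment> \<open>The commutator now contributes - a I^2 u1 = a H - a^2 I H, which is cancelled
      by (1 - a I) applied to the remainder - a H.\<close>
    have "tail_diff a (tail_diff a v) y = tail_diff a (\<lambda>y. 1 * (y * u1 y) + (- a) * H y) y"
      by (rule tail_diff_cong[OF 1 y])
    also have "\<dots> = 1 * tail_diff a (\<lambda>y. y * u1 y) y + (- a) * tail_diff a H y"
      by (rule tail_diff_lincomb[OF yu1 H1 y])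
    finally have *: "tail_diff a (tail_diff a v) y = 1 * tail_diff a (\<lambda>y. y * u1 y) y + (- a) * tail_diff a H y" .
    have Iu1: "tail_integral u1 x = - h x + a * H x" if "0 < x" for x
    proof -
      have "tail_integral (\<lambda>y. 1 * u y + (- a) * tail_integral u y) x = 1 * tail_integral u x + (- a) * tail_integral (tail_integral u) x"
        by (rule tail_integral_lincomb[OF u moments_from_tail_integral'[OF u] that])
      then show ?thesis using IIu[OF that] Iu[of x] by (simp add: u1_def tail_diff_def)
    qed
    have "tail_integral (tail_integral u1) y = tail_integral (\<lambda>x. (- 1) * h x + a * H x) y"
      using Iu1 y by (intro tail_integral_cong) auto
    also have "\<dots> = (- 1) * H y + a * tail_integral H y"
      unfolding H_def by (rule tail_integral_lincomb[OF h H1[unfolded H_def] y])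
    finally have "tail_integral (tail_integral u1) y = - H y + a * tail_integral H y" by simp
    then have T: "tail_integral (\<lambda>y. y * u1 y) y = y * tail_integral u1 y - H y + a * tail_integral H y"
      using tail_integral_mult[OF u1 y] by simp
    show ?thesis
      unfolding * u1_def[symmetric] tail_diff_def[of a "\<lambda>y. y * u1 y"] tail_diff_def[of a H] tail_diff_def[of a u1] T
      by (simp add: algebra_simps)
  qed
qed

text \<open>Taking the first moment of the once conjugated generator avoids computing moments of the
  convolution. With both first moments zero, the left side is - a m_2(v) / 2 and the right side a
  m_2(h) - a m_2(h) / 2, because m_2(u) = - 2 m_1(h) = 0 and m_3(u) = - 3 m_2(h).\<close>

lemma moment_2_generator:
  assumes u: "u \<in> moments_from 2" and a: "0 < a"
  defines "h \<equiv> primitive u"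
  defines "H \<equiv> tail_integral h"
  assumes v: "v \<in> moments_from 1"
    and eq: "\<And>y. 0 < y \<Longrightarrow> tail_diff a v y = 1 * (y * tail_diff a u y) + (- a) * H y"
    and mean: "moment 1 v = 0" "moment 1 h = 0"
  shows "moment 2 v = - moment 2 h"
proof -
  have h: "h \<in> moments_from 1"
    unfolding h_def by (rule moments_from_primitive) (use u in \<open>simp add: numeral_2_eq_2\<close>)
  have H: "H \<in> moments_from 0" unfolding H_def by (rule moments_from_tail_integral) (use h in simp)
  have H1: "H \<in> moments_from 1" by (rule moments_from_mono[OF H]) simp
  have td: "moment m (tail_diff a f) = moment m f - a * (moment (Suc m) f / real (Suc m))"
    if "f \<in> moments_from n" "n \<le> m" for f m n
    using moment_lincomb[OF that(1) moments_from_tail_integral'[OF that(1)] that(2), of 1 "- a"]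
      moment_tail[OF that(1), of m] that(2) by (simp add: tail_diff_def)
  have yu1: "(\<lambda>y. y * tail_diff a u y) \<in> moments_from 1"
    by (rule moments_from_mult) (use tail_diff_moments_from[OF u] in \<open>simp add: numeral_2_eq_2\<close>)
  have "moment 1 (tail_diff a v) = moment 1 (\<lambda>y. 1 * (y * tail_diff a u y) + (- a) * H y)"
    by (rule moment_cong[OF eq])
  also have "\<dots> = 1 * moment 1 (\<lambda>y. y * tail_diff a u y) + (- a) * moment 1 H"
    by (rule moment_lincomb[OF yu1 H1 order_refl])
  also have "moment 1 (\<lambda>y. y * tail_diff a u y) = moment 2 (tail_diff a u)"
    by (simp add: moment_mult numeral_2_eq_2)
  also have "\<dots> = moment 2 u - a * (moment 3 u / 3)"
    using td[OF u order_refl] by (simp add: numeral_3_eq_3 numeral_2_eq_2)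
  also have "moment 2 u = 0"
    using moment_primitive[OF u, of 1] mean(2) by (simp add: h_def numeral_2_eq_2)
  also have "moment 3 u / 3 = - moment 2 h"
    using moment_primitive[OF u, of 2] by (simp add: h_def numeral_3_eq_3 numeral_2_eq_2)
  also have "moment 1 H = moment 2 h / 2"
    unfolding H_def using moment_tail[OF h, of 1] by (simp add: numeral_2_eq_2)
  finally have "moment 1 (tail_diff a v) = a * moment 2 h / 2" by simp
  moreover have "moment 1 (tail_diff a v) = - (a * (moment 2 v / 2))"
    using td[OF v order_refl] mean(1) by (simp add: numeral_2_eq_2)
  ultimately have "a * moment 2 v = a * (- moment 2 h)" by simp
  then show ?thesis using a by (simp only: mult_cancel_left) simp
qed

text \<open>After (1 - a I)^2 the k-th derivative of L h is y Z + k P, where P is (1 - a I)^2 D^k h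
  and Z is its derivative. The energy inequality of order k + 1 contributes - (2k + 3)/2 and the
  second term + k, which leaves - 3/2 for every k.\<close>

lemma generator_dissipative:
  assumes a: "a = 2 / \<rho>" and \<rho>: "0 < \<rho>" and \<mu>: "0 < \<mu>"
    and hD: "h \<in> X_space (Suc k) \<mu>" and hX: "h \<in> X_space k \<mu>" and LX: "coag_L \<rho> h \<in> X_space k \<mu>"
  shows "winner \<mu> (Suc k) (tail_diff a (tail_diff a (weak_deriv k h)))
      (tail_diff a (tail_diff a (weak_deriv k (coag_L \<rho> h))))
    \<le> - (3 / 2) * (wnorm \<mu> (Suc k) (tail_diff a (tail_diff a (weak_deriv k h))))\<^sup>2"
    and "moment 2 (coag_L \<rho> h) = - moment 2 h"
proof -
  have a0: "0 < a" using a \<rho> by simp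
  define U where "U = weak_deriv (Suc k) h"
  define u where "u = (primitive ^^ k) U"
  define h' where "h' = primitive u"
  define H where "H = tail_integral h'"
  define e where "e = exp_convolution a H"
  define L where "L = coag_L \<rho> h"
  have U: "U \<in> wL2 \<mu> (Suc (Suc k))" unfolding U_def by (rule X_space_weak_deriv(2)[OF hD])
  have Um: "U \<in> moments_from (Suc (Suc k))" by (rule wL2_moments_from[OF U \<mu>])
  have u: "u \<in> moments_from 2"
    unfolding u_def by (rule moments_from_primitive_funpow) (use Um in \<open>simp add: numeral_2_eq_2\<close>)
  have h': "h' \<in> moments_from 1"
    unfolding h'_def by (rule moments_from_primitive) (use u in \<open>simp add: numeral_2_eq_2\<close>)
  have hm: "h \<in> moments_from 1" by (rule X_space_primitive(2)[OF hX \<mu>])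
  have hh': "AE y in halfline. h y = h' y"
    using X_space_primitive(1)[OF hD \<mu>] by (simp add: h'_def u_def U_def)
  have h'h: "AE y in halfline. h' y = h y" using hh' by eventually_elim simp
  have hloc: "loc_integrable h" by (rule X_space_weak_deriv(7)[OF hX])
  have "has_weak_deriv 1 h' u" using has_weak_deriv_primitive[OF u, of 1] by (simp add: h'_def)
  then have w1: "has_weak_deriv 1 h u" by (rule has_weak_deriv_cong[OF _ h'h hloc])
  have d1: "AE y in halfline. weak_deriv 1 h y = u y"
    by (rule has_weak_deriv_unique[OF has_weak_deriv_weak_deriv[OF w1] w1])
  have tail: "tail_integral h y = H y" if "0 \<le> y" for y
    unfolding H_def by (rule tail_integral_cong_AE[OF _ _ hh' that])
      (use hm h' in \<open>auto intro: moments_from_measurable\<close>)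
  have conv: "exp_convolution a (tail_integral h) y = e y" for y
    unfolding e_def exp_convolution_def
    by (intro Bochner_Integration.integral_cong) (auto simp: tail)
  define v where "v = (\<lambda>y. 1 * (y * u y) + 1 * ((- 2 * a) * H y + (2 * a\<^sup>2) * e y))"
  have "AE y in halfline. 0 < y" by (rule AE_I2) simp
  with d1 have Lv: "AE y in halfline. L y = v y"
    by eventually_elim
      (simp add: L_def coag_L_def v_def tail conv convolution_g_profile[OF a] power2_eq_square, simp add: a)
  have LX: "L \<in> X_space k \<mu>" using LX by (simp add: L_def)
  have Lm: "L \<in> moments_from 1" by (rule X_space_primitive(2)[OF LX \<mu>])
  have H0: "H \<in> moments_from 0" unfolding H_def by (rule moments_from_tail_integral) (use h' in simp)
  have H1: "H \<in> moments_from 1" by (rule moments_from_mono[OF H0]) simp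
  have yu: "(\<lambda>y. y * u y) \<in> moments_from 1" by (rule moments_from_mult) (use u in \<open>simp add: numeral_2_eq_2\<close>)
  \<comment> \<open>The moments of the convolution are inherited rather than estimated: L h has them
    because it lies in the space, and e is a linear combination of L h, y u and H.\<close>
  have e: "e \<in> moments_from 1"
  proof (rule moments_from_cong_AE)
    show "(\<lambda>y. (1 / (2 * a\<^sup>2)) * L y + 1 * ((- 1 / (2 * a\<^sup>2)) * (y * u y) + (1 / a) * H y)) \<in> moments_from 1"
      by (intro moments_from_lincomb Lm yu H1)
    show "e \<in> borel_measurable halfline" unfolding e_def by (rule exp_convolution_tail(1)[OF H0 a0])
    show "AE y in halfline. (1 / (2 * a\<^sup>2)) * L y + 1 * ((- 1 / (2 * a\<^sup>2)) * (y * u y) + (1 / a) * H y) = e y"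
      using Lv by eventually_elim (use a0 in \<open>simp add: v_def field_simps power2_eq_square\<close>)
  qed
  note gen = tail_diff_generator[OF u a0, folded h'_def, folded H_def, folded e_def, OF e, folded v_def]
  have v: "v \<in> moments_from 1" by (rule gen(1))
  have Lmeas: "L \<in> borel_measurable halfline" and vmeas: "v \<in> borel_measurable halfline"
    using Lm v by (auto intro: moments_from_measurable)
  show "moment 2 (coag_L \<rho> h) = - moment 2 h"
  proof -
    have hmeas: "h \<in> borel_measurable halfline" "h' \<in> borel_measurable halfline"
      using hm h' by (auto intro: moments_from_measurable)
    have "moment 1 v = moment 1 L" by (rule moment_cong_AE[symmetric, OF Lmeas vmeas Lv])
    also have "\<dots> = 0" using X_space_weak_deriv(4)[OF LX] by (simp add: moment_def)
    finally have v1: "moment 1 v = 0" .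
    have "moment 1 h' = moment 1 h" by (rule moment_cong_AE[symmetric, OF hmeas hh'])
    also have "\<dots> = 0" using X_space_weak_deriv(4)[OF hX] by (simp add: moment_def)
    finally have h1: "moment 1 h' = 0" .
    have "moment 2 v = - moment 2 h'"
      by (rule moment_2_generator[OF u a0 v, folded h'_def, folded H_def, OF gen(2) v1 h1])
    then show ?thesis
      using moment_cong_AE[OF Lmeas vmeas Lv, of 2] moment_cong_AE[OF hmeas hh', of 2] by (simp add: L_def)
  qed
  define Q where "Q = (\<lambda>f. tail_diff a (tail_diff a f))"
  have Qcong: "AE y in halfline. Q f y = Q g y"
    if "f \<in> borel_measurable halfline" "g \<in> borel_measurable halfline" "AE y in halfline. f y = g y" for f g
    unfolding Q_def using that by (intro tail_diff_cong_AE measurable_tail_diff)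
  have Qprim: "(primitive ^^ j) (Q f) y = Q ((primitive ^^ j) f) y" if f: "f \<in> moments_from n" and y: "0 < y" for f n j y
  proof -
    have "(primitive ^^ j) (Q f) y = tail_diff a ((primitive ^^ j) (tail_diff a f)) y"
      unfolding Q_def by (rule primitive_funpow_tail_diff[OF tail_diff_moments_from[OF f] y])
    also have "\<dots> = Q ((primitive ^^ j) f) y"
      unfolding Q_def by (rule tail_diff_cong[OF primitive_funpow_tail_diff[OF f] y])
    finally show ?thesis .
  qed
  have Qm: "Q f \<in> moments_from n" if "f \<in> moments_from n" for f n
    unfolding Q_def by (intro tail_diff_moments_from that)
  have Qw: "Q f \<in> wL2 \<mu> n" if "f \<in> wL2 \<mu> n" for f n
    unfolding Q_def by (intro tail_diff_wL2(1) that \<mu>)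
  define F where "F = weak_deriv k h"
  define FL where "FL = weak_deriv k L"
  have F: "F \<in> wL2 \<mu> (Suc k)" and FL: "FL \<in> wL2 \<mu> (Suc k)"
    unfolding F_def FL_def by (rule X_space_weak_deriv(2)[OF hX], rule X_space_weak_deriv(2)[OF LX])
  define Z where "Z = Q U"
  have Z: "Z \<in> wL2 \<mu> (Suc (Suc k))" unfolding Z_def by (rule Qw[OF U])
  have Zm: "Z \<in> moments_from (Suc (Suc k))" by (rule wL2_moments_from[OF Z \<mu>])
  define P where "P = primitive Z"
  have pU: "primitive U \<in> moments_from (Suc k)" by (rule moments_from_primitive[OF Um])
  have "has_weak_deriv k h' (primitive U)"
    using has_weak_deriv_primitive[OF pU, of k] by (simp add: h'_def u_def funpow_swap1)
  then have wF: "has_weak_deriv k h (primitive U)" by (rule has_weak_deriv_cong[OF _ h'h hloc])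
  have "AE y in halfline. F y = primitive U y"
    unfolding F_def by (rule has_weak_deriv_unique[OF X_space_weak_deriv(1)[OF hX] wF])
  then have "AE y in halfline. Q F y = Q (primitive U) y"
    using wL2_measurable[OF F] moments_from_measurable[OF pU] by (intro Qcong)
  with \<open>AE y in halfline. 0 < y\<close> have QF: "AE y in halfline. Q F y = P y"
    by eventually_elim (use Qprim[OF Um, of _ 1] in \<open>simp add: P_def Z_def\<close>)
  have Pmeas: "P \<in> borel_measurable halfline"
    unfolding P_def by (rule moments_from_measurable[OF moments_from_primitive'[OF Zm]])
  have P: "P \<in> wL2 \<mu> (Suc k)" by (rule wL2_cong_AE[OF Qw[OF F] Pmeas QF])
  define V where "V = (\<lambda>y. y * Z y + real k * P y)"
  have yZ: "(\<lambda>y. y * Z y) \<in> wL2 \<mu> (Suc k)" by (rule wL2_mult[OF Z])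
  have V: "V \<in> wL2 \<mu> (Suc k)"
    using wL2_lincomb[OF yZ P, of 1 "real k"] by (simp add: V_def)
  have FLm: "FL \<in> moments_from (Suc k)" and Vm: "V \<in> moments_from (Suc k)"
    using FL V \<mu> by (auto intro: wL2_moments_from)
  have "AE y in halfline. v y = (primitive ^^ k) FL y"
    using Lv X_space_primitive(1)[OF LX \<mu>] by eventually_elim (simp add: FL_def)
  then have "AE y in halfline. Q v y = Q ((primitive ^^ k) FL) y"
    using vmeas moments_from_measurable[OF moments_from_primitive_funpow'[OF FLm]] by (intro Qcong)
  with \<open>AE y in halfline. 0 < y\<close> have "AE y in halfline. (primitive ^^ k) (Q FL) y = (primitive ^^ k) V y"
  proof eventually_elim
    case (elim y)
    have "(primitive ^^ k) (Q FL) y = Q v y" using elim Qprim[OF FLm, of y k] by simp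
    also have "\<dots> = y * Q u y" unfolding Q_def using gen(3) elim by simp
    also have "\<dots> = y * (primitive ^^ k) Z y"
      using elim Qprim[OF Um, of y k] by (simp add: Z_def u_def)
    also have "\<dots> = (primitive ^^ k) V y"
      unfolding V_def P_def by (rule primitive_funpow_mult[OF Zm, symmetric]) (use elim in simp)
    finally show ?case .
  qed
  \<comment> \<open>The conjugation identity is known for k-th primitives. As \<open>Q FL\<close>
    and V are both weak derivatives of one function, uniqueness brings the identity back to the
    level of derivatives.\<close>
  then have "has_weak_deriv k ((primitive ^^ k) V) (Q FL)"
    by (rule has_weak_deriv_cong[OF has_weak_deriv_primitive[OF Qm[OF FLm]]])
      (rule moments_from_loc_integrable[OF moments_from_primitive_funpow'[OF Vm]])
  then have QFL: "AE y in halfline. Q FL y = V y"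
    by (rule has_weak_deriv_unique[OF _ has_weak_deriv_primitive[OF Vm]])
  \<comment> \<open>P is minus the tail integral of Z, which turns the lower bound of the energy
    inequality into the upper bound wanted here.\<close>
  have IZ: "tail_integral Z = (\<lambda>y. (- 1) * P y)" by (simp add: P_def primitive_def)
  have IZw: "tail_integral Z \<in> wL2 \<mu> (Suc k)" unfolding IZ by (rule wL2_cmult[OF P])
  have IZn: "wnorm \<mu> (Suc k) (tail_integral Z) = wnorm \<mu> (Suc k) P" unfolding IZ wnorm_cmult by simp
  have IZi: "winner \<mu> (Suc k) (\<lambda>y. y * Z y) (tail_integral Z) = - winner \<mu> (Suc k) (\<lambda>y. y * Z y) P"
    unfolding IZ winner_def by simp
  have "winner \<mu> (Suc k) (Q F) (Q FL) = winner \<mu> (Suc k) P V"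
    by (rule winner_cong_AE[OF wL2_measurable[OF Qw[OF F]] Pmeas wL2_measurable[OF Qw[OF FL]] wL2_measurable[OF V] QF QFL])
  also have "\<dots> = winner \<mu> (Suc k) (\<lambda>y. 1 * (y * Z y) + real k * P y) P"
    by (subst winner_commute) (simp add: V_def)
  also have "\<dots> = winner \<mu> (Suc k) (\<lambda>y. y * Z y) P + real k * (wnorm \<mu> (Suc k) P)\<^sup>2"
    by (subst winner_lincomb_left[OF yZ P P]) (simp add: winner_self)
  also have "winner \<mu> (Suc k) (\<lambda>y. y * Z y) P \<le> - (real (2 * Suc k + 1) / 2 * (wnorm \<mu> (Suc k) P)\<^sup>2)"
    using energy_inequality[OF Z IZw \<mu>] IZi IZn by simp
  also have "- (real (2 * Suc k + 1) / 2 * (wnorm \<mu> (Suc k) P)\<^sup>2) + real k * (wnorm \<mu> (Suc k) P)\<^sup>2 = - (3 / 2) * (wnorm \<mu> (Suc k) P)\<^sup>2"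
    by (simp add: algebra_simps add_divide_distrib)
  also have "wnorm \<mu> (Suc k) P = wnorm \<mu> (Suc k) (Q F)"
    by (rule wnorm_cong_AE[symmetric, OF wL2_measurable[OF Qw[OF F]] Pmeas QF])
  finally have "winner \<mu> (Suc k) (Q F) (Q FL) \<le> - (3 / 2) * (wnorm \<mu> (Suc k) (Q F))\<^sup>2" by simp
  then show "winner \<mu> (Suc k) (tail_diff a (tail_diff a (weak_deriv k h)))
      (tail_diff a (tail_diff a (weak_deriv k (coag_L \<rho> h))))
    \<le> - (3 / 2) * (wnorm \<mu> (Suc k) (tail_diff a (tail_diff a (weak_deriv k h))))\<^sup>2"
    unfolding Q_def F_def FL_def L_def .
qed

section \<open>The energy form and its equivalence with the norm\<close>

section \<open>An equivalent inner product\<close>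

text \<open>The bilinear form is kept, and not only its diagonal, because differentiation along
  orbits pairs h with L h. The second moment detects what the kernel of (1 - a I)^2 leaves
  undetermined once the first moment is zero.\<close>

definition energy :: "nat \<Rightarrow> real \<Rightarrow> real \<Rightarrow> (real \<Rightarrow> real) \<Rightarrow> (real \<Rightarrow> real) \<Rightarrow> real" where
  "energy k \<mu> a f g =
     winner \<mu> (Suc k) (tail_diff a (tail_diff a (weak_deriv k f))) (tail_diff a (tail_diff a (weak_deriv k g)))
       + moment 2 f * moment 2 g"

lemma energy_commute: "energy k \<mu> a f g = energy k \<mu> a g f"
  by (simp add: energy_def winner_commute mult.commute)

lemma energy_self:
  "energy k \<mu> a f f = (wnorm \<mu> (Suc k) (tail_diff a (tail_diff a (weak_deriv k f))))\<^sup>2 + (moment 2 f)\<^sup>2"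
  by (simp add: energy_def winner_self power2_eq_square)

lemma energy_lincomb_left:
  assumes \<mu>: "0 < \<mu>" and f: "f \<in> X_space k \<mu>" and g: "g \<in> X_space k \<mu>" and h: "h \<in> X_space k \<mu>"
  shows "energy k \<mu> a (\<lambda>y. b * f y + c * g y) h = b * energy k \<mu> a f h + c * energy k \<mu> a g h"
proof -
  define Q where "Q = (\<lambda>f. tail_diff a (tail_diff a f))"
  let ?F = "weak_deriv k f" and ?G = "weak_deriv k g" and ?H = "weak_deriv k h"
  let ?S = "weak_deriv k (\<lambda>y. b * f y + c * g y)"
  have FG: "?F \<in> wL2 \<mu> (Suc k)" "?G \<in> wL2 \<mu> (Suc k)" "?H \<in> wL2 \<mu> (Suc k)" "?S \<in> wL2 \<mu> (Suc k)"
    using X_space_weak_deriv(2) X_space_lincomb(1) f g h by blast+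
  have Qw: "Q f \<in> wL2 \<mu> n" if "f \<in> wL2 \<mu> n" for f n
    unfolding Q_def by (intro tail_diff_wL2(1) that \<mu>)
  have Fm: "?F \<in> moments_from (Suc k)" "?G \<in> moments_from (Suc k)"
    using FG \<mu> by (auto intro: wL2_moments_from)
  have lin: "(\<lambda>y. b * ?F y + c * ?G y) \<in> wL2 \<mu> (Suc k)" by (rule wL2_lincomb[OF FG(1,2)])
  have "AE y in halfline. Q ?S y = Q (\<lambda>y. b * ?F y + c * ?G y) y"
    unfolding Q_def
    by (intro tail_diff_cong_AE measurable_tail_diff X_space_lincomb(2)[OF f g] wL2_measurable[OF FG(4)] wL2_measurable[OF lin])
  moreover have "Q (\<lambda>y. b * ?F y + c * ?G y) y = b * Q ?F y + c * Q ?G y" if y: "0 < y" for y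
  proof -
    have "Q (\<lambda>y. b * ?F y + c * ?G y) y = tail_diff a (\<lambda>y. b * tail_diff a ?F y + c * tail_diff a ?G y) y"
      unfolding Q_def by (rule tail_diff_cong[OF tail_diff_lincomb[OF Fm] y])
    also have "\<dots> = b * Q ?F y + c * Q ?G y"
      unfolding Q_def by (rule tail_diff_lincomb[OF Fm[THEN tail_diff_moments_from] y])
    finally show ?thesis .
  qed
  moreover have "AE y in halfline. 0 < y" by (rule AE_I2) simp
  ultimately have "AE y in halfline. Q ?S y = b * Q ?F y + c * Q ?G y"
    by (auto elim: AE_mp)
  then have "winner \<mu> (Suc k) (Q ?S) (Q ?H) = winner \<mu> (Suc k) (\<lambda>y. b * Q ?F y + c * Q ?G y) (Q ?H)"
    by (rule winner_cong_AE[OF wL2_measurable[OF Qw[OF FG(4)]]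
          wL2_measurable[OF wL2_lincomb[OF Qw[OF FG(1)] Qw[OF FG(2)]]]
          wL2_measurable[OF Qw[OF FG(3)]] wL2_measurable[OF Qw[OF FG(3)]]]) auto
  also have "\<dots> = b * winner \<mu> (Suc k) (Q ?F) (Q ?H) + c * winner \<mu> (Suc k) (Q ?G) (Q ?H)"
    by (intro winner_lincomb_left Qw FG)
  finally have 1: "winner \<mu> (Suc k) (Q ?S) (Q ?H) = b * winner \<mu> (Suc k) (Q ?F) (Q ?H) + c * winner \<mu> (Suc k) (Q ?G) (Q ?H)" .
  have 2: "moment 2 (\<lambda>y. b * f y + c * g y) = b * moment 2 f + c * moment 2 g"
    by (rule moment_lincomb[of f 1 g]) (use X_space_primitive(2)[OF _ \<mu>] f g in auto)
  show ?thesis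
    using 1 2 unfolding energy_def Q_def by (simp add: algebra_simps)
qed

lemma energy_cong:
  assumes \<mu>: "0 < \<mu>" and f: "f \<in> X_space k \<mu>" "f' \<in> X_space k \<mu>" "f \<approx>\<^sub>+ f'" and g: "g \<in> X_space k \<mu>"
  shows "energy k \<mu> a f g = energy k \<mu> a f' g"
proof -
  have "AE y in halfline. weak_deriv k f y = weak_deriv k f' y" by (rule X_space_weak_deriv_cong[OF f])
  then have "AE y in halfline. tail_diff a (tail_diff a (weak_deriv k f)) y = tail_diff a (tail_diff a (weak_deriv k f')) y"
    by (intro tail_diff_cong_AE measurable_tail_diff X_space_weak_deriv(5)[OF f(1)] X_space_weak_deriv(5)[OF f(2)])
  then have "winner \<mu> (Suc k) (tail_diff a (tail_diff a (weak_deriv k f))) (tail_diff a (tail_diff a (weak_deriv k g)))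
      = winner \<mu> (Suc k) (tail_diff a (tail_diff a (weak_deriv k f'))) (tail_diff a (tail_diff a (weak_deriv k g)))"
    by (intro winner_cong_AE measurable_tail_diff X_space_weak_deriv(5)[OF f(1)] X_space_weak_deriv(5)[OF f(2)] X_space_weak_deriv(5)[OF g]) auto
  moreover have "moment 2 f = moment 2 f'"
    by (rule moment_cong_AE) (use f X_space_weak_deriv(6) in \<open>auto simp: ae_eq_halfline\<close>)
  ultimately show ?thesis by (simp add: energy_def)
qed

lemma moment_weak_deriv:
  assumes h: "h \<in> X_space k \<mu>" and \<mu>: "0 < \<mu>" and "1 \<le> m"
  shows "moment m h = (-1) ^ k * fact m / fact (m + k) * moment (m + k) (weak_deriv k h)"
proof -
  have Fm: "weak_deriv k h \<in> moments_from (Suc k)"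
    by (rule wL2_moments_from[OF X_space_weak_deriv(2)[OF h] \<mu>])
  have "moment m h = moment m ((primitive ^^ k) (weak_deriv k h))"
    by (rule moment_cong_AE[OF X_space_weak_deriv(6)[OF h] _ X_space_primitive(1)[OF h \<mu>]])
      (rule moments_from_measurable[OF moments_from_primitive_funpow'[OF Fm]])
  also have "\<dots> = (-1) ^ k * fact m / fact (m + k) * moment (m + k) (weak_deriv k h)"
    by (rule moment_primitive_funpow[OF Fm]) (use assms(3) in simp)
  finally show ?thesis .
qed

text \<open>Each factor 1 - a I costs at most 1 + 4 |a| / mu, and the second moment of h is a
  continuous functional of D^k h.\<close>

lemma energy_upper:
  assumes \<mu>: "0 < \<mu>"
  obtains C where "0 \<le> C"
    and "\<And>f g. f \<in> X_space k \<mu> \<Longrightarrow> g \<in> X_space k \<mu> \<Longrightarrow> \<bar>energy k \<mu> a f g\<bar> \<le> C * X_norm k \<mu> f * X_norm k \<mu> g"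
proof -
  define q where "q = (1 + \<bar>a\<bar> * (4 / \<mu>)) * (1 + \<bar>a\<bar> * (4 / \<mu>))"
  define c where "c = \<bar>(-1) ^ k * fact 2 / fact (2 + k)\<bar> * L2_norm halfline (\<lambda>y. y ^ (2 + k - Suc k) * exp (- (\<mu> / 2 * y)))"
  have q0: "0 \<le> q" using \<mu> by (simp add: q_def)
  have c0: "0 \<le> c" by (simp add: c_def L2_norm_nonneg)
  have "\<bar>energy k \<mu> a f g\<bar> \<le> (q * q + c * c) * X_norm k \<mu> f * X_norm k \<mu> g"
    if fg: "f \<in> X_space k \<mu>" "g \<in> X_space k \<mu>" for f g
  proof -
    have Q: "tail_diff a (tail_diff a (weak_deriv k h)) \<in> wL2 \<mu> (Suc k) \<and>
        wnorm \<mu> (Suc k) (tail_diff a (tail_diff a (weak_deriv k h))) \<le> q * X_norm k \<mu> h"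
      if h: "h \<in> X_space k \<mu>" for h
    proof -
      note 1 = tail_diff_wL2[OF X_space_weak_deriv(2)[OF h] \<mu>, of a]
      note 2 = tail_diff_wL2[OF 1(1) \<mu>, of a]
      have "wnorm \<mu> (Suc k) (tail_diff a (tail_diff a (weak_deriv k h)))
          \<le> (1 + \<bar>a\<bar> * (4 / \<mu>)) * ((1 + \<bar>a\<bar> * (4 / \<mu>)) * wnorm \<mu> (Suc k) (weak_deriv k h))"
        using \<mu> by (intro order_trans[OF 2(2)] mult_left_mono 1(2)) auto
      then show ?thesis using 2(1) by (simp add: q_def X_norm_eq_wnorm mult.assoc)
    qed
    have m: "\<bar>moment 2 h\<bar> \<le> c * X_norm k \<mu> h" if h: "h \<in> X_space k \<mu>" for h
    proof -
      have "\<bar>moment (2 + k) (weak_deriv k h)\<bar>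
          \<le> L2_norm halfline (\<lambda>y. y ^ (2 + k - Suc k) * exp (- (\<mu> / 2 * y))) * wnorm \<mu> (Suc k) (weak_deriv k h)"
        unfolding moment_def by (rule wL2_moment(2)[OF X_space_weak_deriv(2)[OF h] \<mu>]) simp
      then have "\<bar>(-1) ^ k * fact 2 / fact (2 + k)\<bar> * \<bar>moment (2 + k) (weak_deriv k h)\<bar>
          \<le> \<bar>(-1) ^ k * fact 2 / fact (2 + k)\<bar> *
            (L2_norm halfline (\<lambda>y. y ^ (2 + k - Suc k) * exp (- (\<mu> / 2 * y))) * wnorm \<mu> (Suc k) (weak_deriv k h))"
        by (rule mult_left_mono) simp
      then show ?thesis
        unfolding moment_weak_deriv[OF h \<mu> one_le_numeral] abs_mult c_def X_norm_eq_wnorm by (simp only: mult.assoc)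
    qed
    have "\<bar>energy k \<mu> a f g\<bar> \<le> \<bar>winner \<mu> (Suc k) (tail_diff a (tail_diff a (weak_deriv k f))) (tail_diff a (tail_diff a (weak_deriv k g)))\<bar>
        + \<bar>moment 2 f\<bar> * \<bar>moment 2 g\<bar>"
      unfolding energy_def abs_mult[symmetric] by (rule abs_triangle_ineq)
    also have "\<dots> \<le> (q * X_norm k \<mu> f) * (q * X_norm k \<mu> g) + (c * X_norm k \<mu> f) * (c * X_norm k \<mu> g)"
    proof (rule add_mono)
      show "\<bar>moment 2 f\<bar> * \<bar>moment 2 g\<bar> \<le> (c * X_norm k \<mu> f) * (c * X_norm k \<mu> g)"
        using c0 by (intro mult_mono m fg) (auto intro: mult_nonneg_nonneg X_norm_nonneg)
      show "\<bar>winner \<mu> (Suc k) (tail_diff a (tail_diff a (weak_deriv k f))) (tail_diff a (tail_diff a (weak_deriv k g)))\<bar>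
          \<le> (q * X_norm k \<mu> f) * (q * X_norm k \<mu> g)"
        using Q[OF fg(1)] Q[OF fg(2)] q0
        by (intro order_trans[OF winner_le mult_mono]) (auto intro: mult_nonneg_nonneg X_norm_nonneg wnorm_nonneg)
    qed
    also have "\<dots> = (q * q + c * c) * X_norm k \<mu> f * X_norm k \<mu> g" by (simp add: algebra_simps)
    finally show ?thesis .
  qed
  moreover have "0 \<le> q * q + c * c" by simp
  ultimately show thesis by (rule that[rotated])
qed

text \<open>\<open>resolvent_bound\<close> is used once for each factor. For F = D^k h the moment of
  order k + 1 is a multiple of the first moment of h and vanishes; for (1 - a I) F it equals - a /
  (k + 2) times the moment of order k + 2 of F, a multiple of m_2(h).\<close>

lemma energy_lower:
  assumes \<mu>: "0 < \<mu>" and a: "\<mu> / 2 < a"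
  obtains C where "0 \<le> C" and "\<And>f. f \<in> X_space k \<mu> \<Longrightarrow> (X_norm k \<mu> f)\<^sup>2 \<le> C * energy k \<mu> a f f"
proof -
  have a0: "0 < a" using a \<mu> by simp
  obtain C where C: "0 \<le> C"
    "\<And>F. F \<in> wL2 \<mu> (Suc k) \<Longrightarrow>
      wnorm \<mu> (Suc k) F \<le> C * (wnorm \<mu> (Suc k) (tail_diff a F) + \<bar>moment (Suc k) F\<bar>)"
    using resolvent_bound[OF \<mu> a, of "Suc k"] unfolding tail_diff_def moment_def by blast
  \<comment> \<open>Converts |m_2(f)| into the moment of order k + 1 of \<open>F1\<close>; the
    maximum with 1 lets the same factor serve the norm term.\<close>
  define d where "d = max 1 (a / real (Suc (Suc k)) * (fact (2 + k) / fact 2))"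
  have d: "1 \<le> d" by (simp add: d_def)
  have "(X_norm k \<mu> f)\<^sup>2 \<le> (2 * (C * (C * d))\<^sup>2) * energy k \<mu> a f f" if f: "f \<in> X_space k \<mu>" for f
  proof -
    define F where "F = weak_deriv k f"
    define F1 where "F1 = tail_diff a F"
    have F: "F \<in> wL2 \<mu> (Suc k)" unfolding F_def by (rule X_space_weak_deriv(2)[OF f])
    have F1: "F1 \<in> wL2 \<mu> (Suc k)" unfolding F1_def by (rule tail_diff_wL2(1)[OF F \<mu>])
    have Fm: "F \<in> moments_from (Suc k)" by (rule wL2_moments_from[OF F \<mu>])
    have "moment 1 f = 0" using X_space_weak_deriv(4)[OF f] by (simp add: moment_def)
    then have m1: "moment (Suc k) F = 0"
      using moment_weak_deriv[OF f \<mu> order_refl] by (simp add: F_def)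
    have "moment (Suc k) F1 = moment (Suc k) F - a * moment (Suc k) (tail_integral F)"
      using moment_lincomb[OF Fm moments_from_tail_integral'[OF Fm], of "Suc k" 1 "- a"] by (simp add: F1_def tail_diff_def)
    also have "moment (Suc k) (tail_integral F) = moment (2 + k) F / real (Suc (Suc k))"
      using moment_tail[OF Fm, of "Suc k"] by simp
    finally have "\<bar>moment (Suc k) F1\<bar> = a / real (Suc (Suc k)) * \<bar>moment (2 + k) F\<bar>"
      using m1 a0 by (simp add: abs_mult)
    also have "\<bar>moment (2 + k) F\<bar> = fact (2 + k) / fact 2 * \<bar>moment 2 f\<bar>"
      using moment_weak_deriv[OF f \<mu>, of 2] by (simp add: F_def abs_mult)
    also have "a / real (Suc (Suc k)) * (fact (2 + k) / fact 2 * \<bar>moment 2 f\<bar>)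
        = (a / real (Suc (Suc k)) * (fact (2 + k) / fact 2)) * \<bar>moment 2 f\<bar>"
      by (simp only: mult.assoc)
    also have "\<dots> \<le> d * \<bar>moment 2 f\<bar>"
      unfolding d_def by (intro mult_right_mono max.cobounded2) simp
    finally have "\<bar>moment (Suc k) F1\<bar> \<le> d * \<bar>moment 2 f\<bar>" .
    moreover have "wnorm \<mu> (Suc k) (tail_diff a F1) \<le> d * wnorm \<mu> (Suc k) (tail_diff a F1)"
      using mult_right_mono[OF d wnorm_nonneg] by simp
    ultimately have "wnorm \<mu> (Suc k) (tail_diff a F1) + \<bar>moment (Suc k) F1\<bar>
        \<le> d * (wnorm \<mu> (Suc k) (tail_diff a F1) + \<bar>moment 2 f\<bar>)"
      by (simp add: distrib_left)
    then have "wnorm \<mu> (Suc k) F1 \<le> C * (d * (wnorm \<mu> (Suc k) (tail_diff a F1) + \<bar>moment 2 f\<bar>))"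
      using C(2)[OF F1] C(1) by (meson mult_left_mono order_trans)
    then have "C * wnorm \<mu> (Suc k) F1 \<le> C * (C * (d * (wnorm \<mu> (Suc k) (tail_diff a F1) + \<bar>moment 2 f\<bar>)))"
      by (rule mult_left_mono[OF _ C(1)])
    moreover have "X_norm k \<mu> f \<le> C * wnorm \<mu> (Suc k) F1"
      using C(2)[OF F] m1 by (simp add: X_norm_eq_wnorm F_def F1_def)
    ultimately have "X_norm k \<mu> f \<le> (C * (C * d)) * (wnorm \<mu> (Suc k) (tail_diff a F1) + \<bar>moment 2 f\<bar>)"
      by (simp add: mult.assoc)
    then have "(X_norm k \<mu> f)\<^sup>2 \<le> ((C * (C * d)) * (wnorm \<mu> (Suc k) (tail_diff a F1) + \<bar>moment 2 f\<bar>))\<^sup>2"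
      by (rule power_mono[OF _ X_norm_nonneg])
    also have "\<dots> = (C * (C * d))\<^sup>2 * (wnorm \<mu> (Suc k) (tail_diff a F1) + \<bar>moment 2 f\<bar>)\<^sup>2"
      by (rule power_mult_distrib)
    also have "\<dots> \<le> (C * (C * d))\<^sup>2 * (2 * ((wnorm \<mu> (Suc k) (tail_diff a F1))\<^sup>2 + \<bar>moment 2 f\<bar>\<^sup>2))"
    proof (rule mult_left_mono)
      have "(x + y)\<^sup>2 \<le> 2 * (x\<^sup>2 + y\<^sup>2)" for x y :: real
        using zero_le_power2[of "x - y"] by (simp add: power2_eq_square algebra_simps)
      then show "(wnorm \<mu> (Suc k) (tail_diff a F1) + \<bar>moment 2 f\<bar>)\<^sup>2 \<le> 2 * ((wnorm \<mu> (Suc k) (tail_diff a F1))\<^sup>2 + \<bar>moment 2 f\<bar>\<^sup>2)" .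
    qed simp
    also have "\<dots> = (2 * (C * (C * d))\<^sup>2) * energy k \<mu> a f f"
      by (simp add: energy_self F1_def F_def)
    finally show ?thesis .
  qed
  moreover have "0 \<le> 2 * (C * (C * d))\<^sup>2" by simp
  ultimately show thesis by (rule that[rotated])
qed

text \<open>The common rate is the smaller of 3/2, from the norm part, and 1, from the moment
  part.\<close>

lemma energy_generator:
  assumes "a = 2 / \<rho>" "0 < \<rho>" "0 < \<mu>"
    and "h \<in> X_space (Suc k) \<mu>" "h \<in> X_space k \<mu>" "coag_L \<rho> h \<in> X_space k \<mu>"
  shows "energy k \<mu> a h (coag_L \<rho> h) \<le> - energy k \<mu> a h h"
proof -
  have "energy k \<mu> a h (coag_L \<rho> h) \<le> - (3 / 2) * (wnorm \<mu> (Suc k) (tail_diff a (tail_diff a (weak_deriv k h))))\<^sup>2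
      + moment 2 h * (- moment 2 h)"
    unfolding energy_def using generator_dissipative[OF assms] by simp
  also have "\<dots> \<le> - energy k \<mu> a h h"
    by (simp add: energy_self power2_eq_square)
  finally show ?thesis .
qed

section \<open>Approximation by primitives with zero first moment\<close>

section \<open>Density of the domain\<close>

lemma bounded_support_wL2:
  assumes [measurable]: "U \<in> borel_measurable halfline"
    and B: "\<And>y. 0 < y \<Longrightarrow> \<bar>U y\<bar> \<le> B * indicator {..N} y" and "0 < \<mu>"
  shows "U \<in> wL2 \<mu> n"
proof (rule wL2I)
  define c where "c = (weight \<mu> n N * B)\<^sup>2"
  have "integrable halfline (\<lambda>y. (weight \<mu> n y * U y)\<^sup>2)"
  proof (rule Bochner_Integration.integrable_bound)
    have "integrable lborel (\<lambda>y. c * indicator {0<..N} y)"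
      by (intro Bochner_Integration.integrable_mult_right integrable_real_indicator) (simp, cases "0 \<le> N", auto)
    also have "(\<lambda>y. c * indicator {0<..N} y) = (\<lambda>y. indicator {0<..} y *\<^sub>R (c * indicator {..N} y))"
      by (auto simp: indicator_def fun_eq_iff)
    finally show "integrable halfline (\<lambda>y. c * indicator {..N} y)"
      unfolding integrable_halfline set_integrable_def .
    show "AE y in halfline. norm ((weight \<mu> n y * U y)\<^sup>2) \<le> norm (c * indicator {..N} y)"
    proof (rule AE_I2)
      fix y assume y: "y \<in> space halfline"
      show "norm ((weight \<mu> n y * U y)\<^sup>2) \<le> norm (c * indicator {..N} y)"
      proof (cases "y \<le> N")
        case True
        have "weight \<mu> n y \<le> weight \<mu> n N"
          unfolding weight_def using y True \<open>0 < \<mu>\<close> by (intro mult_mono power_mono) auto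
        moreover have "\<bar>U y\<bar> \<le> B" using B[of y] y True by simp
        ultimately have "\<bar>weight \<mu> n y * U y\<bar> \<le> weight \<mu> n N * B"
          unfolding abs_mult using weight_pos[of y \<mu> n] y by (intro mult_mono) auto
        then have "\<bar>weight \<mu> n y * U y\<bar>\<^sup>2 \<le> (weight \<mu> n N * B)\<^sup>2"
          by (intro power_mono) auto
        then show ?thesis using True by (simp add: c_def)
      next
        case False
        then show ?thesis using B[of y] y by simp
      qed
    qed
  qed measurable
  then show "(\<lambda>y. weight \<mu> n y * U y) \<in> L2 halfline" by (simp add: L2_def)
qed measurable

lemma wnorm_tendsto_0:
  assumes [measurable]: "\<And>i. g i \<in> borel_measurable halfline" and G: "G \<in> wL2 \<mu> n"
    and lim: "AE y in halfline. (\<lambda>i. g i y) \<longlonglongrightarrow> 0"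
    and le: "\<And>i y. 0 < y \<Longrightarrow> \<bar>g i y\<bar> \<le> G y"
  shows "(\<lambda>i. wnorm \<mu> n (g i)) \<longlonglongrightarrow> 0"
proof -
  have "(\<lambda>i. \<integral>y. (weight \<mu> n y * g i y)\<^sup>2 \<partial>halfline) \<longlonglongrightarrow> (\<integral>y. 0 \<partial>halfline)"
  proof (rule integral_dominated_convergence[where w = "\<lambda>y. (weight \<mu> n y * G y)\<^sup>2"])
    show "integrable halfline (\<lambda>y. (weight \<mu> n y * G y)\<^sup>2)"
      by (rule L2_integrable_square[OF wL2_L2[OF G]])
    show "AE y in halfline. (\<lambda>i. (weight \<mu> n y * g i y)\<^sup>2) \<longlonglongrightarrow> 0"
      using lim
    proof eventually_elim
      case (elim y)
      have "(\<lambda>i. (weight \<mu> n y * g i y)\<^sup>2) \<longlonglongrightarrow> (weight \<mu> n y * 0)\<^sup>2"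
        by (intro tendsto_intros elim)
      then show ?case by simp
    qed
    show "AE y in halfline. norm ((weight \<mu> n y * g i y)\<^sup>2) \<le> (weight \<mu> n y * G y)\<^sup>2" for i
    proof (rule AE_I2)
      fix y assume y: "y \<in> space halfline"
      then have "\<bar>g i y\<bar>\<^sup>2 \<le> (G y)\<^sup>2" by (intro power_mono le) auto
      then show "norm ((weight \<mu> n y * g i y)\<^sup>2) \<le> (weight \<mu> n y * G y)\<^sup>2"
        by (simp add: power_mult_distrib mult_left_mono)
    qed
  qed measurable
  then have "(\<lambda>i. sqrt (\<integral>y. (weight \<mu> n y * g i y)\<^sup>2 \<partial>halfline)) \<longlonglongrightarrow> sqrt 0"
    by (intro tendsto_real_sqrt) simp
  then show ?thesis by (simp add: wnorm_def L2_norm_def)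
qed

text \<open>Cutting range and support at the same N gives functions that differ from F by at most
  |F| and eventually equal F at each point.\<close>

lemma truncate_approx:
  assumes F: "F \<in> wL2 \<mu> n" and "0 < \<delta>"
  obtains N f where "0 < N" "f \<in> borel_measurable halfline" "\<And>y. 0 < y \<Longrightarrow> \<bar>f y\<bar> \<le> real N * indicator {..real N} y"
    and "wnorm \<mu> n (\<lambda>y. F y - f y) < \<delta>"
proof -
  have [measurable]: "F \<in> borel_measurable halfline" by (rule wL2_measurable[OF F])
  define f where "f = (\<lambda>(N::nat) y. indicator {..real N} y * max (- real N) (min (real N) (F y)))"
  have [measurable]: "(\<lambda>y. indicator {..real N} y :: real) \<in> borel_measurable halfline" for N :: nat
    by (rule measurable_halflineI) measurable
  have fm [measurable]: "f N \<in> borel_measurable halfline" for N unfolding f_def by measurable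
  have "(\<lambda>N. wnorm \<mu> n (\<lambda>y. F y - f N y)) \<longlonglongrightarrow> 0"
  proof (rule wnorm_tendsto_0)
    show "(\<lambda>y. \<bar>F y\<bar>) \<in> wL2 \<mu> n"
      using F by (auto simp: wL2_def L2_def power_mult_distrib)
    show "AE y in halfline. (\<lambda>N. F y - f N y) \<longlonglongrightarrow> 0"
    proof (rule AE_I2)
      fix y
      obtain M where M: "max y \<bar>F y\<bar> < real M" using reals_Archimedean2 by blast
      have "eventually (\<lambda>N. F y - f N y = 0) sequentially"
        using eventually_ge_at_top[of M]
      proof eventually_elim
        case (elim N)
        then have "y \<le> real N" "- real N \<le> F y" "F y \<le> real N" using M by auto
        then show ?case by (simp add: f_def)
      qed
      then show "(\<lambda>N. F y - f N y) \<longlonglongrightarrow> 0" by (rule tendsto_eventually)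
    qed
    show "\<bar>F y - f N y\<bar> \<le> \<bar>F y\<bar>" for N y
      by (auto simp: f_def indicator_def max_def min_def abs_if)
  qed measurable
  then have "eventually (\<lambda>N. wnorm \<mu> n (\<lambda>y. F y - f N y) < \<delta>) sequentially"
    using \<open>0 < \<delta>\<close> by (auto dest: order_tendstoD)
  then have "eventually (\<lambda>N. wnorm \<mu> n (\<lambda>y. F y - f N y) < \<delta> \<and> 0 < N) sequentially"
    using eventually_gt_at_top[of 0] by (rule eventually_conj)
  then obtain N where N: "wnorm \<mu> n (\<lambda>y. F y - f N y) < \<delta>" "0 < N"
    by (auto simp: eventually_sequentially)
  show thesis
    by (rule that[OF N(2) fm _ N(1)]) (auto simp: f_def indicator_def max_def min_def)
qed

text \<open>A measurable function is an almost everywhere limit of continuous ones. Clamping these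
  to [-N, N] keeps the limit, since f takes its values there, and provides domination.\<close>

lemma continuous_approx:
  assumes f [measurable]: "f \<in> borel_measurable halfline" and N: "0 < N"
    and le: "\<And>y. 0 < y \<Longrightarrow> \<bar>f y\<bar> \<le> N * indicator {..N} y" and \<mu>: "0 < \<mu>" and "0 < \<delta>"
  obtains g where "continuous_on UNIV g" "\<And>y. \<bar>g y\<bar> \<le> N" "wnorm \<mu> n (\<lambda>y. f y - indicator {..N} y * g y) < \<delta>"
proof -
  define f' where "f' = (\<lambda>y. indicator {0<..} y * f y)"
  have "f' \<in> borel_measurable lborel"
    using f unfolding measurable_halfline set_borel_measurable_def f'_def by simp
  then have "f' \<in> borel_measurable lebesgue" by (rule measurable_completion)
  then have "f' measurable_on UNIV" by (rule lebesgue_measurable_imp_measurable_on) simp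
  then obtain K g where K: "negligible K" and g: "\<And>i. continuous_on UNIV (g i)"
    and lim: "\<And>y. y \<notin> K \<Longrightarrow> (\<lambda>i. g i y) \<longlonglongrightarrow> f' y"
    by (auto simp: measurable_on_def)
  define g' where "g' = (\<lambda>(i::nat) y. max (- N) (min N (g i y)))"
  have g'c: "continuous_on UNIV (g' i)" for i unfolding g'_def by (intro continuous_intros g)
  have g'm: "g' i \<in> borel_measurable halfline" for i
    by (intro measurable_halflineI borel_measurable_continuous_onI g'c)
  have g'b: "\<bar>g' i y\<bar> \<le> N" for i y using N by (auto simp: g'_def)
  have [measurable]: "(\<lambda>y. indicator {..N} y :: real) \<in> borel_measurable halfline"
    by (rule measurable_halflineI) measurable
  have "AE y in lebesgue. y \<notin> K"
    using K by (simp add: negligible_iff_null_sets AE_not_in)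
  then have "AE y in lborel. y \<notin> K" by (simp add: AE_completion_iff)
  then have nK: "AE y in halfline. y \<notin> K" unfolding AE_halfline by eventually_elim simp
  have "(\<lambda>i. wnorm \<mu> n (\<lambda>y. f y - indicator {..N} y * g' i y)) \<longlonglongrightarrow> 0"
  proof (rule wnorm_tendsto_0)
    show "(\<lambda>y. 2 * N * indicator {..N} y) \<in> wL2 \<mu> n"
      by (rule bounded_support_wL2[where B = "2 * N" and N = N]) (use N \<mu> in auto)
    show "\<bar>f y - indicator {..N} y * g' i y\<bar> \<le> 2 * N * indicator {..N} y" if "0 < y" for i y
      using le[OF that] g'b[of i y] by (auto simp: indicator_def)
    have "AE y in halfline. 0 < y" by (rule AE_I2) simp
    with nK show "AE y in halfline. (\<lambda>i. f y - indicator {..N} y * g' i y) \<longlonglongrightarrow> 0"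
    proof eventually_elim
      case (elim y)
      have "(\<lambda>i. g i y) \<longlonglongrightarrow> f y" using lim[of y] elim by (simp add: f'_def)
      then have "(\<lambda>i. f y - indicator {..N} y * g' i y) \<longlonglongrightarrow> f y - indicator {..N} y * max (- N) (min N (f y))"
        unfolding g'_def by (intro tendsto_intros)
      moreover have "f y - indicator {..N} y * max (- N) (min N (f y)) = 0"
        using le[of y] elim by (auto simp: indicator_def max_def min_def split: if_splits)
      ultimately show ?case by simp
    qed
    show "(\<lambda>y. f y - indicator {..N} y * g' i y) \<in> borel_measurable halfline" for i
      using g'm[of i] by measurable
  qed
  then have "eventually (\<lambda>i. wnorm \<mu> n (\<lambda>y. f y - indicator {..N} y * g' i y) < \<delta>) sequentially"
    using \<open>0 < \<delta>\<close> by (auto dest: order_tendstoD)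
  then obtain i where "wnorm \<mu> n (\<lambda>y. f y - indicator {..N} y * g' i y) < \<delta>"
    by (auto simp: eventually_sequentially)
  then show thesis by (rule that[OF g'c g'b])
qed

lemma tail_integral_shift:
  assumes "0 \<le> y" "0 \<le> \<epsilon>"
  shows "tail_integral (\<lambda>x. f (x + \<epsilon>)) y = tail_integral f (y + \<epsilon>)"
proof -
  have "tail_integral f (y + \<epsilon>) = (\<integral>x. indicator {y + \<epsilon><..} (\<epsilon> + 1 * x) *\<^sub>R f (\<epsilon> + 1 * x) \<partial>lborel)"
    unfolding tail_integral_def set_lebesgue_integral_def by (subst lborel_integral_real_affine[of 1 _ \<epsilon>]) auto
  also have "\<dots> = tail_integral (\<lambda>x. f (x + \<epsilon>)) y"
    unfolding tail_integral_def set_lebesgue_integral_def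
    by (intro Bochner_Integration.integral_cong) (auto simp: indicator_def add.commute)
  finally show ?thesis ..
qed

lemma average_integral:
  assumes "0 < y" "0 \<le> \<epsilon>"
  shows "integrable halfline (\<lambda>x. indicator {y<..<y + \<epsilon>} x :: real)" "(\<integral>x. indicator {y<..<y + \<epsilon>} x \<partial>halfline) = \<epsilon>"
proof -
  have eq: "(\<lambda>x. indicator {0<..} x *\<^sub>R (indicator {y<..<y + \<epsilon>} x :: real)) = indicator {y<..<y + \<epsilon>}"
    using assms by (auto simp: indicator_def fun_eq_iff)
  show "integrable halfline (\<lambda>x. indicator {y<..<y + \<epsilon>} x :: real)"
    unfolding integrable_halfline set_integrable_def eq
    by (rule integrable_real_indicator) (use assms in \<open>auto simp: emeasure_lborel_Ioo\<close>)
  show "(\<integral>x. indicator {y<..<y + \<epsilon>} x \<partial>halfline) = \<epsilon>"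
    unfolding integral_halfline set_lebesgue_integral_def eq using assms by simp
qed

text \<open>U is a difference quotient of the cut-off function f, so its primitive is the average of
  f over (y, y + epsilon). The averages converge to f at points of continuity, that is, everywhere
  except possibly at the cut N.\<close>

lemma average_approx:
  assumes g: "continuous_on UNIV g" and gb: "\<And>y. \<bar>g y\<bar> \<le> N" and N: "0 < N" and \<mu>: "0 < \<mu>" and "0 < \<delta>"
  obtains U B where "U \<in> borel_measurable halfline" "\<And>y. 0 < y \<Longrightarrow> \<bar>U y\<bar> \<le> B * indicator {..N} y"
    and "wnorm \<mu> n (\<lambda>y. indicator {..N} y * g y - primitive U y) < \<delta>"
proof -
  define f where "f = (\<lambda>y. indicator {..N} y * g y)"
  have fb: "\<bar>f y\<bar> \<le> N * indicator {..N} y" for y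
    using gb[of y] by (auto simp: f_def indicator_def)
  have fm [measurable]: "f \<in> borel_measurable borel"
    unfolding f_def using borel_measurable_continuous_onI[OF g] by measurable
  have fm' [measurable]: "f \<in> borel_measurable halfline" by (rule measurable_halflineI[OF fm])
  have fw: "f \<in> wL2 \<mu> 0" by (rule bounded_support_wL2[OF fm' fb \<mu>])
  have f0: "f \<in> moments_from 0" by (rule wL2_moments_from[OF fw \<mu>])
  define \<epsilon> where "\<epsilon> = (\<lambda>i. 1 / real (Suc i))"
  have \<epsilon>: "0 < \<epsilon> i" for i by (simp add: \<epsilon>_def)
  have \<epsilon>0: "\<epsilon> \<longlonglongrightarrow> 0" unfolding \<epsilon>_def by (rule LIMSEQ_Suc) (rule lim_1_over_n)
  define U where "U = (\<lambda>i y. (1 / \<epsilon> i) * f (y + \<epsilon> i) + (- 1 / \<epsilon> i) * f y)"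
  have shb: "\<bar>f (y + \<epsilon> i)\<bar> \<le> N * indicator {..N} y" for y i
    using fb[of "y + \<epsilon> i"] \<epsilon>[of i] N by (cases "y + \<epsilon> i \<le> N") (auto simp: indicator_def)
  have shm: "(\<lambda>y. f (y + \<epsilon> i)) \<in> borel_measurable halfline" for i
    by (rule measurable_halflineI) measurable
  have sh0: "(\<lambda>y. f (y + \<epsilon> i)) \<in> moments_from 0" for i
    by (rule wL2_moments_from[OF bounded_support_wL2[OF shm shb \<mu>] \<mu>])
  have Um: "U i \<in> borel_measurable halfline" for i unfolding U_def using shm[of i] by measurable
  have Ub: "\<bar>U i y\<bar> \<le> 2 * N / \<epsilon> i * indicator {..N} y" for i y
  proof -
    have "\<bar>f (y + \<epsilon> i) - f y\<bar> \<le> 2 * N * indicator {..N} y" using fb[of y] shb[of y i] by linarith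
    moreover have "U i y = (f (y + \<epsilon> i) - f y) / \<epsilon> i" by (simp add: U_def diff_divide_distrib)
    ultimately show ?thesis using \<epsilon>[of i] by (simp add: divide_right_mono)
  qed
  have pU: "primitive (U i) y = (1 / \<epsilon> i) * (\<integral>x. indicator {y<..<y + \<epsilon> i} x * f x \<partial>halfline)" if y: "0 < y" for i y
  proof -
    have "tail_integral (U i) y = (1 / \<epsilon> i) * tail_integral (\<lambda>y. f (y + \<epsilon> i)) y + (- 1 / \<epsilon> i) * tail_integral f y"
      unfolding U_def by (rule tail_integral_lincomb[OF sh0 f0 y])
    also have "tail_integral (\<lambda>y. f (y + \<epsilon> i)) y = tail_integral f (y + \<epsilon> i)"
      using y \<epsilon>[of i] by (intro tail_integral_shift) auto
    finally have tU: "tail_integral (U i) y = (1 / \<epsilon> i) * tail_integral f (y + \<epsilon> i) + (- 1 / \<epsilon> i) * tail_integral f y" .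
    have le: "y \<le> y + \<epsilon> i" using \<epsilon>[of i] by simp
    show ?thesis
      unfolding primitive_def tU tail_integral_diff_interval[OF f0 y le] by (simp add: right_diff_distrib)
  qed
  have fi: "integrable halfline f" using moments_from_integrable[OF f0 order_refl] by simp
  have ii: "integrable halfline (\<lambda>x. indicator {y<..<y + \<epsilon> i} x * f x)" for y i
  proof (rule Bochner_Integration.integrable_bound[OF fi])
    have "(\<lambda>x. indicator {y<..<y + \<epsilon> i} x :: real) \<in> borel_measurable halfline"
      by (rule measurable_halflineI) measurable
    then show "(\<lambda>x. indicator {y<..<y + \<epsilon> i} x * f x) \<in> borel_measurable halfline" by measurable
    show "AE x in halfline. norm (indicator {y<..<y + \<epsilon> i} x * f x) \<le> norm (f x)"
      by (auto simp: indicator_def)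
  qed
  have close: "\<bar>primitive (U i) y - c\<bar> \<le> \<eta>"
    if y: "0 < y" and near: "\<And>x. y < x \<Longrightarrow> x < y + \<epsilon> i \<Longrightarrow> \<bar>f x - c\<bar> \<le> \<eta>" for i y c \<eta>
  proof -
    note av = average_integral[OF y less_imp_le[OF \<epsilon>], of i]
    have iav: "integrable halfline (\<lambda>x. c * (indicator {y<..<y + \<epsilon> i} x :: real))"
      "integrable halfline (\<lambda>x. \<eta> * (indicator {y<..<y + \<epsilon> i} x :: real))"
      using av(1) by simp_all
    have "primitive (U i) y - c = (1 / \<epsilon> i) * ((\<integral>x. indicator {y<..<y + \<epsilon> i} x * f x \<partial>halfline) - c * \<epsilon> i)"
      using pU[OF y, of i] \<epsilon>[of i] by (simp add: field_simps)
    also have "(\<integral>x. indicator {y<..<y + \<epsilon> i} x * f x \<partial>halfline) - c * \<epsilon> i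
        = (\<integral>x. indicator {y<..<y + \<epsilon> i} x * f x - c * indicator {y<..<y + \<epsilon> i} x \<partial>halfline)"
      using Bochner_Integration.integral_diff[OF ii iav(1)] av(2) by simp
    finally have eq: "primitive (U i) y - c
        = (1 / \<epsilon> i) * (\<integral>x. indicator {y<..<y + \<epsilon> i} x * f x - c * indicator {y<..<y + \<epsilon> i} x \<partial>halfline)" .
    have "\<bar>\<integral>x. indicator {y<..<y + \<epsilon> i} x * f x - c * indicator {y<..<y + \<epsilon> i} x \<partial>halfline\<bar>
        \<le> (\<integral>x. \<bar>indicator {y<..<y + \<epsilon> i} x * f x - c * indicator {y<..<y + \<epsilon> i} x\<bar> \<partial>halfline)"
      by (rule integral_abs_bound)
    also have "\<dots> \<le> (\<integral>x. \<eta> * indicator {y<..<y + \<epsilon> i} x \<partial>halfline)"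
      by (intro integral_mono integrable_abs Bochner_Integration.integrable_diff ii iav)
        (use near in \<open>auto simp: indicator_def\<close>)
    also have "\<dots> = \<eta> * \<epsilon> i" using av(2) by simp
    finally show ?thesis
      unfolding eq abs_mult using \<epsilon>[of i] by (simp add: field_simps)
  qed
  have pUb: "\<bar>primitive (U i) y\<bar> \<le> N * indicator {..N} y" if y: "0 < y" for i y
  proof -
    \<comment> \<open>Averages look to the right only, so beyond N they vanish; both cases are
      \<open>close\<close> with c = 0.\<close>
    have "\<bar>f x - 0\<bar> \<le> N * indicator {..N} y" if "y < x" for x
      using fb[of x] that N by (cases "x \<le> N") (auto simp: indicator_def)
    then show ?thesis using close[OF y, of i 0 "N * indicator {..N} y"] by simp
  qed
  have "(\<lambda>i. wnorm \<mu> n (\<lambda>y. f y - primitive (U i) y)) \<longlonglongrightarrow> 0"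
  proof (rule wnorm_tendsto_0)
    show "(\<lambda>y. f y - primitive (U i) y) \<in> borel_measurable halfline" for i
      unfolding primitive_def using measurable_tail_integral[OF Um[of i]] by measurable
    show "(\<lambda>y. 2 * N * indicator {..N} y) \<in> wL2 \<mu> n"
      by (rule bounded_support_wL2[where B = "2 * N" and N = N])
        (use N \<mu> in \<open>auto intro!: measurable_halflineI borel_measurable_times\<close>)
    show "\<bar>f y - primitive (U i) y\<bar> \<le> 2 * N * indicator {..N} y" if "0 < y" for i y
      using pUb[OF that, of i] fb[of y] by linarith
    have "AE y in halfline. y \<noteq> N"
      unfolding AE_halfline using AE_lborel_singleton[of N] by eventually_elim simp
    moreover have "AE y in halfline. 0 < y" by (rule AE_I2) simp
    ultimately show "AE y in halfline. (\<lambda>i. f y - primitive (U i) y) \<longlonglongrightarrow> 0"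
    proof eventually_elim
      case (elim y)
      have "isCont f y"
      proof (cases "y < N")
        case True
        have "continuous_on {..<N} f"
          by (rule continuous_on_eq[of _ g]) (use g in \<open>auto simp: f_def intro: continuous_on_subset\<close>)
        then show ?thesis using True by (simp add: continuous_on_eq_continuous_at)
      next
        case False
        then have "y \<in> {N<..}" using elim by auto
        moreover have "continuous_on {N<..} f"
          by (rule continuous_on_eq[of _ "\<lambda>_. 0"]) (auto simp: f_def)
        ultimately show ?thesis by (simp add: continuous_on_eq_continuous_at)
      qed
      show ?case
      proof (rule LIMSEQ_I)
        fix r :: real assume "0 < r"
        then obtain s where s: "0 < s" "\<And>x. \<bar>x - y\<bar> < s \<Longrightarrow> \<bar>f x - f y\<bar> < r / 2"
          using \<open>isCont f y\<close> unfolding continuous_at_eps_delta dist_real_def by (meson half_gt_zero)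
        have "eventually (\<lambda>i. \<epsilon> i < s) sequentially" using \<epsilon>0 s(1) by (rule order_tendstoD)
        then obtain M where M: "\<And>i. M \<le> i \<Longrightarrow> \<epsilon> i < s" by (auto simp: eventually_sequentially)
        have "norm (f y - primitive (U i) y - 0) < r" if "M \<le> i" for i
        proof -
          have "\<bar>primitive (U i) y - f y\<bar> \<le> r / 2"
            by (rule close) (use elim M[OF that] s(2) in \<open>auto intro!: less_imp_le\<close>)
          then show ?thesis using \<open>0 < r\<close> unfolding real_norm_def by linarith
        qed
        then show "\<exists>M. \<forall>i\<ge>M. norm (f y - primitive (U i) y - 0) < r" by blast
      qed
    qed
  qed
  then have "eventually (\<lambda>i. wnorm \<mu> n (\<lambda>y. f y - primitive (U i) y) < \<delta>) sequentially"
    using \<open>0 < \<delta>\<close> by (auto dest: order_tendstoD)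
  then obtain i where "wnorm \<mu> n (\<lambda>y. f y - primitive (U i) y) < \<delta>"
    by (auto simp: eventually_sequentially)
  then show thesis
    by (intro that[OF Um[of i] Ub[of i]]) (simp add: f_def)
qed

lemma primitive_wL2: "f \<in> wL2 \<mu> n \<Longrightarrow> 0 < \<mu> \<Longrightarrow> primitive f \<in> wL2 \<mu> n"
  unfolding primitive_def using wL2_cmult[OF wL2_tail_integral(1), of f \<mu> n "- 1"] by simp

text \<open>U is bounded with bounded support and hence lies in the weighted spaces of every index;
  k + 2 is the index that membership in the domain asks for.\<close>

lemma primitive_dense:
  assumes F: "F \<in> wL2 \<mu> n" and \<mu>: "0 < \<mu>" and \<delta>: "0 < \<delta>"
  obtains U where "\<And>m. U \<in> wL2 \<mu> m" "wnorm \<mu> n (\<lambda>y. F y - primitive U y) < \<delta>"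
proof -
  have \<delta>3: "0 < \<delta> / 3" using \<delta> by simp
  obtain N f where N: "0 < (N::nat)" and f: "f \<in> borel_measurable halfline"
    "\<And>y. 0 < y \<Longrightarrow> \<bar>f y\<bar> \<le> real N * indicator {..real N} y" and 1: "wnorm \<mu> n (\<lambda>y. F y - f y) < \<delta> / 3"
    using truncate_approx[OF F \<delta>3] by blast
  have N': "0 < real N" using N by simp
  obtain g where g: "continuous_on UNIV g" "\<And>y. \<bar>g y\<bar> \<le> real N"
    and 2: "wnorm \<mu> n (\<lambda>y. f y - indicator {..real N} y * g y) < \<delta> / 3"
    using continuous_approx[OF f(1) N' f(2) \<mu> \<delta>3] by blast
  obtain U B where U: "U \<in> borel_measurable halfline" "\<And>y. 0 < y \<Longrightarrow> \<bar>U y\<bar> \<le> B * indicator {..real N} y"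
    and 3: "wnorm \<mu> n (\<lambda>y. indicator {..real N} y * g y - primitive U y) < \<delta> / 3"
    using average_approx[OF g N' \<mu> \<delta>3] by blast
  have Uw: "U \<in> wL2 \<mu> m" for m by (rule bounded_support_wL2[OF U \<mu>])
  define f1 where "f1 = (\<lambda>y. indicator {..real N} y * g y)"
  have fw: "f \<in> wL2 \<mu> n" by (rule bounded_support_wL2[OF f \<mu>])
  have f1m: "f1 \<in> borel_measurable halfline"
    unfolding f1_def by (rule measurable_halflineI) (use borel_measurable_continuous_onI[OF g(1)] in measurable)
  have f1w: "f1 \<in> wL2 \<mu> n"
    by (rule bounded_support_wL2[OF f1m _ \<mu>, where B = "real N" and N = "real N"])
      (use g(2) in \<open>auto simp: f1_def indicator_def\<close>)
  have pw: "primitive U \<in> wL2 \<mu> n" by (rule primitive_wL2[OF Uw \<mu>])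
  have d: "(\<lambda>y. u y - v y) \<in> wL2 \<mu> n" if "u \<in> wL2 \<mu> n" "v \<in> wL2 \<mu> n" for u v
    using wL2_diff[OF that, of 1] by simp
  have "wnorm \<mu> n (\<lambda>y. 1 * (F y - f y) + 1 * (1 * (f y - f1 y) + 1 * (f1 y - primitive U y)))
      \<le> \<bar>1\<bar> * wnorm \<mu> n (\<lambda>y. F y - f y) + \<bar>1\<bar> * wnorm \<mu> n (\<lambda>y. 1 * (f y - f1 y) + 1 * (f1 y - primitive U y))"
    by (rule wnorm_lincomb[OF d[OF F fw] wL2_lincomb[OF d[OF fw f1w] d[OF f1w pw]]])
  also have "wnorm \<mu> n (\<lambda>y. 1 * (f y - f1 y) + 1 * (f1 y - primitive U y))
      \<le> \<bar>1\<bar> * wnorm \<mu> n (\<lambda>y. f y - f1 y) + \<bar>1\<bar> * wnorm \<mu> n (\<lambda>y. f1 y - primitive U y)"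
    by (rule wnorm_lincomb[OF d[OF fw f1w] d[OF f1w pw]])
  finally have "wnorm \<mu> n (\<lambda>y. F y - primitive U y) < \<delta>"
    using 1 2 3 by (simp add: f1_def)
  with Uw show thesis by (rule that)
qed

text \<open>Replacing D^k h by a primitive of U destroys the zero first moment. It is restored by
  subtracting a multiple of E = exp (-mu y), whose primitive has the nonzero moment m0; the
  coefficient is small because the moment is continuous and vanishes on D^k h. The inclusion
  \<open>sub\<close> is later supplied by the generation hypothesis.\<close>

lemma X_space_dense:
  assumes h: "h \<in> X_space k \<mu>" and \<mu>: "0 < \<mu>" and \<epsilon>: "0 < \<epsilon>"
    and sub: "X_space (Suc k) \<mu> \<subseteq> X_space k \<mu>"
  obtains d where "d \<in> X_space (Suc k) \<mu>" "X_norm k \<mu> (\<lambda>y. 1 * h y + (- 1) * d y) < \<epsilon>"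
proof -
  define F where "F = weak_deriv k h"
  have F: "F \<in> wL2 \<mu> (Suc k)" unfolding F_def by (rule X_space_weak_deriv(2)[OF h])
  have Fm: "F \<in> moments_from (Suc k)" by (rule wL2_moments_from[OF F \<mu>])
  have "moment 1 h = 0" using X_space_weak_deriv(4)[OF h] by (simp add: moment_def)
  then have F0: "moment (Suc k) F = 0"
    using moment_weak_deriv[OF h \<mu> order_refl] by (simp add: F_def)
  \<comment> \<open>The rate mu exceeds mu/2, so E lies in the weighted space of every
    index.\<close>
  define E where "E = (\<lambda>y. exp (- (\<mu> * y)))"
  have E: "E \<in> wL2 \<mu> m" for m
  proof (rule wL2I)
    show "E \<in> borel_measurable halfline" unfolding E_def by (rule measurable_halflineI) measurable
    have "(\<lambda>y. weight \<mu> m y * E y) = (\<lambda>y. y ^ m * exp (- (\<mu> / 2 * y)))"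
      by (auto simp: weight_def E_def mult.assoc mult_exp_exp algebra_simps)
    then show "(\<lambda>y. weight \<mu> m y * E y) \<in> L2 halfline" using power_exp_L2[of "\<mu> / 2" m] \<mu> by simp
  qed
  have Em: "E \<in> moments_from m" for m by (rule wL2_moments_from[OF E \<mu>])
  define m0 where "m0 = moment (Suc k) (primitive E)"
  have "0 < moment (Suc (Suc k)) E"
    unfolding moment_def
    by (rule halfline_integral_pos[OF moments_from_integrable[OF Em order_refl]]) (simp add: E_def)
  then have m0: "m0 \<noteq> 0"
    using moment_primitive[OF Em order_refl, of "Suc k"] by (simp add: m0_def del: of_nat_Suc)
  define M where "M = L2_norm halfline (\<lambda>y. y ^ (Suc k - Suc k) * exp (- (\<mu> / 2 * y)))"
  have M0: "0 \<le> M" by (simp add: M_def L2_norm_nonneg)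
  have pE: "primitive E \<in> wL2 \<mu> (Suc k)" by (rule primitive_wL2[OF E \<mu>])
  \<comment> \<open>The factor by which restoring the moment enlarges the approximation
    error.\<close>
  define q where "q = 1 + M / \<bar>m0\<bar> * wnorm \<mu> (Suc k) (primitive E)"
  have q: "0 < q" using M0 wnorm_nonneg[of \<mu> "Suc k" "primitive E"] by (simp add: q_def add_pos_nonneg)
  obtain U where U: "\<And>m. U \<in> wL2 \<mu> m" and Ud: "wnorm \<mu> (Suc k) (\<lambda>y. F y - primitive U y) < \<epsilon> / q"
    using primitive_dense[OF F \<mu>, of "\<epsilon> / q"] \<epsilon> q by auto
  have Um: "U \<in> moments_from m" for m by (rule wL2_moments_from[OF U \<mu>])
  have pU: "primitive U \<in> wL2 \<mu> (Suc k)" by (rule primitive_wL2[OF U \<mu>])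
  have pUm: "primitive U \<in> moments_from (Suc k)" by (rule wL2_moments_from[OF pU \<mu>])
  define c where "c = moment (Suc k) (primitive U) / m0"
  define r where "r = wnorm \<mu> (Suc k) (\<lambda>y. F y - primitive U y)"
  have diff: "(\<lambda>y. 1 * F y + (- 1) * primitive U y) \<in> wL2 \<mu> (Suc k)" by (rule wL2_lincomb[OF F pU])
  have "moment (Suc k) (\<lambda>y. 1 * F y + (- 1) * primitive U y) = 1 * moment (Suc k) F + (- 1) * moment (Suc k) (primitive U)"
    by (rule moment_lincomb[OF Fm pUm order_refl])
  then have "\<bar>moment (Suc k) (primitive U)\<bar> = \<bar>moment (Suc k) (\<lambda>y. 1 * F y + (- 1) * primitive U y)\<bar>"
    using F0 by simp
  also have "\<dots> \<le> M * wnorm \<mu> (Suc k) (\<lambda>y. 1 * F y + (- 1) * primitive U y)"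
    unfolding moment_def M_def by (rule wL2_moment(2)[OF diff \<mu> order_refl])
  finally have c: "\<bar>c\<bar> \<le> M * r / \<bar>m0\<bar>"
    by (simp add: c_def r_def abs_divide divide_right_mono)
  define V where "V = (\<lambda>y. 1 * U y + (- c) * E y)"
  have V: "V \<in> wL2 \<mu> m" for m unfolding V_def by (rule wL2_lincomb[OF U E])
  have Vm: "V \<in> moments_from m" for m by (rule wL2_moments_from[OF V \<mu>])
  have pV: "primitive V y = 1 * primitive U y + (- c) * primitive E y" if "0 < y" for y
    using tail_integral_lincomb[OF Um Em that, of 1 "- c"] by (simp add: V_def primitive_def)
  have pVw: "primitive V \<in> wL2 \<mu> (Suc k)" by (rule primitive_wL2[OF V \<mu>])
  have "moment (Suc k) (primitive V) = moment (Suc k) (\<lambda>y. 1 * primitive U y + (- c) * primitive E y)"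
    by (rule moment_cong[OF pV])
  also have "\<dots> = 1 * moment (Suc k) (primitive U) + (- c) * m0"
    unfolding m0_def by (rule moment_lincomb[OF pUm wL2_moments_from[OF pE \<mu>] order_refl])
  also have "\<dots> = 0" using m0 by (simp add: c_def)
  finally have V0: "moment (Suc k) (primitive V) = 0" .
  define d where "d = (primitive ^^ Suc k) V"
  have dm: "d \<in> moments_from 1" unfolding d_def by (rule moments_from_primitive_funpow'[OF Vm])
  have "moment (Suc (Suc k)) V = 0"
    using V0 moment_primitive[OF Vm order_refl, of "Suc k"] by (simp del: of_nat_Suc)
  then have "moment 1 d = 0"
    unfolding d_def using moment_primitive_funpow[OF Vm[of 1], of 1 "Suc k"] by simp
  then have d0: "integrable halfline (\<lambda>y. y * d y)" "(\<integral>y. y * d y \<partial>halfline) = 0"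
    using moments_from_integrable[OF dm order_refl] by (simp_all add: moment_def)
  have dX: "d \<in> X_space (Suc k) \<mu>"
    by (rule X_spaceI(1)[OF has_weak_deriv_primitive[OF Vm, where k = "Suc k", folded d_def] V d0])
  have dX': "d \<in> X_space k \<mu>" using dX sub by blast
  have "has_weak_deriv k d (primitive V)"
    using has_weak_deriv_primitive[OF moments_from_primitive'[OF Vm], where k = k] by (simp add: d_def funpow_swap1)
  then have dV: "AE y in halfline. weak_deriv k d y = primitive V y"
    by (rule has_weak_deriv_unique[OF X_space_weak_deriv(1)[OF dX']])
  define S where "S = weak_deriv k (\<lambda>y. 1 * h y + (- 1) * d y)"
  have "AE y in halfline. 0 < y" by (rule AE_I2) simp
  with dV X_space_lincomb(2)[OF h dX', of 1 "- 1"]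
  have SV: "AE y in halfline. S y = 1 * (F y - primitive U y) + c * primitive E y"
    by eventually_elim (simp add: S_def F_def pV)
  have diff': "(\<lambda>y. F y - primitive U y) \<in> wL2 \<mu> (Suc k)" using diff by simp
  have "X_norm k \<mu> (\<lambda>y. 1 * h y + (- 1) * d y) = wnorm \<mu> (Suc k) (\<lambda>y. 1 * (F y - primitive U y) + c * primitive E y)"
    unfolding X_norm_eq_wnorm S_def[symmetric]
    by (rule wnorm_cong_AE[OF _ _ SV])
      (unfold S_def, rule X_space_weak_deriv(5)[OF X_space_lincomb(1)[OF h dX']], rule wL2_measurable[OF wL2_lincomb[OF diff' pE]])
  also have "\<dots> \<le> \<bar>1\<bar> * r + \<bar>c\<bar> * wnorm \<mu> (Suc k) (primitive E)"
    unfolding r_def by (rule wnorm_lincomb[OF diff' pE])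
  also have "\<dots> \<le> \<bar>1\<bar> * r + M * r / \<bar>m0\<bar> * wnorm \<mu> (Suc k) (primitive E)"
    by (intro add_left_mono mult_right_mono c wnorm_nonneg)
  also have "\<dots> = q * r" by (simp add: q_def algebra_simps)
  also have "\<dots> < \<epsilon>" using Ud q by (simp add: r_def field_simps)
  finally show thesis by (rule that[OF dX])
qed

section \<open>Energy decay for strongly continuous semigroups\<close>

section \<open>Dissipative semigroups\<close>

text \<open>The extra slope epsilon makes the inequality strict: the set A of times with phi(t) -
  epsilon t <= phi(0) is closed, and if its supremum c were below T, the right derivative at c would
  produce a later element.\<close>

lemma right_derivative_nonpos_imp_le:
  fixes \<phi> :: "real \<Rightarrow> real"
  assumes T: "0 \<le> T" and cont: "continuous_on {0..T} \<phi>"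
    and D: "\<And>t. 0 \<le> t \<Longrightarrow> t < T \<Longrightarrow> \<exists>D\<le>0. ((\<lambda>s. (\<phi> (t + s) - \<phi> t) / s) \<longlongrightarrow> D) (at_right 0)"
  shows "\<phi> T \<le> \<phi> 0"
proof -
  have "\<phi> T \<le> \<phi> 0 + \<epsilon> * T" if \<epsilon>: "0 < \<epsilon>" for \<epsilon>
  proof -
    define A where "A = {t \<in> {0..T}. \<phi> t - \<epsilon> * t \<le> \<phi> 0}"
    have "closed A"
      unfolding A_def
      by (rule continuous_on_closed_Collect_le) (intro continuous_intros cont | simp)+
    moreover have "0 \<in> A" "bdd_above A" using T by (auto simp: A_def)
    ultimately have c: "Sup A \<in> A" by (intro closed_contains_Sup) auto
    define c where "c = Sup A"
    have cA: "0 \<le> c" "c \<le> T" "\<phi> c - \<epsilon> * c \<le> \<phi> 0" using c by (auto simp: A_def c_def)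
    have "c = T"
    proof (rule ccontr)
      assume "c \<noteq> T"
      then have "c < T" using cA by simp
      then obtain D where D: "D \<le> 0" "((\<lambda>s. (\<phi> (c + s) - \<phi> c) / s) \<longlongrightarrow> D) (at_right 0)"
        using D cA by blast
      have "eventually (\<lambda>s. (\<phi> (c + s) - \<phi> c) / s < \<epsilon>) (at_right 0)"
        using D \<epsilon> by (intro order_tendstoD(2)[OF D(2)]) simp
      moreover have "eventually (\<lambda>s. s < T - c) (at_right 0)"
        using \<open>c < T\<close> by (auto simp: eventually_at_right_field intro!: exI[of _ "T - c"])
      moreover have "eventually (\<lambda>s::real. 0 < s) (at_right 0)"
        by (rule eventually_at_right_less)
      ultimately have "eventually (\<lambda>s. 0 < s \<and> s < T - c \<and> (\<phi> (c + s) - \<phi> c) / s < \<epsilon>) (at_right 0)"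
        by eventually_elim auto
      then obtain s where s: "0 < s" "s < T - c" "(\<phi> (c + s) - \<phi> c) / s < \<epsilon>"
        using eventually_happens'[OF trivial_limit_at_right_real] by blast
      then have "\<phi> (c + s) - \<phi> c < \<epsilon> * s" by (simp add: divide_less_eq mult.commute)
      then have "c + s \<in> A" using s cA by (simp add: A_def algebra_simps)
      then have "c + s \<le> c" unfolding c_def using \<open>bdd_above A\<close> by (intro cSup_upper)
      then show False using s by simp
    qed
    then show ?thesis using cA by simp
  qed
  note le = this
  show ?thesis
  proof (cases "T = 0")
    case False
    show ?thesis
    proof (rule field_le_epsilon)
      fix e :: real assume "0 < e"
      then show "\<phi> T \<le> \<phi> 0 + e" using le[of "e / T"] False T by simp
    qed
  qed simp
qed

text \<open>
  A right-continuous curve in a pseudometric space has points of continuity: shrink intervals on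
  which the curve oscillates little. This replaces the uniform boundedness principle, so that no
  completeness of the space is needed.
\<close>

lemma right_continuous_imp_continuity_point:
  fixes d :: "real \<Rightarrow> real \<Rightarrow> real"
  assumes sym: "\<And>s t. d s t = d t s"
    and tri: "\<And>r s t. 0 \<le> r \<Longrightarrow> 0 \<le> s \<Longrightarrow> 0 \<le> t \<Longrightarrow> d r t \<le> d r s + d s t"
    and right: "\<And>t e. 0 \<le> t \<Longrightarrow> 0 < e \<Longrightarrow> \<exists>\<eta>>0. \<forall>s. 0 < s \<longrightarrow> s < \<eta> \<longrightarrow> d (t + s) t < e"
    and b: "0 < b"
  obtains c where "0 < c" "c < b" "\<And>e. 0 < e \<Longrightarrow> \<exists>\<eta>>0. \<forall>s. \<bar>s - c\<bar> < \<eta> \<longrightarrow> d s c < e"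
proof -
  define osc where "osc = (\<lambda>p (e::real). \<forall>s\<in>{fst p..snd p}. \<forall>s'\<in>{fst p..snd p}. d s s' < e)"
  have step: "\<exists>q. (0 \<le> fst q \<and> fst q < snd q) \<and> (fst p < fst q \<and> snd q < snd p \<and> osc q (2 / real (Suc n)))"
    if p: "0 \<le> fst p \<and> fst p < snd p" for p :: "real \<times> real" and n
  proof -
    \<comment> \<open>Right continuity at the midpoint controls the curve only to the right of it,
      so the new interval is placed strictly to the right of t.\<close>
    define t where "t = (fst p + snd p) / 2"
    have t: "fst p < t" "t < snd p" "0 \<le> t" using p by (auto simp: t_def)
    obtain \<eta> where \<eta>: "0 < \<eta>" "\<And>s. 0 < s \<Longrightarrow> s < \<eta> \<Longrightarrow> d (t + s) t < 1 / real (Suc n)"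
      using right[of t "1 / real (Suc n)"] t by auto
    define m where "m = min \<eta> (snd p - t)"
    have m: "0 < m" "m \<le> \<eta>" "m \<le> snd p - t" using \<eta> t by (auto simp: m_def)
    define q where "q = (t + m / 3, t + 2 * m / 3)"
    have "osc q (2 / real (Suc n))"
      unfolding osc_def
    proof (intro ballI)
      fix s s' assume s: "s \<in> {fst q..snd q}" "s' \<in> {fst q..snd q}"
      have "d s t < 1 / real (Suc n)" "d s' t < 1 / real (Suc n)"
        using \<eta>(2)[of "s - t"] \<eta>(2)[of "s' - t"] s m by (auto simp: q_def)
      moreover have "d s s' \<le> d s t + d t s'" using s m t by (intro tri) (auto simp: q_def)
      ultimately show "d s s' < 2 / real (Suc n)" using sym[of t s'] by simp
    qed
    then show ?thesis using t m p by (intro exI[of _ q]) (auto simp: q_def)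
  qed
  obtain P where P: "\<And>n. 0 \<le> fst (P n) \<and> fst (P n) < snd (P n)" and P0: "P 0 = (0, b)"
    and PS: "\<And>n. fst (P n) < fst (P (Suc n)) \<and> snd (P (Suc n)) < snd (P n) \<and> osc (P (Suc n)) (2 / real (Suc n))"
  proof -
    have "\<exists>P. (\<forall>n. 0 \<le> fst (P n) \<and> fst (P n) < snd (P n)) \<and>
        (\<forall>n. fst (P n) < fst (P (Suc n)) \<and> snd (P (Suc n)) < snd (P n) \<and> osc (P (Suc n)) (2 / real (Suc n))) \<and> P 0 = (0, b)"
    proof -
      define f where "f = (\<lambda>p n. SOME q. (0 \<le> fst q \<and> fst q < snd q) \<and> (fst p < fst q \<and> snd q < snd p \<and> osc q (2 / real (Suc n))))"
      define P where "P = rec_nat (0::real, b) (\<lambda>n p. f p n)"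
      have ok: "0 \<le> fst (P n) \<and> fst (P n) < snd (P n)" for n
      proof (induction n)
        case (Suc n)
        then show ?case using someI_ex[OF step[OF Suc, of n]] by (simp add: P_def f_def)
      qed (simp add: P_def b)
      have "fst (P n) < fst (P (Suc n)) \<and> snd (P (Suc n)) < snd (P n) \<and> osc (P (Suc n)) (2 / real (Suc n))" for n
        using someI_ex[OF step[OF ok, of n n]] by (simp add: P_def f_def)
      then show ?thesis using ok by (intro exI[of _ P]) (simp add: P_def)
    qed
    then show ?thesis using that by blast
  qed
  have inc: "fst (P n) \<le> fst (P m)" "snd (P m) \<le> snd (P n)" if "n \<le> m" for n m
    using lift_Suc_mono_le[of "\<lambda>n. fst (P n)", OF less_imp_le that]
      lift_Suc_antimono_le[of "\<lambda>n. snd (P n)", OF less_imp_le that] PS by blast+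
  have below: "fst (P n) \<le> snd (P m)" for n m
    using inc[of n "max n m"] inc[of m "max n m"] P[of "max n m"] by auto
  define c where "c = (SUP n. fst (P n))"
  have bdd: "bdd_above (range (\<lambda>n. fst (P n)))" using below[of _ 0] by (intro bdd_aboveI[of _ "snd (P 0)"]) auto
  have l: "fst (P n) \<le> c" for n unfolding c_def by (rule cSUP_upper[OF _ bdd]) simp
  have u: "c \<le> snd (P n)" for n unfolding c_def by (rule cSUP_least) (auto intro: below)
  \<comment> \<open>The nesting is strict on both sides, so c is interior to every interval and has
    two-sided neighbourhoods of small oscillation.\<close>
  have in_strict: "fst (P n) < c" "c < snd (P n)" for n
    using PS[of n] l[of "Suc n"] u[of "Suc n"] by auto
  have "\<exists>\<eta>>0. \<forall>s. \<bar>s - c\<bar> < \<eta> \<longrightarrow> d s c < e" if e: "0 < e" for e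
  proof -
    obtain n where n: "2 / e < real n" using reals_Archimedean2 by blast
    then have "2 / e < real (Suc n)" by simp
    then have le: "2 / real (Suc n) < e" using e by (simp add: field_simps)
    define \<eta> where "\<eta> = min (c - fst (P (Suc n))) (snd (P (Suc n)) - c)"
    have "0 < \<eta>" using in_strict by (simp add: \<eta>_def)
    moreover have "d s c < e" if "\<bar>s - c\<bar> < \<eta>" for s
    proof -
      have "s \<in> {fst (P (Suc n))..snd (P (Suc n))}" "c \<in> {fst (P (Suc n))..snd (P (Suc n))}"
        using that in_strict[of "Suc n"] by (auto simp: \<eta>_def)
      then have "d s c < 2 / real (Suc n)" using PS[of n] unfolding osc_def by blast
      with le show ?thesis by simp
    qed
    ultimately show ?thesis by blast
  qed
  moreover have "0 < c" "c < b" using in_strict[of 0] P0 by auto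
  ultimately show thesis using that by blast
qed

lemma ae_eq_refl: "f \<approx>\<^sub>+ f"
  by (simp add: ae_eq_def)

lemma ae_eq_sym: "f \<approx>\<^sub>+ g \<Longrightarrow> g \<approx>\<^sub>+ f"
  unfolding ae_eq_def by (erule AE_mp) simp

lemma ae_eq_trans: "f \<approx>\<^sub>+ g \<Longrightarrow> g \<approx>\<^sub>+ h \<Longrightarrow> f \<approx>\<^sub>+ h"
  unfolding ae_eq_halfline by (auto elim: AE_mp)

lemma ae_eq_lincomb: "f \<approx>\<^sub>+ f' \<Longrightarrow> g \<approx>\<^sub>+ g' \<Longrightarrow> (\<lambda>y. a * f y + b * g y) \<approx>\<^sub>+ (\<lambda>y. a * f' y + b * g' y)"
  unfolding ae_eq_halfline by (auto elim: AE_mp)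

text \<open>A seminormed space of representatives, with almost everywhere equality in place of a
  quotient.\<close>

locale function_space =
  fixes X :: "(real \<Rightarrow> real) set" and N :: "(real \<Rightarrow> real) \<Rightarrow> real"
  assumes lincomb: "f \<in> X \<Longrightarrow> g \<in> X \<Longrightarrow> (\<lambda>y. a * f y + b * g y) \<in> X"
    and N_nonneg: "0 \<le> N f"
    and N_lincomb: "f \<in> X \<Longrightarrow> g \<in> X \<Longrightarrow> N (\<lambda>y. a * f y + b * g y) \<le> \<bar>a\<bar> * N f + \<bar>b\<bar> * N g"
    and N_cong: "f \<in> X \<Longrightarrow> g \<in> X \<Longrightarrow> f \<approx>\<^sub>+ g \<Longrightarrow> N f = N g"
begin

lemma diff_in: "f \<in> X \<Longrightarrow> g \<in> X \<Longrightarrow> (\<lambda>y. f y - g y) \<in> X"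
  using lincomb[of f g 1 "- 1"] by simp

lemma quotient_in: "f \<in> X \<Longrightarrow> g \<in> X \<Longrightarrow> (\<lambda>y. (f y - g y) / t) \<in> X"
  using lincomb[of f g "1 / t" "- (1 / t)"] by (simp add: diff_divide_distrib)

lemma N_diff_commute: "f \<in> X \<Longrightarrow> g \<in> X \<Longrightarrow> N (\<lambda>y. f y - g y) = N (\<lambda>y. g y - f y)"
proof -
  have "N (\<lambda>y. f y - g y) \<le> N (\<lambda>y. g y - f y)" if "f \<in> X" "g \<in> X" for f g
    using N_lincomb[OF diff_in[OF that(2,1)] that(1), of "- 1" 0] by simp
  then show "f \<in> X \<Longrightarrow> g \<in> X \<Longrightarrow> ?thesis" by (blast intro: antisym)
qed

lemma N_triangle:
  assumes "f \<in> X" "g \<in> X" "h \<in> X"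
  shows "N (\<lambda>y. f y - h y) \<le> N (\<lambda>y. f y - g y) + N (\<lambda>y. g y - h y)"
  using N_lincomb[OF diff_in[OF assms(1,2)] diff_in[OF assms(2,3)], of 1 1] by simp

lemma N_diff_cong:
  assumes "f \<in> X" "f' \<in> X" "g \<in> X" "g' \<in> X" "f \<approx>\<^sub>+ f'" "g \<approx>\<^sub>+ g'"
  shows "N (\<lambda>y. f y - g y) = N (\<lambda>y. f' y - g' y)"
  using N_cong[OF lincomb[OF assms(1,3)] lincomb[OF assms(2,4)] ae_eq_lincomb[OF assms(5,6)], of 1 "- 1"] by simp

end

locale C0_space = function_space X N for X N +
  fixes S
  assumes C0: "C0_semigroup X N S"
begin

lemma S_in: "0 \<le> t \<Longrightarrow> h \<in> X \<Longrightarrow> S t h \<in> X"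
  and S_lincomb: "0 \<le> t \<Longrightarrow> f \<in> X \<Longrightarrow> g \<in> X \<Longrightarrow> S t (\<lambda>y. a * f y + b * g y) \<approx>\<^sub>+ (\<lambda>y. a * S t f y + b * S t g y)"
  and S_0: "h \<in> X \<Longrightarrow> S 0 h \<approx>\<^sub>+ h"
  and S_add: "0 \<le> s \<Longrightarrow> 0 \<le> t \<Longrightarrow> h \<in> X \<Longrightarrow> S (s + t) h \<approx>\<^sub>+ S s (S t h)"
  and S_tendsto: "h \<in> X \<Longrightarrow> ((\<lambda>t. N (\<lambda>y. S t h y - h y)) \<longlongrightarrow> 0) (at_right 0)"
  subgoal using C0[unfolded C0_semigroup_def, THEN conjunct1] by blast
  subgoal using C0[unfolded C0_semigroup_def, THEN conjunct2, THEN conjunct2, THEN conjunct1] by blast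
  subgoal using C0[unfolded C0_semigroup_def, THEN conjunct2, THEN conjunct2, THEN conjunct2, THEN conjunct2, THEN conjunct1] by blast
  subgoal using C0[unfolded C0_semigroup_def, THEN conjunct2, THEN conjunct2, THEN conjunct2, THEN conjunct2, THEN conjunct2, THEN conjunct1] by blast
  subgoal using C0[unfolded C0_semigroup_def, THEN conjunct2, THEN conjunct2, THEN conjunct2, THEN conjunct2, THEN conjunct2, THEN conjunct2] by blast
  done

text \<open>A bound M might be negative if N vanishes on X; the maximum with 0 makes it usable as a
  factor in monotone estimates.\<close>

lemma S_bound:
  assumes "0 \<le> t"
  obtains M where "0 \<le> M" "\<And>h. h \<in> X \<Longrightarrow> N (S t h) \<le> M * N h"
proof -
  from assms obtain M where M: "\<And>h. h \<in> X \<Longrightarrow> N (S t h) \<le> M * N h"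
    using C0[unfolded C0_semigroup_def, THEN conjunct2, THEN conjunct2, THEN conjunct2, THEN conjunct1] by blast
  have "N (S t h) \<le> max 0 M * N h" if "h \<in> X" for h
    by (rule order_trans[OF M[OF that] mult_right_mono[OF _ N_nonneg]]) simp
  then show thesis by (intro that[of "max 0 M"]) auto
qed

lemma S_diff:
  assumes t: "0 \<le> t" and f: "f \<in> X" and g: "g \<in> X"
  shows "N (\<lambda>y. S t f y - S t g y) = N (S t (\<lambda>y. f y - g y))"
proof -
  have "S t (\<lambda>y. 1 * f y + (- 1) * g y) \<approx>\<^sub>+ (\<lambda>y. 1 * S t f y + (- 1) * S t g y)"
    by (rule S_lincomb[OF t f g])
  then show ?thesis
    using N_cong[of "S t (\<lambda>y. f y - g y)" "\<lambda>y. S t f y - S t g y"] S_in[OF t] diff_in f g by simp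
qed

lemma orbit_right_continuous:
  assumes h: "h \<in> X" and t: "0 \<le> t"
  shows "((\<lambda>s. N (\<lambda>y. S (t + s) h y - S t h y)) \<longlongrightarrow> 0) (at_right 0)"
proof (rule Lim_transform_eventually[OF S_tendsto[OF S_in[OF t h]]])
  have "eventually (\<lambda>s::real. 0 < s) (at_right 0)" by (rule eventually_at_right_less)
  then show "eventually (\<lambda>s. N (\<lambda>y. S s (S t h) y - S t h y) = N (\<lambda>y. S (t + s) h y - S t h y)) (at_right 0)"
  proof eventually_elim
    case (elim s)
    then have "S (s + t) h \<approx>\<^sub>+ S s (S t h)" using t h by (intro S_add) auto
    then show ?case
      using elim t h by (intro N_diff_cong S_in) (auto simp: add.commute intro: ae_eq_sym ae_eq_refl)
  qed
qed

text \<open>Take a continuity point c in (0, t). The operator \<open>S (t - c)\<close> maps the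
  orbit values at s - t + c and at c to those at s and t, so boundedness of this single operator
  transports continuity from c to t.\<close>

lemma orbit_continuous:
  assumes h: "h \<in> X" and t: "0 < t"
  shows "((\<lambda>s. N (\<lambda>y. S s h y - S t h y)) \<longlongrightarrow> 0) (at t)"
proof -
  \<comment> \<open>The truncation at 0 makes d total in both times, although \<open>S\<close> is
    controlled only from time 0 on.\<close>
  define d where "d = (\<lambda>s t. N (\<lambda>y. S (max 0 s) h y - S (max 0 t) h y))"
  have in_X: "S (max 0 s) h \<in> X" for s by (rule S_in[OF _ h]) simp
  obtain c where c: "0 < c" "c < t" "\<And>e. 0 < e \<Longrightarrow> \<exists>\<eta>>0. \<forall>s. \<bar>s - c\<bar> < \<eta> \<longrightarrow> d s c < e"
  proof (rule right_continuous_imp_continuity_point[of d t])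
    show "d s t = d t s" for s t unfolding d_def by (rule N_diff_commute[OF in_X in_X])
    show "d r t \<le> d r s + d s t" for r s t unfolding d_def by (rule N_triangle[OF in_X in_X in_X])
    show "\<exists>\<eta>>0. \<forall>s. 0 < s \<longrightarrow> s < \<eta> \<longrightarrow> d (t + s) t < e" if "0 \<le> t" "0 < e" for t e
    proof -
      have "eventually (\<lambda>s. N (\<lambda>y. S (t + s) h y - S t h y) < e) (at_right 0)"
        by (rule order_tendstoD(2)[OF orbit_right_continuous[OF h that(1)] that(2)])
      then obtain \<eta> where "0 < \<eta>" "\<And>s. 0 < s \<Longrightarrow> s < \<eta> \<Longrightarrow> N (\<lambda>y. S (t + s) h y - S t h y) < e"
        by (auto simp: eventually_at_right_field)
      then show ?thesis using that(1) by (intro exI[of _ \<eta>]) (auto simp: d_def max_def)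
    qed
  qed (use t in auto)
  obtain M where M: "0 \<le> M" "\<And>h. h \<in> X \<Longrightarrow> N (S (t - c) h) \<le> M * N h"
    using S_bound[of "t - c"] c by auto
  have bound: "N (\<lambda>y. S s h y - S t h y) \<le> M * d (s - t + c) c" if "t - c < s" for s
  proof -
    have sc: "0 \<le> s - t + c" using that by simp
    have "S ((t - c) + (s - t + c)) h \<approx>\<^sub>+ S (t - c) (S (s - t + c) h)" "S ((t - c) + c) h \<approx>\<^sub>+ S (t - c) (S c h)"
      using c sc h by (intro S_add; simp)+
    then have "N (\<lambda>y. S s h y - S t h y) = N (\<lambda>y. S (t - c) (S (s - t + c) h) y - S (t - c) (S c h) y)"
      using that c sc h t by (intro N_diff_cong S_in) auto
    also have "\<dots> = N (S (t - c) (\<lambda>y. S (s - t + c) h y - S c h y))"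
      using c sc h by (intro S_diff S_in) auto
    also have "\<dots> \<le> M * N (\<lambda>y. S (s - t + c) h y - S c h y)"
      using c sc h by (intro M(2) diff_in S_in) auto
    finally show ?thesis using sc c by (simp add: d_def max_absorb2)
  qed
  have "((\<lambda>s. M * d (s - t + c) c) \<longlongrightarrow> M * 0) (at t)"
  proof (intro tendsto_intros)
    show "((\<lambda>s. d (s - t + c) c) \<longlongrightarrow> 0) (at t)"
    proof (rule tendstoI)
      fix e :: real assume "0 < e"
      then obtain \<eta> where \<eta>: "0 < \<eta>" "\<And>s. \<bar>s - c\<bar> < \<eta> \<Longrightarrow> d s c < e" using c(3) by blast
      show "eventually (\<lambda>s. dist (d (s - t + c) c) 0 < e) (at t)"
        unfolding eventually_at
        by (intro exI[of _ \<eta>]) (use \<eta> N_nonneg in \<open>auto simp: dist_real_def d_def abs_of_nonneg\<close>)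
    qed
  qed
  then have lim: "((\<lambda>s. M * d (s - t + c) c) \<longlongrightarrow> 0) (at t)" by simp
  have "eventually (\<lambda>s. t - c < s) (at t)"
    using c eventually_at_in_open'[of "{t - c<..}" t] by (auto elim: eventually_mono)
  then show ?thesis
    by (intro tendsto_sandwich[OF _ _ tendsto_const lim]) (auto simp: N_nonneg elim!: eventually_mono intro: bound)
qed

end

text \<open>The last assumption says that A + 1 is dissipative for the form B; the bound of B by N
  lets limits in N pass through B.\<close>

locale dissipative_semigroup = function_space X N for X N +
  fixes D A S B C
  assumes gen: "generates_semigroup X N D A S"
    and B_lincomb: "f \<in> X \<Longrightarrow> g \<in> X \<Longrightarrow> h \<in> X \<Longrightarrow> B (\<lambda>y. a * f y + b * g y) h = a * B f h + b * B g h"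
    and B_commute: "B f g = B g f"
    and B_cong: "f \<in> X \<Longrightarrow> f' \<in> X \<Longrightarrow> f \<approx>\<^sub>+ f' \<Longrightarrow> g \<in> X \<Longrightarrow> B f g = B f' g"
    and B_bound: "f \<in> X \<Longrightarrow> g \<in> X \<Longrightarrow> \<bar>B f g\<bar> \<le> C * N f * N g"
    and C_nonneg: "0 \<le> C"
    and dissipative: "h \<in> D \<Longrightarrow> h \<in> X \<Longrightarrow> A h \<in> X \<Longrightarrow> B h (A h) \<le> - B h h"
begin

sublocale C0_space X N S
  by standard (use gen in \<open>simp add: generates_semigroup_def\<close>)

lemma D_in: "h \<in> D \<Longrightarrow> h \<in> X"
  and A_in: "h \<in> D \<Longrightarrow> A h \<in> X"
  and generator_iff: "h \<in> X \<Longrightarrow> f \<in> X \<Longrightarrow>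
    ((\<lambda>t. N (\<lambda>y. (S t h y - h y) / t - f y)) \<longlongrightarrow> 0) (at_right 0) \<longleftrightarrow> h \<in> D \<and> f \<approx>\<^sub>+ A h"
  using gen unfolding generates_semigroup_def by blast+

text \<open>\<open>S t\<close> is bounded and commutes with the difference quotient at 0, so the
  quotient at \<open>S t h\<close> converges to \<open>S t (A h)\<close>. As the generator is
  characterized by an equivalence, this convergence places \<open>S t h\<close> in the domain, and
  the limit can be restated with \<open>A (S t h)\<close>.\<close>

lemma orbit_derivative:
  assumes h: "h \<in> D" and t: "0 \<le> t"
  shows "S t h \<in> D"
    and "((\<lambda>s. N (\<lambda>y. (S (t + s) h y - S t h y) / s - A (S t h) y)) \<longlongrightarrow> 0) (at_right 0)"
proof -
  have hX: "h \<in> X" and AX: "A h \<in> X" using D_in[OF h] A_in[OF h] by auto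
  have uX: "S t h \<in> X" by (rule S_in[OF t hX])
  have fX: "S t (A h) \<in> X" by (rule S_in[OF t AX])
  obtain M where M: "0 \<le> M" "\<And>h. h \<in> X \<Longrightarrow> N (S t h) \<le> M * N h" using S_bound[OF t] by blast
  have "((\<lambda>s. N (\<lambda>y. (S s h y - h y) / s - A h y)) \<longlongrightarrow> 0) (at_right 0)"
    using generator_iff[OF hX AX] h ae_eq_refl by blast
  then have "((\<lambda>s. M * N (\<lambda>y. (S s h y - h y) / s - A h y)) \<longlongrightarrow> M * 0) (at_right 0)"
    by (intro tendsto_intros)
  then have lim: "((\<lambda>s. M * N (\<lambda>y. (S s h y - h y) / s - A h y)) \<longlongrightarrow> 0) (at_right 0)" by simp
  have bound: "N (\<lambda>y. (S s (S t h) y - S t h y) / s - S t (A h) y) \<le> M * N (\<lambda>y. (S s h y - h y) / s - A h y)"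
    if s: "0 < s" for s
  proof -
    have sX: "S s h \<in> X" "S s (S t h) \<in> X" "S t (S s h) \<in> X"
      using s t hX by (auto intro!: S_in)
    have qX: "(\<lambda>y. (S s h y - h y) / s) \<in> X" by (rule quotient_in[OF sX(1) hX])
    have "S s (S t h) \<approx>\<^sub>+ S t (S s h)"
      using S_add[of s t h] S_add[of t s h] s t hX by (auto simp: add.commute intro: ae_eq_trans ae_eq_sym)
    then have "(\<lambda>y. (1 / s) * S s (S t h) y + (- (1 / s)) * S t h y) \<approx>\<^sub>+ (\<lambda>y. (1 / s) * S t (S s h) y + (- (1 / s)) * S t h y)"
      by (intro ae_eq_lincomb ae_eq_refl)
    also have "(\<lambda>y. (1 / s) * S t (S s h) y + (- (1 / s)) * S t h y) \<approx>\<^sub>+ S t (\<lambda>y. (1 / s) * S s h y + (- (1 / s)) * h y)"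
      by (rule ae_eq_sym[OF S_lincomb[OF t sX(1) hX]])
    finally (ae_eq_trans) have "(\<lambda>y. (S s (S t h) y - S t h y) / s) \<approx>\<^sub>+ S t (\<lambda>y. (S s h y - h y) / s)"
      by (simp add: diff_divide_distrib)
    then have "N (\<lambda>y. (S s (S t h) y - S t h y) / s - S t (A h) y) = N (\<lambda>y. S t (\<lambda>y. (S s h y - h y) / s) y - S t (A h) y)"
      by (intro N_diff_cong quotient_in sX uX S_in[OF t qX] fX ae_eq_refl)
    also have "\<dots> = N (S t (\<lambda>y. (S s h y - h y) / s - A h y))" by (rule S_diff[OF t qX AX])
    also have "\<dots> \<le> M * N (\<lambda>y. (S s h y - h y) / s - A h y)" by (rule M(2)[OF diff_in[OF qX AX]])
    finally show ?thesis .
  qed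
  have pos: "eventually (\<lambda>s::real. 0 < s) (at_right 0)" by (rule eventually_at_right_less)
  have "((\<lambda>s. N (\<lambda>y. (S s (S t h) y - S t h y) / s - S t (A h) y)) \<longlongrightarrow> 0) (at_right 0)"
    by (rule tendsto_sandwich[OF _ _ tendsto_const lim]) (use pos in \<open>auto simp: N_nonneg elim!: eventually_mono intro: bound\<close>)
  then show uD: "S t h \<in> D" using generator_iff[OF uX fX] by blast
  have AuX: "A (S t h) \<in> X" by (rule A_in[OF uD])
  have "((\<lambda>s. N (\<lambda>y. (S s (S t h) y - S t h y) / s - A (S t h) y)) \<longlongrightarrow> 0) (at_right 0)"
    using generator_iff[OF uX AuX] uD ae_eq_refl by blast
  then show "((\<lambda>s. N (\<lambda>y. (S (t + s) h y - S t h y) / s - A (S t h) y)) \<longlongrightarrow> 0) (at_right 0)"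
  proof (rule Lim_transform_eventually)
    show "eventually (\<lambda>s. N (\<lambda>y. (S s (S t h) y - S t h y) / s - A (S t h) y)
        = N (\<lambda>y. (S (t + s) h y - S t h y) / s - A (S t h) y)) (at_right 0)"
      using pos
    proof eventually_elim
      case (elim s)
      have sX: "S s (S t h) \<in> X" "S (t + s) h \<in> X" using elim t hX by (auto intro!: S_in)
      have "S s (S t h) \<approx>\<^sub>+ S (t + s) h"
        using S_add[of s t h] elim t hX by (auto simp: add.commute intro: ae_eq_sym)
      then have "(\<lambda>y. (1 / s) * S s (S t h) y + (- (1 / s)) * S t h y) \<approx>\<^sub>+ (\<lambda>y. (1 / s) * S (t + s) h y + (- (1 / s)) * S t h y)"
        by (intro ae_eq_lincomb ae_eq_refl)
      then show ?case
        by (intro N_diff_cong quotient_in sX uX AuX ae_eq_refl) (simp add: diff_divide_distrib)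
    qed
  qed
qed

lemma B_diff_left: "f \<in> X \<Longrightarrow> g \<in> X \<Longrightarrow> h \<in> X \<Longrightarrow> B (\<lambda>y. f y - g y) h = B f h - B g h"
  using B_lincomb[of f g h 1 "- 1"] by simp

text \<open>Expansion around g: the linear term gives continuity and derivative, the quadratic term
  is the remainder.\<close>

lemma B_square_diff:
  assumes f: "f \<in> X" and g: "g \<in> X"
  shows "B f f - B g g = 2 * B (\<lambda>y. f y - g y) g + B (\<lambda>y. f y - g y) (\<lambda>y. f y - g y)"
proof -
  have d: "(\<lambda>y. f y - g y) \<in> X" by (rule diff_in[OF f g])
  show ?thesis
    unfolding B_diff_left[OF f g d] B_diff_left[OF f g g]
    by (subst (1 2) B_commute[of _ "\<lambda>y. f y - g y"]) (simp add: B_diff_left[OF f g] f g B_commute[of f g])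
qed

lemma B_square_tendsto:
  assumes lim: "((\<lambda>s. N (\<lambda>y. S s h y - S t h y)) \<longlongrightarrow> 0) F" and h: "h \<in> X" and t: "0 \<le> t"
    and ev: "eventually (\<lambda>s. 0 \<le> s) F"
  shows "((\<lambda>s. B (S s h) (S s h)) \<longlongrightarrow> B (S t h) (S t h)) F"
proof -
  let ?e = "\<lambda>s. 2 * (C * N (\<lambda>y. S s h y - S t h y) * N (S t h)) + C * N (\<lambda>y. S s h y - S t h y) * N (\<lambda>y. S s h y - S t h y)"
  have "(?e \<longlongrightarrow> 2 * (C * 0 * N (S t h)) + C * 0 * 0) F"
    by (intro tendsto_intros lim)
  then have e: "(?e \<longlongrightarrow> 0) F" by simp
  have "eventually (\<lambda>s. norm (B (S s h) (S s h) - B (S t h) (S t h)) \<le> ?e s) F"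
    using ev
  proof eventually_elim
    case (elim s)
    have X: "S s h \<in> X" "S t h \<in> X" using elim t h by (auto intro: S_in)
    have d: "(\<lambda>y. S s h y - S t h y) \<in> X" by (rule diff_in[OF X])
    show ?case
      unfolding B_square_diff[OF X] real_norm_def
      using B_bound[OF d X(2)] B_bound[OF d d] by linarith
  qed
  then have "((\<lambda>s. B (S s h) (S s h) - B (S t h) (S t h)) \<longlongrightarrow> 0) F"
    by (rule Lim_null_comparison[OF _ e])
  then show ?thesis by (rule LIM_zero_cancel)
qed

text \<open>With u the orbit at t and q the difference quotient, the orbit at t + s is u + s q, and
  the quotient of the squares is 2 B(q, u) + s B(q, q); boundedness of B gives the limit.\<close>

lemma B_square_derivative:
  assumes h: "h \<in> D" and t: "0 \<le> t"
  shows "((\<lambda>s. (B (S (t + s) h) (S (t + s) h) - B (S t h) (S t h)) / s) \<longlongrightarrow> 2 * B (S t h) (A (S t h))) (at_right 0)"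
proof -
  define u where "u = S t h"
  have hX: "h \<in> X" by (rule D_in[OF h])
  have uD: "u \<in> D" unfolding u_def by (rule orbit_derivative(1)[OF h t])
  have uX: "u \<in> X" and AX: "A u \<in> X" using D_in[OF uD] A_in[OF uD] by auto
  define q where "q = (\<lambda>s y. (S (t + s) h y - u y) / s)"
  define r where "r = (\<lambda>s. N (\<lambda>y. q s y - A u y))"
  have r: "(r \<longlongrightarrow> 0) (at_right 0)"
    using orbit_derivative(2)[OF h t] by (simp add: r_def q_def u_def)
  let ?e = "\<lambda>s. 2 * (C * r s * N u) + \<bar>s\<bar> * (C * (r s + N (A u)) * (r s + N (A u)))"
  have id: "((\<lambda>s::real. s) \<longlongrightarrow> 0) (at_right 0)" by (rule tendsto_ident_at)
  have "(?e \<longlongrightarrow> 2 * (C * 0 * N u) + \<bar>0\<bar> * (C * (0 + N (A u)) * (0 + N (A u)))) (at_right 0)"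
    by (intro tendsto_intros r id)
  then have e: "(?e \<longlongrightarrow> 0) (at_right 0)" by simp
  have "eventually (\<lambda>s::real. 0 < s) (at_right 0)" by (rule eventually_at_right_less)
  then have "eventually (\<lambda>s. norm ((B (S (t + s) h) (S (t + s) h) - B u u) / s - 2 * B u (A u)) \<le> ?e s) (at_right 0)"
  proof eventually_elim
    case (elim s)
    have sX: "S (t + s) h \<in> X" using elim t hX by (auto intro: S_in)
    have qX: "q s \<in> X" unfolding q_def by (rule quotient_in[OF sX uX])
    have dX: "(\<lambda>y. q s y - A u y) \<in> X" by (rule diff_in[OF qX AX])
    have eq: "(\<lambda>y. S (t + s) h y - u y) = (\<lambda>y. s * q s y + 0 * q s y)"
      using elim by (simp add: q_def)
    have 1: "B (\<lambda>y. S (t + s) h y - u y) f = s * B (q s) f" if "f \<in> X" for f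
      unfolding eq using B_lincomb[OF qX qX that, of s 0] by simp
    have "B (S (t + s) h) (S (t + s) h) - B u u = 2 * (s * B (q s) u) + s * (s * B (q s) (q s))"
      unfolding B_square_diff[OF sX uX] 1[OF uX] 1[OF diff_in[OF sX uX]]
      by (subst B_commute[of "q s"]) (simp add: 1[OF qX])
    then have "(B (S (t + s) h) (S (t + s) h) - B u u) / s = 2 * B (q s) u + s * B (q s) (q s)"
      using elim by (simp add: add_divide_distrib)
    moreover have "B (\<lambda>y. q s y - A u y) u = B (q s) u - B u (A u)"
      using B_diff_left[OF qX AX uX] B_commute[of u "A u"] by simp
    ultimately have split: "(B (S (t + s) h) (S (t + s) h) - B u u) / s - 2 * B u (A u)
        = 2 * B (\<lambda>y. q s y - A u y) u + s * B (q s) (q s)" by simp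
    have "\<bar>B (\<lambda>y. q s y - A u y) u\<bar> \<le> C * r s * N u"
      unfolding r_def by (rule B_bound[OF dX uX])
    moreover have "\<bar>s * B (q s) (q s)\<bar> \<le> \<bar>s\<bar> * (C * (r s + N (A u)) * (r s + N (A u)))"
    proof -
      have Nq: "N (q s) \<le> r s + N (A u)"
        using N_lincomb[OF dX AX, of 1 1] by (simp add: r_def)
      have "\<bar>B (q s) (q s)\<bar> \<le> C * N (q s) * N (q s)" by (rule B_bound[OF qX qX])
      also have "\<dots> \<le> C * (r s + N (A u)) * (r s + N (A u))"
        using C_nonneg Nq N_nonneg[of "q s"] by (intro mult_mono mult_nonneg_nonneg) auto
      finally show ?thesis unfolding abs_mult by (rule mult_left_mono) simp
    qed
    ultimately show ?case unfolding split real_norm_def by linarith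
  qed
  then have "((\<lambda>s. (B (S (t + s) h) (S (t + s) h) - B u u) / s - 2 * B u (A u)) \<longlongrightarrow> 0) (at_right 0)"
    by (rule Lim_null_comparison[OF _ e])
  then show ?thesis unfolding u_def by (rule LIM_zero_cancel)
qed

text \<open>Gronwall for the square: the product of exp (2 t) with B has nonpositive right
  derivative along the orbit. The generator provides right derivatives only, so two-sided continuity
  is taken from \<open>orbit_continuous\<close>.\<close>

lemma B_decay:
  assumes h: "h \<in> D" and T: "0 \<le> T"
  shows "B (S T h) (S T h) \<le> exp (- 2 * T) * B h h"
proof -
  have hX: "h \<in> X" by (rule D_in[OF h])
  define b where "b = (\<lambda>t::real. B (S t h) (S t h))"
  define \<phi> where "\<phi> = (\<lambda>t::real. exp (2 * t) * b t)"
  have "\<phi> T \<le> \<phi> 0"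
  proof (rule right_derivative_nonpos_imp_le[OF T])
    have "continuous_on {0..T} b"
      unfolding continuous_on_def
    proof
      fix t assume t: "t \<in> {0..T}"
      show "(b \<longlongrightarrow> b t) (at t within {0..T})"
      \<comment> \<open>At the left endpoint of \<open>{0..T}\<close> only the limit from the right
        is asked for, and there right continuity of the orbit is enough.\<close>
      proof (cases "t = 0")
        case True
        have r: "((\<lambda>s. N (\<lambda>y. S s h y - S 0 h y)) \<longlongrightarrow> 0) (at_right 0)"
          using orbit_right_continuous[OF hX order_refl] by simp
        have pos: "eventually (\<lambda>s::real. 0 \<le> s) (at_right 0)"
          using eventually_at_right_less[of "0::real"] by (rule eventually_mono) simp
        have "(b \<longlongrightarrow> b 0) (at_right 0)"
          unfolding b_def by (rule B_square_tendsto[OF r hX order_refl pos])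
        then have "(b \<longlongrightarrow> b 0) (at 0 within {0..})"
          by (simp add: at_within_Ici_at_right)
        then show ?thesis unfolding True by (rule tendsto_within_subset) auto
      next
        case False
        then have t0: "0 < t" using t by simp
        have "eventually (\<lambda>s. 0 \<le> s) (at t)"
          using eventually_at_in_open'[of "{0<..}" t] t0 by (auto elim: eventually_mono)
        then have "(b \<longlongrightarrow> b t) (at t)"
          unfolding b_def using t0 by (intro B_square_tendsto[OF orbit_continuous[OF hX t0] hX]) auto
        then show ?thesis by (rule tendsto_within_subset) auto
      qed
    qed
    then show "continuous_on {0..T} \<phi>" unfolding \<phi>_def by (intro continuous_intros)
    fix t :: real assume t: "0 \<le> t"
    define D' where "D' = 2 * B (S t h) (A (S t h))"
    have uD: "S t h \<in> D" by (rule orbit_derivative(1)[OF h t])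
    have D': "D' \<le> - 2 * b t"
      using dissipative[OF uD D_in[OF uD] A_in[OF uD]] by (simp add: D'_def b_def)
    have e: "((\<lambda>s. (exp (2 * (t + s)) - exp (2 * t)) / s) \<longlongrightarrow> 2 * exp (2 * t)) (at_right 0)"
    proof -
      have "((\<lambda>x. exp (2 * x)) has_real_derivative 2 * exp (2 * t)) (at t)"
        by (auto intro!: derivative_eq_intros)
      then have "((\<lambda>s. (exp (2 * (t + s)) - exp (2 * t)) / s) \<longlongrightarrow> 2 * exp (2 * t)) (at 0)"
        by (simp add: DERIV_def)
      then show ?thesis by (rule tendsto_within_subset) auto
    qed
    have d: "((\<lambda>s. (b (t + s) - b t) / s) \<longlongrightarrow> D') (at_right 0)"
      unfolding b_def D'_def by (rule B_square_derivative[OF h t])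
    have ec: "((\<lambda>s. exp (2 * (t + s))) \<longlongrightarrow> exp (2 * (t + 0))) (at_right 0)"
      by (intro tendsto_intros)
    \<comment> \<open>The product rule for difference quotients, with the exponential taken at t + s
      in one term and b taken at t in the other.\<close>
    have "((\<lambda>s. exp (2 * (t + s)) * ((b (t + s) - b t) / s) + (exp (2 * (t + s)) - exp (2 * t)) / s * b t)
        \<longlongrightarrow> exp (2 * (t + 0)) * D' + 2 * exp (2 * t) * b t) (at_right 0)"
      by (intro tendsto_add tendsto_mult ec d e tendsto_const)
    moreover have "(\<lambda>s. exp (2 * (t + s)) * ((b (t + s) - b t) / s) + (exp (2 * (t + s)) - exp (2 * t)) / s * b t)
        = (\<lambda>s. (\<phi> (t + s) - \<phi> t) / s)"
      by (simp add: \<phi>_def fun_eq_iff diff_divide_distrib add_divide_distrib[symmetric] algebra_simps)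
    moreover have "exp (2 * (t + 0)) * D' + 2 * exp (2 * t) * b t \<le> 0"
    proof -
      have "exp (2 * t) * D' \<le> exp (2 * t) * (- 2 * b t)" by (rule mult_left_mono[OF D']) simp
      then show ?thesis by simp
    qed
    ultimately show "\<exists>D\<le>0. ((\<lambda>s. (\<phi> (t + s) - \<phi> t) / s) \<longlongrightarrow> D) (at_right 0)" by auto
  qed
  moreover have "b 0 = B h h"
  proof -
    have X: "S 0 h \<in> X" by (rule S_in[OF order_refl hX])
    have "B (S 0 h) (S 0 h) = B h (S 0 h)" by (rule B_cong[OF X hX S_0[OF hX] X])
    also have "\<dots> = B (S 0 h) h" by (rule B_commute)
    also have "\<dots> = B h h" by (rule B_cong[OF X hX S_0[OF hX] hX])
    finally show ?thesis by (simp add: b_def)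
  qed
  ultimately have "exp (2 * T) * b T \<le> B h h" by (simp add: \<phi>_def)
  then have "exp (- 2 * T) * (exp (2 * T) * b T) \<le> exp (- 2 * T) * B h h" by (rule mult_left_mono) simp
  then show ?thesis by (simp add: b_def mult.assoc[symmetric] mult_exp_exp)
qed

end

section \<open>From energy decay on the domain to norm decay on the whole space\<close>

section \<open>The spectral gap\<close>

lemma X_function_space: "function_space (X_space k \<mu>) (X_norm k \<mu>)"
  by standard (auto intro: X_space_lincomb(1) X_norm_nonneg X_norm_lincomb X_norm_cong)

theorem lemma3p16:
  fixes \<rho> \<mu> :: real and k :: nat
  assumes "\<rho> > 0" and "0 < \<mu>" and "\<mu> < 2 / \<rho>"
  shows "\<exists>K>0. \<forall>etL :: real \<Rightarrow> (real \<Rightarrow> real) \<Rightarrow> real \<Rightarrow> real.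
           generates_semigroup (X_space k \<mu>) (X_norm k \<mu>) (X_space (k + 1) \<mu>) (coag_L \<rho>) etL \<longrightarrow>
           (\<forall>h0 \<in> X_space k \<mu>. \<forall>t\<ge>0.
              X_norm k \<mu> (etL t h0) \<le> K * X_norm k \<mu> h0 * exp (- t))"
proof -
  define a where "a = 2 / \<rho>"
  \<comment> \<open>The inequality mu/2 < a puts exp (-a y) into the weighted spaces, which is the
    setting of \<open>resolvent_bound\<close>.\<close>
  have \<mu>: "0 < \<mu>" and a: "\<mu> / 2 < a" using assms by (auto simp: a_def)
  let ?X = "X_space k \<mu>" and ?N = "X_norm k \<mu>"
  obtain C where C: "0 \<le> C" "\<And>f g. f \<in> ?X \<Longrightarrow> g \<in> ?X \<Longrightarrow> \<bar>energy k \<mu> a f g\<bar> \<le> C * ?N f * ?N g"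
    using energy_upper[OF \<mu>] by blast
  obtain c where c: "0 \<le> c" "\<And>f. f \<in> ?X \<Longrightarrow> (?N f)\<^sup>2 \<le> c * energy k \<mu> a f f"
    using energy_lower[OF \<mu> a] by blast
  \<comment> \<open>Squared norms decay at rate 2 up to the factor c C from comparing energy and
    norm, hence the square root; the summand 1 makes K positive even if c C = 0.\<close>
  define K where "K = sqrt (c * C) + 1"
  have K: "0 < K" "c * C \<le> K\<^sup>2"
  proof -
    have "0 \<le> c * C" using c(1) C(1) by simp
    then have "sqrt (c * C) ^ 2 \<le> K\<^sup>2" unfolding K_def by (intro power_mono) auto
    with \<open>0 \<le> c * C\<close> show "c * C \<le> K\<^sup>2" by simp
    show "0 < K" using \<open>0 \<le> c * C\<close> by (simp add: K_def add_nonneg_pos)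
  qed
  have "?N (S t h) \<le> K * ?N h * exp (- t)"
    if gen: "generates_semigroup ?X ?N (X_space (k + 1) \<mu>) (coag_L \<rho>) S" and h: "h \<in> ?X" and t: "0 \<le> t" for S h t
  proof -
    interpret dissipative_semigroup ?X ?N "X_space (k + 1) \<mu>" "coag_L \<rho>" S "energy k \<mu> a" C
    proof (intro dissipative_semigroup.intro X_function_space dissipative_semigroup_axioms.intro gen)
      show "energy k \<mu> a h (coag_L \<rho> h) \<le> - energy k \<mu> a h h"
        if "h \<in> X_space (k + 1) \<mu>" "h \<in> ?X" "coag_L \<rho> h \<in> ?X" for h
        using energy_generator[OF a_def assms(1) \<mu>] that by simp
    qed (use C in \<open>auto intro: energy_lincomb_left[OF \<mu>] energy_commute energy_cong[OF \<mu>]\<close>)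
    have decay: "?N (S t d) \<le> K * ?N d * exp (- t)" if d: "d \<in> X_space (k + 1) \<mu>" for d
    proof -
      have dX: "d \<in> ?X" by (rule D_in[OF d])
      have "(?N (S t d))\<^sup>2 \<le> c * energy k \<mu> a (S t d) (S t d)" by (rule c(2)[OF S_in[OF t dX]])
      also have "\<dots> \<le> c * (exp (- 2 * t) * energy k \<mu> a d d)"
        by (intro mult_left_mono B_decay d t c(1))
      also have "\<dots> \<le> c * (exp (- 2 * t) * (C * ?N d * ?N d))"
        using C(2)[OF dX dX] by (intro mult_left_mono c(1)) auto
      also have "\<dots> = (c * C) * (?N d * exp (- t))\<^sup>2"
      proof -
        have "exp (- 2 * t) = (exp (- t))\<^sup>2" by (simp add: power2_eq_square mult_exp_exp)
        then show ?thesis by (simp add: power_mult_distrib power2_eq_square mult.assoc mult.left_commute)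
      qed
      also have "\<dots> \<le> K\<^sup>2 * (?N d * exp (- t))\<^sup>2" by (rule mult_right_mono[OF K(2)]) simp
      finally have "(?N (S t d))\<^sup>2 \<le> (K * (?N d * exp (- t)))\<^sup>2" by (simp only: power_mult_distrib)
      then have "?N (S t d) \<le> K * (?N d * exp (- t))"
        by (rule power2_le_imp_le) (use K(1) N_nonneg in simp)
      then show ?thesis by (simp only: mult.assoc)
    qed
    \<comment> \<open>The growth bound may depend on t: it multiplies only the distance from h to an
      element of the domain, which is arbitrarily small, and K is unaffected.\<close>
    obtain M where M: "0 \<le> M" "\<And>h. h \<in> ?X \<Longrightarrow> ?N (S t h) \<le> M * ?N h" using S_bound[OF t] by blast
    show ?thesis
    proof (rule field_le_epsilon)
      fix e :: real assume e: "0 < e"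
      \<comment> \<open>Collects the two places where the distance r enters: M r from
        \<open>S t\<close> applied to the difference, and K exp (-t) r from comparing the norms of d
        and h.\<close>
      define q where "q = M + K * exp (- t)"
      have q: "0 < q" using M(1) K(1) by (simp add: q_def add_nonneg_pos)
      have sub: "X_space (Suc k) \<mu> \<subseteq> ?X" using D_in by auto
      obtain d where d: "d \<in> X_space (Suc k) \<mu>" "?N (\<lambda>y. 1 * h y + (- 1) * d y) < e / q"
        using X_space_dense[OF h \<mu> _ sub, of "e / q"] e q by auto
      define r where "r = ?N (\<lambda>y. h y - d y)"
      have r: "r < e / q" using d(2) by (simp add: r_def)
      have dD: "d \<in> X_space (k + 1) \<mu>" and dX: "d \<in> ?X" using d(1) sub by auto
      have X: "S t h \<in> ?X" "S t d \<in> ?X" "(\<lambda>y. h y - d y) \<in> ?X"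
        using S_in[OF t] h dX diff_in by auto
      have "?N (S t h) \<le> ?N (\<lambda>y. S t h y - S t d y) + ?N (S t d)"
        using N_lincomb[OF diff_in[OF X(1,2)] X(2), of 1 1] by simp
      also have "?N (\<lambda>y. S t h y - S t d y) \<le> M * r"
        unfolding S_diff[OF t h dX] r_def by (rule M(2)[OF X(3)])
      also have "?N (S t d) \<le> K * ?N d * exp (- t)" by (rule decay[OF dD])
      also have "?N d \<le> ?N h + r"
        using N_lincomb[OF h X(3), of 1 "- 1"] by (simp add: r_def)
      finally have "?N (S t h) \<le> M * r + K * (?N h + r) * exp (- t)"
        using K(1) by (simp add: mult_left_mono mult_right_mono)
      also have "\<dots> = K * ?N h * exp (- t) + q * r" by (simp add: q_def algebra_simps)
      also have "q * r \<le> e" using r q by (simp add: field_simps)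
      finally show "?N (S t h) \<le> K * ?N h * exp (- t) + e" by simp
    qed
  qed
  then show ?thesis using K(1) by blast
qed

end
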